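(* Let $\alpha\in(0,1)\cup(1,\infty)$, and let $\xi_0,\xi_1,\ldots$ be non-degenerate i.i.d. complex-valued random variables such that $\mathbb{E}\log(1+|\xi_0|)<\infty$. Consider the random analytic function $$H_n(z)=\begin{cases}\sum_{k=0}^\infty\xi_k e^{n^{1-\alpha}k^\alpha}z^k, & (\text{case }\alpha<1,\ z\in\mathbb{D}),\\[1mm] \sum_{k=0}^\infty\xi_k e^{-n^{1-\alpha}k^\alpha}z^k, & (\text{case }\alpha>1,\ z\in\mathbb{C}).\end{cases}$$ As $n\to\infty$, the sequence of random measures $\frac1n\mu_{H_n}$ (on $\mathbb{D}$ if $\alpha<1$, on $\mathbb{C}$ if $\alpha>1$) converges in probability to the deterministic measure having the density $$z\mapsto\frac1{2\pi\alpha|1-\alpha|}\,\frac1{|z|^2}\left|\frac{\log|z|}{\alpha}\right|^{\frac{2-\alpha}{\alpha-1}}$$ with respect to the Lebesgue measure, where the density is restricted to $\mathbb{D}$ in the case $\alpha<1$ and to $\mathbb{C}\setminus\mathbb{D}$ (i.e. it is replaced by $0$ on $\mathbb{D}$) in the case $\alpha>1$.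
   Context: A random variable is non-degenerate if it is not almost surely equal to a constant. $\mathbb{D}=\{z\in\mathbb{C}:|z|<1\}$. For an analytic function $G\not\equiv0$, $\mu_G=\sum_{z:G(z)=0}n_G(z)\,\delta_z$ is the measure counting zeros with multiplicity $n_G(z)$. A sequence of random locally finite measures $\mu_n$ on $X$ converges in probability to $\mu$ if $\int_X\varphi\,d\mu_n\to\int_X\varphi\,d\mu$ in probability for every continuous compactly supported $\varphi:X\to\mathbb{R}$. *)

theory Defs
  imports "HOL-Probability.Probability" "HOL-Complex_Analysis.Complex_Analysis"
begin

definition nondegenerate :: "'a measure \<Rightarrow> ('a \<Rightarrow> complex) \<Rightarrow> bool" where
  "nondegenerate M X \<longleftrightarrow> \<not> (\<exists>c. AE \<omega> in M. X \<omega> = c)"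

definition iid :: "'a measure \<Rightarrow> (nat \<Rightarrow> 'a \<Rightarrow> complex) \<Rightarrow> bool" where
  "iid M \<xi> \<longleftrightarrow> prob_space.indep_vars M (\<lambda>_. borel) \<xi> UNIV \<and>
     (\<forall>k. distr M borel (\<xi> k) = distr M borel (\<xi> 0))"

(* Zeros of G in U counted with multiplicity, as a Borel measure on the open set U.
   Intended for G analytic on U and not identically zero; the library's zorder is
   then the multiplicity of a zero. *)
definition zeros_measure :: "complex set \<Rightarrow> (complex \<Rightarrow> complex) \<Rightarrow> complex measure" where
  "zeros_measure U G =
     distr (point_measure {z \<in> U. G z = 0} (\<lambda>z. ennreal (of_int (zorder G z))))
       (restrict_space borel U) (\<lambda>z. z)"

(* Random variables are taken measurable with respect to the completion of M, because the
   variables of interest are built from a random power series that converges only almost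
   surely. Measurability is part of the definition since the library's measure assigns 0 to
   non-measurable sets. *)
definition converges_in_prob ::
    "'a measure \<Rightarrow> (nat \<Rightarrow> 'a \<Rightarrow> real) \<Rightarrow> ('a \<Rightarrow> real) \<Rightarrow> bool" where
  "converges_in_prob M X Y \<longleftrightarrow>
     (\<forall>n. X n \<in> borel_measurable (completion M)) \<and> Y \<in> borel_measurable (completion M) \<and>
     (\<forall>\<epsilon>>0. (\<lambda>n. measure (completion M) {\<omega> \<in> space M. \<bar>X n \<omega> - Y \<omega>\<bar> > \<epsilon>})
        \<longlonglongrightarrow> 0)"

definition locally_finite_on :: "'b::topological_space set \<Rightarrow> 'b measure \<Rightarrow> bool" where
  "locally_finite_on U \<nu> \<longleftrightarrow>
     sets \<nu> = sets (restrict_space borel U) \<and>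
     (\<forall>K. compact K \<and> K \<subseteq> U \<longrightarrow> emeasure \<nu> K < \<infinity>)"

definition test_function :: "'b::topological_space set \<Rightarrow> ('b \<Rightarrow> real) \<Rightarrow> bool" where
  "test_function U \<phi> \<longleftrightarrow> continuous_on U \<phi> \<and>
     (\<exists>K. compact K \<and> K \<subseteq> U \<and> (\<forall>x \<in> U - K. \<phi> x = 0))"

definition measures_converge_in_prob ::
    "'a measure \<Rightarrow> 'b::topological_space set \<Rightarrow> (nat \<Rightarrow> 'a \<Rightarrow> 'b measure) \<Rightarrow>
     ('a \<Rightarrow> 'b measure) \<Rightarrow> bool" where
  "measures_converge_in_prob M U \<nu> \<mu> \<longleftrightarrow>
     (\<forall>n. AE \<omega> in M. locally_finite_on U (\<nu> n \<omega>)) \<and> (AE \<omega> in M. locally_finite_on U (\<mu> \<omega>)) \<and>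
     (\<forall>\<phi>. test_function U \<phi> \<longrightarrow>
        converges_in_prob M (\<lambda>n \<omega>. integral\<^sup>L (\<nu> n \<omega>) \<phi>) (\<lambda>\<omega>. integral\<^sup>L (\<mu> \<omega>) \<phi>))"

definition H :: "real \<Rightarrow> (nat \<Rightarrow> complex) \<Rightarrow> nat \<Rightarrow> complex \<Rightarrow> complex" where
  "H \<alpha> c n z =
     (if \<alpha> < 1
      then \<Sum>k. c k * of_real (exp (real n powr (1 - \<alpha>) * real k powr \<alpha>)) * z ^ k
      else \<Sum>k. c k * of_real (exp (- (real n powr (1 - \<alpha>) * real k powr \<alpha>))) * z ^ k)"

definition H_domain :: "real \<Rightarrow> complex set" where
  "H_domain \<alpha> = (if \<alpha> < 1 then ball 0 1 else UNIV)"

definition limit_density :: "real \<Rightarrow> complex \<Rightarrow> real" where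
  "limit_density \<alpha> z =
     1 / (2 * pi * \<alpha> * \<bar>1 - \<alpha>\<bar>) * (1 / (cmod z)\<^sup>2) *
     \<bar>ln (cmod z) / \<alpha>\<bar> powr ((2 - \<alpha>) / (\<alpha> - 1))"

definition limit_measure :: "real \<Rightarrow> complex measure" where
  "limit_measure \<alpha> =
     density (restrict_space lborel (H_domain \<alpha>))
       (\<lambda>z. ennreal (if \<alpha> > 1 \<and> z \<in> ball 0 1 then 0 else limit_density \<alpha> z))"

end

(* By Jensen's formula, integrating a test function against the difference of two circle averages
   of ln |G| counts the zeros of G against a mollified version of that test function.  So it suffices
   that u_n = ln |H_n| / n converges in probability, in L^1 on compact sets, to a radial potential
   whose Riesz measure is the claimed limit.

   Upper bound: the log moment gives |xi_k| <= C exp(eps k) for all k off an event of small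
   probability, and then |H_n| is at most a geometric series times exp(n potential), the potential
   being the Legendre transform of the growth exponent of the coefficients.

   Lower bound at one point: arbitrarily many terms have modulus exp(n (potential - o(1))), and a
   Gaussian-smoothed characteristic function estimate of Kolmogorov-Rogozin type shows that the sum is
   unlikely to be much smaller than that.

   L^1 convergence: cover a disc by small discs.  On each of them the upper bound is nearly attained at
   the centre, so the sub-mean value property of ln |H_n| leaves no room for a large deficit. *)
theory Submission
  imports Defs
begin

section \<open>Circle averages and Lebesgue measure on the plane\<close>

text \<open>Two circles instead of one: the value at the centre enters Jensen's formula through a
  constant independent of the radius, which cancels in the difference, so centres that are zeros
  cause no trouble. The weight left on the zeros, \<open>jkernel\<close>, is bounded with compact
  support, so L^1 control of u_n suffices. The same identity holds for the potential and the limit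
  measure (\<open>lim_jkernel\<close>), and the two sides are compared without Laplacians or smooth
  test functions.

  The obstacle is that u_n is unbounded below near zeros, while the small-ball estimate controls
  only finitely many fixed points at a time. In the cover the number of discs is at most of order
  h^(-2) and each error is proportional to the area of its disc, so h drops out of the total and can
  be chosen from the modulus of continuity of the potential.

  The analytic part is deterministic and concerns one coefficient sequence that is
  \<open>subexponential\<close>; probability enters only through exceptional events. Measurability
  of the zero counts comes from the two-circle identity once more, by letting its radius tend to
  0.\<close>

abbreviation unif01 :: "real measure" where
  "unif01 \<equiv> restrict_space lborel {0..1}"

abbreviation circ :: "real \<Rightarrow> complex" where
  "circ t \<equiv> cis (2 * pi * t)"

lemma borel_measurable_circ [measurable]: "circ \<in> borel_measurable borel"
  by (intro borel_measurable_continuous_onI continuous_intros)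

lemma borel_measurable_circ_unif01 [measurable]: "circ \<in> borel_measurable unif01"
  by (intro measurable_restrict_space1) simp

interpretation unif01: prob_space unif01
  by (rule prob_space_restrict_space) auto

text \<open>Cauchy's formula is applied on the unit circle to the rescaled function zeta -> h (a + w
  zeta), so a complex radius vector w, including w = 0, is handled without case distinction.\<close>

lemma circ_mean_value:
  assumes h: "h holomorphic_on ball a R" and w: "cmod w < R"
  shows "integrable unif01 (\<lambda>t. h (a + w * circ t))"
    and "(\<integral>t. h (a + w * circ t) \<partial>unif01) = h a"
proof -
  define f where "f = (\<lambda>\<zeta>. h (a + w * \<zeta>))"
  have img: "(\<lambda>\<zeta>. a + w * \<zeta>) ` cball 0 1 \<subseteq> ball a R"
  proof (clarify)
    fix \<zeta> :: complex assume "\<zeta> \<in> cball 0 1"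
    hence "cmod w * cmod \<zeta> \<le> cmod w * 1" by (intro mult_left_mono) auto
    thus "a + w * \<zeta> \<in> ball a R" using w by (simp add: dist_norm norm_mult)
  qed
  have "(h \<circ> (\<lambda>\<zeta>. a + w * \<zeta>)) holomorphic_on cball 0 1"
    by (rule holomorphic_on_compose_gen[OF _ h]) (use img in \<open>auto intro!: holomorphic_intros\<close>)
  hence f: "f holomorphic_on cball 0 1" by (simp add: f_def o_def)
  have cf: "continuous_on (cball 0 1) f" by (rule holomorphic_on_imp_continuous_on[OF f])
  have "((\<lambda>u. f u / (u - 0)) has_contour_integral (2 * of_real pi * \<i> * f 0)) (circlepath 0 1)"
    by (rule Cauchy_integral_circlepath[OF cf]) (auto intro: holomorphic_on_subset[OF f])
  hence "((\<lambda>t. f (circlepath 0 1 t) / circlepath 0 1 t *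
           (2 * pi * \<i> * exp (2 * of_real pi * \<i> * t))) has_integral (2 * of_real pi * \<i> * f 0)) {0..1}"
    unfolding has_contour_integral_def
    by (rule has_integral_eq[rotated]) (simp add: vector_derivative_circlepath01)
  hence "((\<lambda>t. (2 * of_real pi * \<i>) * f (circ t)) has_integral (2 * of_real pi * \<i> * f 0)) {0..1}"
    by (rule has_integral_eq[rotated]) (auto simp: circlepath cis_conv_exp mult_ac)
  hence "((\<lambda>t. inverse (2 * of_real pi * \<i>) * ((2 * of_real pi * \<i>) * f (circ t))) has_integral 
      inverse (2 * of_real pi * \<i>) * (2 * of_real pi * \<i> * f 0)) {0..1}"
    by (rule has_integral_mult_right)
  hence hi: "((\<lambda>t. f (circ t)) has_integral f 0) {0..1}" by (simp add: field_simps)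
  have cont: "continuous_on {0..1} (\<lambda>t. f (circ t))"
    by (rule continuous_on_compose2[OF cf]) (auto intro!: continuous_intros)
  have si: "set_integrable lborel {0..1} (\<lambda>t. f (circ t))"
    unfolding set_integrable_def
    by (rule borel_integrable_compact) (use cont in auto)
  show "integrable unif01 (\<lambda>t. h (a + w * circ t))"
    using si by (subst integrable_restrict_space) (auto simp: f_def set_integrable_def)
  have "(\<integral>t. f (circ t) \<partial>unif01) = (LINT t:{0..1}|lborel. f (circ t))"
    by (subst integral_restrict_space) (auto simp: set_lebesgue_integral_def)
  also have "\<dots> = integral {0..1} (\<lambda>t. f (circ t))"
    by (rule set_borel_integral_eq_integral(2)[OF si])
  also have "\<dots> = f 0" using hi by (rule integral_unique)
  finally show "(\<integral>t. h (a + w * circ t) \<partial>unif01) = h a" by (simp add: f_def)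
qed

section \<open>Rotation invariance of planar Lebesgue measure and polar integration\<close>

definition complex_of_vec :: "real^2 \<Rightarrow> complex" where
  "complex_of_vec v = Complex (v $ 1) (v $ 2)"

lemma complex_of_vec_measurable [measurable]: "complex_of_vec \<in> borel_measurable borel"
proof -
  have "complex_of_vec = (\<lambda>v. of_real (v $ 1) + \<i> * of_real (v $ 2))"
    by (auto simp: complex_of_vec_def complex_eq_iff)
  moreover have "continuous_on UNIV \<dots>" by (intro continuous_intros)
  ultimately show ?thesis by (metis borel_measurable_continuous_onI)
qed

lemma distr_complex_of_vec: "distr lborel borel complex_of_vec = lborel"
proof (rule lborel_eqI[symmetric])
  fix l u :: complex assume lu: "\<And>b. b \<in> Basis \<Longrightarrow> l \<bullet> b \<le> u \<bullet> b"
  have le: "Re l \<le> Re u" "Im l \<le> Im u" using lu[of 1] lu[of \<i>] by (auto simp: Basis_complex_def)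
  define lv uv :: "real^2" where "lv = vector [Re l, Im l]" and "uv = vector [Re u, Im u]"
  have pre: "complex_of_vec -` box l u = box lv uv"
    by (auto simp: complex_of_vec_def box_def Basis_complex_def Basis_vec_def lv_def uv_def
         inner_axis exhaust_2 forall_2)
  have B: "(Basis :: (real^2) set) = {axis 1 1, axis 2 1}"
    by (auto simp: Basis_vec_def UNIV_2)
  have ne: "axis 1 1 \<noteq> (axis 2 1 :: real^2)" by (simp add: axis_eq_axis)
  have "emeasure (distr lborel borel complex_of_vec) (box l u) = emeasure lborel (box lv uv)"
    by (subst emeasure_distr) (auto simp: pre)
  also have "\<dots> = ennreal (\<Prod>b\<in>Basis. (uv - lv) \<bullet> b)"
    using le by (subst emeasure_lborel_box) (auto simp: B inner_axis lv_def uv_def)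
  also have "(\<Prod>b\<in>Basis. (uv - lv) \<bullet> b) = (\<Prod>b\<in>Basis. (u - l) \<bullet> b)"
    using ne by (simp add: B Basis_complex_def inner_axis lv_def uv_def)
  finally show "emeasure (distr lborel borel complex_of_vec) (box l u) = (\<Prod>b\<in>Basis. (u - l) \<bullet> b)" .
qed auto

text \<open>On \<open>real^2\<close> this is the invariance under orthogonal maps. The preimage of a
  box under multiplication by z is the image of the box under the inverse rotation \<open>R\<close>,
  multiplication by the conjugate of z; boxes determine Lebesgue measure.\<close>

lemma distr_lborel_rotation:
  assumes z: "cmod z = 1"
  shows "distr lborel borel (\<lambda>w. z * w) = lborel"
proof (rule lborel_eqI[symmetric])
  fix l u :: complex assume lu: "\<And>b. b \<in> Basis \<Longrightarrow> l \<bullet> b \<le> u \<bullet> b"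
  define vec :: "complex \<Rightarrow> real^2" where "vec w = vector [Re w, Im w]" for w
  have vec [simp]: "complex_of_vec (vec w) = w" "vec (complex_of_vec v) = v" for w v
    by (auto simp: vec_def complex_of_vec_def vec_eq_iff forall_2)
  define R where "R v = vec (cnj z * complex_of_vec v)" for v
  have zz: "z * cnj z = 1" "cnj z * z = 1" using z by (simp_all add: complex_norm_square[symmetric] mult.commute)
  have lin: "linear R"
    by (rule linearI) (auto simp: R_def vec_def complex_of_vec_def vec_eq_iff forall_2 algebra_simps)
  have nvec: "norm (vec w) = cmod w" for w
    by (simp add: norm_vec_def L2_set_def sum_2 vec_def cmod_def)
  have ort: "orthogonal_transformation R"
    unfolding orthogonal_transformation using lin z
    by (simp add: R_def nvec norm_mult) (metis nvec vec(2))
  let ?S = "complex_of_vec -` box l u"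
  have mS: "?S \<in> sets borel"
    using measurable_sets_borel[OF complex_of_vec_measurable, of "box l u"] by simp
  have eS: "emeasure lborel ?S = (\<Prod>b\<in>Basis. (u - l) \<bullet> b)"
    using emeasure_distr[of complex_of_vec lborel borel "box l u"] lu
    by (simp add: distr_complex_of_vec emeasure_lborel_box)
  have lm: "?S \<in> lmeasurable"
    using mS eS by (intro fmeasurableI) auto
  have im: "R ` ?S = complex_of_vec -` ((\<lambda>w. z * w) -` box l u)"
  proof (intro equalityI subsetI)
    fix v assume "v \<in> R ` ?S"
    then obtain v' where "v = R v'" "v' \<in> ?S" by auto
    thus "v \<in> complex_of_vec -` ((\<lambda>w. z * w) -` box l u)"
      by (simp add: R_def mult.assoc[symmetric] zz)
  next
    fix v assume v: "v \<in> complex_of_vec -` ((\<lambda>w. z * w) -` box l u)"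
    have "v = R (vec (z * complex_of_vec v))" by (simp add: R_def mult.assoc[symmetric] zz)
    thus "v \<in> R ` ?S" using v by (intro image_eqI[of _ _ "vec (z * complex_of_vec v)"]) auto
  qed
  have m2: "(\<lambda>w. z * w) -` box l u \<in> sets borel"
    using measurable_sets_borel[of "\<lambda>w. z * w" borel "box l u"] by simp
  have m3: "R ` ?S \<in> sets borel"
    unfolding im using measurable_sets_borel[OF complex_of_vec_measurable m2] .
  have "emeasure (distr lborel borel (\<lambda>w. z * w)) (box l u) = emeasure lborel ((\<lambda>w. z * w) -` box l u)"
    by (subst emeasure_distr) auto
  also have "\<dots> = emeasure (distr lborel borel complex_of_vec) ((\<lambda>w. z * w) -` box l u)"
    by (simp add: distr_complex_of_vec)
  also have "\<dots> = emeasure lborel (R ` ?S)"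
    using m2 by (subst emeasure_distr) (auto simp: im)
  also have "\<dots> = emeasure lebesgue (R ` ?S)" using m3 by simp
  also have "\<dots> = emeasure lebesgue ?S"
    using measure_orthogonal_image[OF ort lm] measurable_orthogonal_image[OF ort lm] lm
    by (simp add: emeasure_eq_measure2)
  also have "\<dots> = emeasure lborel ?S" using mS by simp
  finally show "emeasure (distr lborel borel (\<lambda>w. z * w)) (box l u) = (\<Prod>b\<in>Basis. (u - l) \<bullet> b)"
    using eS by simp
qed auto

text \<open>Polar integration without a Jacobian: each rotation preserves the integral, hence so
  does the mean over all angles, and Tonelli moves the angular mean inside.\<close>

lemma nn_integral_lborel_circle_average:
  fixes f :: "complex \<Rightarrow> ennreal"
  assumes [measurable]: "f \<in> borel_measurable borel"
  shows "(\<integral>\<^sup>+w. f w \<partial>lborel) = (\<integral>\<^sup>+w. (\<integral>\<^sup>+t. f (w * circ t) \<partial>unif01) \<partial>lborel)"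
proof -
  interpret pair_sigma_finite unif01 "lborel :: complex measure" ..
  have "(\<integral>\<^sup>+w. f w \<partial>lborel) = (\<integral>\<^sup>+w. f (w * circ t) \<partial>lborel)" for t
  proof -
    have "(\<integral>\<^sup>+w. f w \<partial>lborel) = (\<integral>\<^sup>+w. f w \<partial>distr lborel borel (\<lambda>w. circ t * w))"
      by (subst distr_lborel_rotation) auto
    also have "\<dots> = (\<integral>\<^sup>+w. f (w * circ t) \<partial>lborel)"
      by (subst nn_integral_distr) (auto simp: mult.commute)
    finally show ?thesis .
  qed
  hence "(\<integral>\<^sup>+w. f w \<partial>lborel) = (\<integral>\<^sup>+t. (\<integral>\<^sup>+w. f (w * circ t) \<partial>lborel) \<partial>unif01)"
    by (simp add: unif01.emeasure_space_1[simplified])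
  also have "\<dots> = (\<integral>\<^sup>+w. (\<integral>\<^sup>+t. f (w * circ t) \<partial>unif01) \<partial>lborel)"
    by (rule Fubini'[symmetric]) measurable
  finally show ?thesis .
qed

lemma nn_integral_lborel_translate:
  fixes f :: "'a::euclidean_space \<Rightarrow> ennreal"
  assumes [measurable]: "f \<in> borel_measurable borel"
  shows "(\<integral>\<^sup>+w. f (a + w) \<partial>lborel) = (\<integral>\<^sup>+w. f w \<partial>lborel)"
  by (subst lborel_distr_plus[of a, symmetric], subst nn_integral_distr) auto

text \<open>The disc is translated to the origin, where its indicator is unaffected by the rotations
  that are averaged over.\<close>

lemma nn_integral_ball_circle_average:
  fixes f :: "complex \<Rightarrow> ennreal"
  assumes [measurable]: "f \<in> borel_measurable borel"
  shows "(\<integral>\<^sup>+w. f w * indicator (ball a h) w \<partial>lborel) =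
     (\<integral>\<^sup>+w. (\<integral>\<^sup>+t. f (a + w * circ t) \<partial>unif01) * indicator (ball 0 h) w \<partial>lborel)"
proof -
  have [measurable]: "ball c r \<in> sets borel" for c :: complex and r by simp
  have "(\<integral>\<^sup>+w. f w * indicator (ball a h) w \<partial>lborel) =
      (\<integral>\<^sup>+w. f (a + w) * indicator (ball a h) (a + w) \<partial>lborel)"
    by (rule nn_integral_lborel_translate[symmetric]) measurable
  also have "\<dots> = (\<integral>\<^sup>+w. f (a + w) * indicator (ball 0 h) w \<partial>lborel)"
    by (intro nn_integral_cong) (auto simp: indicator_def dist_norm)
  also have "\<dots> = (\<integral>\<^sup>+w. (\<integral>\<^sup>+t. f (a + w * circ t) * indicator (ball 0 h) (w * circ t) \<partial>unif01) \<partial>lborel)"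
    by (rule nn_integral_lborel_circle_average) measurable
  also have "\<dots> = (\<integral>\<^sup>+w. (\<integral>\<^sup>+t. f (a + w * circ t) * indicator (ball 0 h) w \<partial>unif01) \<partial>lborel)"
    by (intro nn_integral_cong) (auto simp: indicator_def norm_mult)
  also have "\<dots> = (\<integral>\<^sup>+w. (\<integral>\<^sup>+t. f (a + w * circ t) \<partial>unif01) * indicator (ball 0 h) w \<partial>lborel)"
    by (intro nn_integral_cong nn_integral_multc) measurable
  finally show ?thesis .
qed

lemma emeasure_complex_ball: "r \<ge> 0 \<Longrightarrow> emeasure lborel (ball (c::complex) r) = ennreal (pi * r\<^sup>2)"
  and emeasure_complex_cball: "r \<ge> 0 \<Longrightarrow> emeasure lborel (cball (c::complex) r) = ennreal (pi * r\<^sup>2)"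
  by (simp_all add: emeasure_ball emeasure_cball unit_ball_vol_2)

text \<open>For a \<ge> 0 both sides give \<open>{..a}\<close> the area pi a^2 of a disc, and these
  half-lines generate the Borel sets.\<close>

lemma distr_lborel_cmod:
  "distr lborel borel cmod = density lborel (\<lambda>r. ennreal (2 * pi * r) * indicator {0..} r)" (is "?A = ?B")
proof (rule measure_eqI_generator_eq)
  let ?E = "range (\<lambda>a::real. {..a})"
  have em: "emeasure ?A {..a} = emeasure ?B {..a}" "emeasure ?A {..a} \<noteq> \<infinity>" for a
  proof -
    have 1: "emeasure ?A {..a} = emeasure lborel (cmod -` {..a})"
      by (subst emeasure_distr) auto
    have 2: "emeasure ?B {..a} = (\<integral>\<^sup>+r. ennreal (2 * pi * r) * indicator {0..a} r \<partial>lborel)"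
      by (subst emeasure_density) (auto intro!: nn_integral_cong simp: indicator_def)
    show "emeasure ?A {..a} = emeasure ?B {..a}" "emeasure ?A {..a} \<noteq> \<infinity>"
    proof (atomize (full), cases "a \<ge> 0")
      case True
      have "cmod -` {..a} = cball 0 a" by auto
      hence "emeasure ?A {..a} = ennreal (pi * a\<^sup>2)" using 1 True by (simp add: emeasure_complex_cball)
      moreover have "(\<integral>\<^sup>+r. ennreal (2 * pi * r) * indicator {0..a} r \<partial>lborel) = ennreal (pi * a\<^sup>2 - pi * 0\<^sup>2)"
        by (rule nn_integral_FTC_Icc) (use True in \<open>auto intro!: derivative_eq_intros\<close>)
      ultimately show "emeasure ?A {..a} = emeasure ?B {..a} \<and> emeasure ?A {..a} \<noteq> \<infinity>" using 2 by simp
    next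
      case False
      hence e: "cmod -` {..a} = {}" "{0..a} = {}" by (auto simp: order_trans[OF norm_ge_zero])
      show "emeasure ?A {..a} = emeasure ?B {..a} \<and> emeasure ?A {..a} \<noteq> \<infinity>"
        unfolding 1 2 e by simp
    qed
  qed
  show "Int_stable ?E" by (auto simp: Int_stable_def)
  show "?E \<subseteq> Pow UNIV" by auto
  show "X \<in> ?E \<Longrightarrow> emeasure ?A X = emeasure ?B X" for X using em(1) by auto
  show "sets ?A = sigma_sets UNIV ?E" "sets ?B = sigma_sets UNIV ?E"
    by (simp_all add: borel_eq_atMost)
  show "range (\<lambda>n::nat. {..real n}) \<subseteq> ?E" by auto
  show "(\<Union>n::nat. {..real n}) = UNIV" by (auto intro: real_arch_simple)
  show "emeasure ?A {..real i} \<noteq> \<infinity>" for i by (rule em(2))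
qed

lemma nn_integral_lborel_radial:
  fixes f :: "real \<Rightarrow> ennreal"
  assumes [measurable]: "f \<in> borel_measurable borel"
  shows "(\<integral>\<^sup>+w. f (cmod w) \<partial>lborel) = (\<integral>\<^sup>+r. f r * (ennreal (2 * pi * r) * indicator {0..} r) \<partial>lborel)"
proof -
  have "(\<integral>\<^sup>+w. f (cmod w) \<partial>lborel) = (\<integral>\<^sup>+r. f r \<partial>distr lborel borel cmod)"
    by (subst nn_integral_distr) auto
  thus ?thesis by (simp add: distr_lborel_cmod nn_integral_density mult.commute)
qed

section \<open>Jensen's formula\<close>

text \<open>The radius is a complex vector w, so that integrating the average over w in a disc about
  0 gives the integral of f over the disc about a.\<close>

definition circ_avg :: "(complex \<Rightarrow> real) \<Rightarrow> complex \<Rightarrow> complex \<Rightarrow> real" where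
  "circ_avg f a w = (\<integral>t. f (a + w * circ t) \<partial>unif01)"

text \<open>A zero-free function on a disc has a holomorphic logarithm, so ln |g| is the real part
  of a holomorphic function and inherits the mean value property.\<close>

lemma ln_cmod_circ_mean:
  assumes g: "g holomorphic_on ball a R" and nz: "\<And>z. z \<in> ball a R \<Longrightarrow> g z \<noteq> 0" and w: "cmod w < R"
  shows "integrable unif01 (\<lambda>t. ln (cmod (g (a + w * circ t))))"
    and "circ_avg (\<lambda>z. ln (cmod (g z))) a w = ln (cmod (g a))"
proof -
  obtain h where h: "h holomorphic_on ball a R" "\<And>z. z \<in> ball a R \<Longrightarrow> g z = exp (h z)"
    using contractible_imp_holomorphic_log[OF g convex_imp_contractible[OF convex_ball] nz] by metis
  have ln: "ln (cmod (g z)) = Re (h z)" if "z \<in> ball a R" for z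
    using h(2)[OF that] by simp
  have inb: "a + w * circ t \<in> ball a R" for t using w by (simp add: dist_norm norm_mult)
  have aR: "a \<in> ball a R" using w by (auto simp: le_less_trans[OF norm_ge_zero])
  have i: "integrable unif01 (\<lambda>t. h (a + w * circ t))" by (rule circ_mean_value(1)[OF h(1) w])
  have "integrable unif01 (\<lambda>t. Re (h (a + w * circ t)))" using i by simp
  thus "integrable unif01 (\<lambda>t. ln (cmod (g (a + w * circ t))))" by (simp only: ln[OF inb])
  have "circ_avg (\<lambda>z. ln (cmod (g z))) a w = (\<integral>t. Re (h (a + w * circ t)) \<partial>unif01)"
    by (simp only: circ_avg_def ln[OF inb])
  also have "\<dots> = Re (h a)" using i circ_mean_value(2)[OF h(1) w] by simp
  finally show "circ_avg (\<lambda>z. ln (cmod (g z))) a w = ln (cmod (g a))" using ln aR by simp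
qed

text \<open>Logarithmic potential of the uniform measure on a circle: constant inside, that of a
  point mass outside. Both Jensen's formula and the potential of the limit measure rest on
  it.\<close>

lemma circ_avg_ln_dist:
  assumes ne: "cmod (z - a) \<noteq> cmod w" "w \<noteq> 0"
  shows "integrable unif01 (\<lambda>t. ln (cmod (a + w * circ t - z)))"
    and "circ_avg (\<lambda>u. ln (cmod (u - z))) a w = ln (max (cmod w) (cmod (z - a)))"
proof -
  have "integrable unif01 (\<lambda>t. ln (cmod (a + w * circ t - z))) \<and>
    circ_avg (\<lambda>u. ln (cmod (u - z))) a w = ln (max (cmod w) (cmod (z - a)))"
  proof (cases "cmod w < cmod (z - a)")
    case True
    have nz: "u - z \<noteq> 0" if "u \<in> ball a (cmod (z - a))" for u using that by (auto simp: dist_norm norm_minus_commute)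
    have "(\<lambda>u. u - z) holomorphic_on ball a (cmod (z - a))" by (intro holomorphic_intros)
    from ln_cmod_circ_mean[OF this nz True] show ?thesis using True by (simp add: norm_minus_commute)
  next
    case False
    hence lt: "cmod (cnj (a - z)) < cmod w" using ne by (simp add: norm_minus_commute flip: complex_cnj_diff)
    \<comment> \<open>For z inside the circle, multiplying by the conjugate of \<open>circ t\<close>
      exchanges the roles of w and a - z: the function to be averaged becomes u + cnj w, which is
      zero-free on the disc of radius |w| and has modulus |w| at 0.\<close>
    have eq: "cmod (0 + cnj (a - z) * circ t + cnj w) = cmod (a + w * circ t - z)" for t
    proof -
      have "cmod (a + w * circ t - z) = cmod (cnj (circ t) * (a + w * circ t - z))" by (simp add: norm_mult)
      also have "cnj (circ t) * (a + w * circ t - z) = (a - z) * cnj (circ t) + w"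
        by (simp add: algebra_simps cis_cnj cis_mult)
      also have "\<dots> = cnj (0 + cnj (a - z) * circ t + cnj w)" by simp
      finally show ?thesis by (metis complex_mod_cnj)
    qed
    have nz': "u + cnj w \<noteq> 0" if "u \<in> ball 0 (cmod w)" for u
      using that by (auto simp: add_eq_0_iff) (metis complex_mod_cnj norm_minus_cancel less_irrefl)
    have hol': "(\<lambda>u. u + cnj w) holomorphic_on ball 0 (cmod w)" by (intro holomorphic_intros)
    from ln_cmod_circ_mean[OF hol' nz' lt] have 
      "integrable unif01 (\<lambda>t. ln (cmod (a + w * circ t - z)))"
      "circ_avg (\<lambda>u. ln (cmod (u - z))) a w = ln (cmod w)"
      unfolding circ_avg_def eq by simp_all
    thus ?thesis using False by (simp add: max_def)
  qed
  thus "integrable unif01 (\<lambda>t. ln (cmod (a + w * circ t - z)))"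
    and "circ_avg (\<lambda>u. ln (cmod (u - z))) a w = ln (max (cmod w) (cmod (z - a)))" by auto
qed

lemma zorder_holomorphic_zero:
  assumes "G holomorphic_on S" "open S" "connected S" "z \<in> S" "\<exists>w\<in>S. G w \<noteq> 0"
  shows "if G z = 0 then zorder G z > 0 else zorder G z = 0"
  using zorder_exist_zero[OF assms] by auto

lemma holomorphic_finite_zeros:
  assumes "G holomorphic_on S" "open S" "connected S" "compact K" "K \<subseteq> S" "\<exists>w\<in>S. G w \<noteq> 0"
  shows "finite {z\<in>K. G z = 0}"
proof (cases "G constant_on S")
  case True
  then obtain c where "\<And>z. z \<in> S \<Longrightarrow> G z = c" by (auto simp: constant_on_def)
  hence "{z\<in>K. G z = 0} = {}" using assms(5,6) by fastforce
  thus ?thesis by (simp only: finite.emptyI)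
next
  case False
  show ?thesis by (rule holomorphic_compact_finite_zeros[OF assms(1-5) False])
qed

text \<open>The product over the zeros has the same zeros and orders as G, so the quotient extends
  to a holomorphic function without zeros.\<close>

lemma holomorphic_factor_zeros:
  assumes G: "G holomorphic_on S" "open S" "connected S" and nz: "\<exists>w\<in>S. G w \<noteq> 0"
    and fin: "finite {z\<in>S. G z = 0}" (is "finite ?Z")
  obtains h where "h holomorphic_on S" "\<And>z. z \<in> S \<Longrightarrow> h z \<noteq> 0"
    "\<And>w. w \<in> S \<Longrightarrow> G w = h w * (\<Prod>z\<in>?Z. (w - z) ^ nat (zorder G z))"
proof -
  define F where "F w = (\<Prod>z\<in>?Z. (w - z) ^ nat (zorder G z))" for w
  have ord: "if G z = 0 then zorder G z > 0 else zorder G z = 0" if "z \<in> S" for z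
    by (rule zorder_holomorphic_zero[OF G that nz])
  have F: "F holomorphic_on S" unfolding F_def by (intro holomorphic_intros)
  have F0: "F z = 0 \<longleftrightarrow> G z = 0" if "z \<in> S" for z
    using that fin ord by (auto simp: F_def)
  have eq: "zorder F z = zorder G z" if z: "z \<in> S" for z
  proof (cases "G z = 0")
    case False
    have "F analytic_on {z}" using F G(2) z by (metis analytic_at)
    thus ?thesis using False F0[OF z] ord[OF z] by (simp add: zorder_eq_0I)
  next
    case True
    let ?g = "\<lambda>w. \<Prod>z\<in>?Z - {z}. (w - z) ^ nat (zorder G z)"
    show ?thesis
    proof (rule zorder_eqI[OF G(2) z])
      show "?g holomorphic_on S" by (intro holomorphic_intros)
      show "?g z \<noteq> 0" using fin by auto
      show "F w = ?g w * (w - z) powi zorder G z" if "w \<in> S" "w \<noteq> z" for w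
      proof -
        have "F w = (w - z) ^ nat (zorder G z) * ?g w"
          unfolding F_def by (rule prod.remove) (use fin True z in auto)
        thus ?thesis using ord[OF z] True by (simp add: power_int_def)
      qed
    qed
  qed
  obtain h where "h holomorphic_on S" "\<And>z. z \<in> S \<Longrightarrow> h z \<noteq> 0" "\<And>z. z \<in> S \<Longrightarrow> G z = h z * F z"
    by (rule holomorphic_zorder_factorization[OF G F F0 eq]) (assumption | blast)+
  thus ?thesis using that unfolding F_def by blast
qed

text \<open>The zeros are factored out and each factor is averaged separately. The constant is left
  unspecified so that the centre may itself be a zero; its value is given under
  \<open>G a \<noteq> 0\<close>, which is the form used for the sub-mean value estimate. Only
  finitely many radii, those of circles through a zero, are excluded.\<close>

lemma jensen:
  assumes G: "G holomorphic_on ball a R" and nz: "\<exists>w\<in>ball a R. G w \<noteq> 0" and fin: "finite {z\<in>ball a R. G z = 0}" (is "finite ?Z")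
  shows "\<exists>c. (\<forall>w. w \<noteq> 0 \<and> cmod w < R \<and> (\<forall>z\<in>?Z. cmod (z - a) \<noteq> cmod w) \<longrightarrow>
       integrable unif01 (\<lambda>t. ln (cmod (G (a + w * circ t)))) \<and>
       circ_avg (\<lambda>z. ln (cmod (G z))) a w = c + (\<Sum>z\<in>?Z. zorder G z * ln (max (cmod w) (cmod (z - a))))) \<and>
    (R > 0 \<and> G a \<noteq> 0 \<longrightarrow> c = ln (cmod (G a)) - (\<Sum>z\<in>?Z. zorder G z * ln (cmod (z - a))))"
proof -
  obtain h where h: "h holomorphic_on ball a R" "\<And>z. z \<in> ball a R \<Longrightarrow> h z \<noteq> 0"
    "\<And>w. w \<in> ball a R \<Longrightarrow> G w = h w * (\<Prod>z\<in>?Z. (w - z) ^ nat (zorder G z))"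
    by (rule holomorphic_factor_zeros[OF G open_ball connected_ball nz fin]) (assumption | blast)+
  have ord: "real (nat (zorder G z)) = zorder G z" if "z \<in> ?Z" for z
    using zorder_holomorphic_zero[OF G open_ball connected_ball _ nz, of z] that by auto
  have lnG: "ln (cmod (G w)) = ln (cmod (h w)) + (\<Sum>z\<in>?Z. zorder G z * ln (cmod (w - z)))"
    if w: "w \<in> ball a R" "G w \<noteq> 0" for w
  proof -
    have ne: "w \<noteq> z" if "z \<in> ?Z" for z using that w by auto
    have "ln (cmod (G w)) = ln (cmod (h w) * (\<Prod>z\<in>?Z. cmod (w - z) ^ nat (zorder G z)))"
      using h(3)[OF w(1)] by (simp add: norm_mult norm_power flip: prod_norm)
    also have "\<dots> = ln (cmod (h w)) + ln (\<Prod>z\<in>?Z. cmod (w - z) ^ nat (zorder G z))"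
      using h(2)[OF w(1)] fin ne by (intro ln_mult_pos) (auto intro!: prod_pos)
    also have "ln (\<Prod>z\<in>?Z. cmod (w - z) ^ nat (zorder G z)) = (\<Sum>z\<in>?Z. ln (cmod (w - z) ^ nat (zorder G z)))"
      using ne by (intro ln_prod) (use fin in auto)
    also have "\<dots> = (\<Sum>z\<in>?Z. zorder G z * ln (cmod (w - z)))"
      by (intro sum.cong refl) (use ne ord in \<open>auto simp: ln_realpow\<close>)
    finally show ?thesis .
  qed
  show ?thesis
  proof (intro exI[of _ "ln (cmod (h a))"] conjI allI impI; (elim conjE)?)
    fix w assume w: "w \<noteq> 0" "cmod w < R" and wZ: "\<forall>z\<in>?Z. cmod (z - a) \<noteq> cmod w"
    have inb: "a + w * circ t \<in> ball a R" for t using w by (simp add: dist_norm norm_mult)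
    have Gn: "G (a + w * circ t) \<noteq> 0" for t
      using bspec[OF wZ, of "a + w * circ t"] inb[of t] by (auto simp: norm_mult)
    note lnGt = lnG[OF inb Gn]
    note i1 = ln_cmod_circ_mean[OF h(1,2) w(2)]
    note i2 = circ_avg_ln_dist[OF bspec[OF wZ] w(1)]
    show int: "integrable unif01 (\<lambda>t. ln (cmod (G (a + w * circ t))))"
      unfolding lnGt by (intro Bochner_Integration.integrable_add i1 Bochner_Integration.integrable_sum integrable_mult_right i2)
    have "circ_avg (\<lambda>z. ln (cmod (G z))) a w = 
       (\<integral>t. ln (cmod (h (a + w * circ t))) + (\<Sum>z\<in>?Z. zorder G z * ln (cmod (a + w * circ t - z))) \<partial>unif01)"
      unfolding circ_avg_def lnGt ..
    also have "\<dots> = circ_avg (\<lambda>z. ln (cmod (h z))) a w + (\<Sum>z\<in>?Z. zorder G z * circ_avg (\<lambda>u. ln (cmod (u - z))) a w)"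
      unfolding circ_avg_def using i1 i2
      by (subst Bochner_Integration.integral_add) (auto intro!: Bochner_Integration.integrable_sum integrable_mult_right)
    also have "\<dots> = ln (cmod (h a)) + (\<Sum>z\<in>?Z. zorder G z * ln (max (cmod w) (cmod (z - a))))"
      using i1 i2 by simp
    finally show "circ_avg (\<lambda>z. ln (cmod (G z))) a w = 
      ln (cmod (h a)) + (\<Sum>z\<in>?Z. zorder G z * ln (max (cmod w) (cmod (z - a))))" .
  next
    assume "R > 0" "G a \<noteq> 0"
    thus "ln (cmod (h a)) = ln (cmod (G a)) - (\<Sum>z\<in>?Z. zorder G z * ln (cmod (z - a)))"
      using lnG[of a] by (simp add: norm_minus_commute)
  qed
qed

text \<open>Difference of the logarithmic potentials of the uniform measures on the circles of
  radius r and r / 2, at distance x from their common centre: equal to ln 2 up to r / 2, decreasing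
  from there, and 0 from r on.\<close>

definition jkernel :: "real \<Rightarrow> real \<Rightarrow> real" where
  "jkernel r x = ln (max r x) - ln (max (r / 2) x)"

lemma jkernel_nonneg: "r > 0 \<Longrightarrow> 0 \<le> jkernel r x"
  by (auto simp: jkernel_def)

lemma jkernel_le:
  assumes "r > 0" shows "jkernel r x \<le> ln 2"
proof -
  have "ln (max r x) \<le> ln (2 * max (r / 2) x)" using assms by (intro ln_mono) auto
  also have "\<dots> = ln 2 + ln (max (r / 2) x)" using assms by (intro ln_mult_pos) auto
  finally show ?thesis by (simp add: jkernel_def)
qed

lemma jkernel_eq_0: "r > 0 \<Longrightarrow> x \<ge> r \<Longrightarrow> jkernel r x = 0"
  by (auto simp: jkernel_def max_def)

lemma jkernel_eq_ln2: "r > 0 \<Longrightarrow> x \<le> r / 2 \<Longrightarrow> jkernel r x = ln 2"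
  by (simp add: jkernel_def max_absorb1 ln_div)

lemma measurable_jkernel [measurable]: "jkernel r \<in> borel_measurable borel"
  unfolding jkernel_def by measurable

text \<open>Circles are null sets. This discards the points for which some circle would pass through
  a singularity of the logarithm.\<close>

lemma AE_cmod_notin_finite:
  assumes "finite D"
  shows "AE w in lborel. cmod (w - c) \<notin> D"
proof -
  have "sphere c r \<in> null_sets lborel" for r
    using negligible_sphere[of c r]
    by (auto simp: null_sets_completion_iff negligible_iff_null_sets negligible_convex_frontier)
  hence "(\<Union>r\<in>D. sphere c r) \<in> null_sets lborel" using assms by auto
  from AE_not_in[OF this] show ?thesis
    by eventually_elim (auto simp: dist_norm norm_minus_commute)
qed

text \<open>Subtracting Jensen's formula for two radii removes its constant. Zeros at distance at
  least r from the centre have kernel 0, so only those in \<open>ball a r\<close> remain.\<close>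

lemma jensen_jkernel:
  assumes G: "G holomorphic_on ball a R" and nz: "\<exists>w\<in>ball a R. G w \<noteq> 0" and r: "0 < r" "r < R"
    and circ: "\<And>z. \<lbrakk>z \<in> ball a R; G z = 0\<rbrakk> \<Longrightarrow> cmod (z - a) \<notin> {r, r / 2}"
  shows "circ_avg (\<lambda>z. ln (cmod (G z))) a (of_real r) - circ_avg (\<lambda>z. ln (cmod (G z))) a (of_real (r / 2)) =
    (\<Sum>z | z \<in> ball a r \<and> G z = 0. zorder G z * jkernel r (cmod (z - a)))"
    and "\<rho> \<in> {r, r / 2} \<Longrightarrow> integrable unif01 (\<lambda>t. ln (cmod (G (a + of_real \<rho> * circ t))))"
proof -
  \<comment> \<open>\<open>G\<close> may have infinitely many zeros in \<open>ball a R\<close>; the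
    smaller disc has compact closure inside it and hence only finitely many.\<close>
  obtain R' where R': "r < R'" "R' < R" using dense[OF r(2)] by auto
  have G': "G holomorphic_on ball a R'" by (rule holomorphic_on_subset[OF G]) (use R' in auto)
  let ?Z = "{z\<in>ball a R'. G z = 0}"
  have "finite {z\<in>cball a R'. G z = 0}"
    by (rule holomorphic_finite_zeros[OF G open_ball connected_ball _ _ nz]) (use R' in auto)
  hence fin: "finite ?Z" by (rule rev_finite_subset) auto
  have nz': "\<exists>w\<in>ball a R'. G w \<noteq> 0"
  proof (rule ccontr)
    assume "\<not> ?thesis"
    hence "ball a R' \<subseteq> ?Z" by auto
    hence "finite (ball a R')" using fin by (rule finite_subset)
    moreover have "uncountable (ball a R')" using R' r by (intro uncountable_ball) simp
    ultimately show False using countable_finite by blast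
  qed
  obtain c where c: "\<forall>w. w \<noteq> 0 \<and> cmod w < R' \<and> (\<forall>z\<in>?Z. cmod (z - a) \<noteq> cmod w) \<longrightarrow>
       integrable unif01 (\<lambda>t. ln (cmod (G (a + w * circ t)))) \<and>
       circ_avg (\<lambda>z. ln (cmod (G z))) a w = c + (\<Sum>z\<in>?Z. zorder G z * ln (max (cmod w) (cmod (z - a))))"
    using jensen[OF G' nz' fin] by blast
  note i = conjunct1[OF c[rule_format]] and c = conjunct2[OF c[rule_format]]
  have circ': "cmod (z - a) \<notin> {r, r / 2}" if "z \<in> ?Z" for z using circ that R' by auto
  show "integrable unif01 (\<lambda>t. ln (cmod (G (a + of_real \<rho> * circ t))))" if "\<rho> \<in> {r, r / 2}"
    using that r R' circ' by (intro i) auto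
  have "circ_avg (\<lambda>z. ln (cmod (G z))) a (of_real r) - circ_avg (\<lambda>z. ln (cmod (G z))) a (of_real (r / 2)) =
     (\<Sum>z\<in>?Z. zorder G z * ln (max r (cmod (z - a)))) - (\<Sum>z\<in>?Z. zorder G z * ln (max (r / 2) (cmod (z - a))))"
    using r R' circ' by (subst (1 2) c) (auto simp: norm_divide)
  also have "\<dots> = (\<Sum>z\<in>?Z. zorder G z * jkernel r (cmod (z - a)))"
    by (simp add: jkernel_def sum_subtractf right_diff_distrib)
  also have "\<dots> = (\<Sum>z | z \<in> ball a r \<and> G z = 0. zorder G z * jkernel r (cmod (z - a)))"
    by (rule sum.mono_neutral_right[OF fin])
       (use r R' in \<open>auto simp: dist_norm norm_minus_commute intro!: jkernel_eq_0\<close>)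
  finally show "circ_avg (\<lambda>z. ln (cmod (G z))) a (of_real r) - circ_avg (\<lambda>z. ln (cmod (G z))) a (of_real (r / 2)) =
    (\<Sum>z | z \<in> ball a r \<and> G z = 0. zorder G z * jkernel r (cmod (z - a)))" .
qed

text \<open>The sub-mean value inequality turns a lower bound for \<open>ln |G|\<close> at the centre into
  an \<open>L\<^sup>1\<close> bound on the disc.\<close>

lemma nn_integral_upper_gap_ball:
  assumes G: "G holomorphic_on ball a R" and h: "0 < h" "h < R" and Ga: "G a \<noteq> 0"
    and meas [measurable]: "G \<in> borel_measurable borel"
    and bd: "\<And>w. w \<in> ball a h \<Longrightarrow> cmod (G w) \<le> exp B"
  shows "(\<integral>\<^sup>+w. ennreal (B - ln (cmod (G w))) * indicator (ball a h) w \<partial>lborel)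
     \<le> ennreal (pi * h\<^sup>2 * (B - ln (cmod (G a))))"
proof -
  let ?Z = "{z\<in>ball a h. G z = 0}"
  have nz: "\<exists>w\<in>ball a R. G w \<noteq> 0" "\<exists>w\<in>ball a h. G w \<noteq> 0" using Ga h by (auto intro!: bexI[of _ a])
  have "finite {z\<in>cball a h. G z = 0}"
    by (rule holomorphic_finite_zeros[OF G open_ball connected_ball _ _ nz(1)]) (use h in auto)
  hence fin: "finite ?Z" by (rule rev_finite_subset) auto
  have G': "G holomorphic_on ball a h" by (rule holomorphic_on_subset[OF G]) (use h in auto)
  obtain c where c: "\<forall>w. w \<noteq> 0 \<and> cmod w < h \<and> (\<forall>z\<in>?Z. cmod (z - a) \<noteq> cmod w) \<longrightarrow>
       integrable unif01 (\<lambda>t. ln (cmod (G (a + w * circ t)))) \<and>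
       circ_avg (\<lambda>z. ln (cmod (G z))) a w = c + (\<Sum>z\<in>?Z. zorder G z * ln (max (cmod w) (cmod (z - a))))"
    and c3: "c = ln (cmod (G a)) - (\<Sum>z\<in>?Z. zorder G z * ln (cmod (z - a)))"
    using jensen[OF G' nz(2) fin] Ga h by blast
  \<comment> \<open>For almost every radius vector the circle avoids the zeros. Replacing |z - a| by
    the maximum of |w| and |z - a| in Jensen's formula then only raises the mean of ln |G| above its
    value at the centre.\<close>
  have inner: "(\<integral>\<^sup>+t. ennreal (B - ln (cmod (G (a + w * circ t)))) \<partial>unif01) \<le> ennreal (B - ln (cmod (G a)))"
    if w: "w \<in> ball 0 h" "cmod (w - 0) \<notin> insert 0 ((\<lambda>z. cmod (z - a)) ` ?Z)" for w
  proof -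
    have w': "w \<noteq> 0" "cmod w < h" "\<And>z. z \<in> ?Z \<Longrightarrow> cmod (z - a) \<noteq> cmod w"
      using w by (auto simp: image_iff)
    have inb: "a + w * circ t \<in> ball a h" for t using w by (simp add: dist_norm norm_mult)
    have Gn: "G (a + w * circ t) \<noteq> 0" for t
      using w'(3)[of "a + w * circ t"] inb[of t] by (auto simp: norm_mult)
    have le: "ln (cmod (G (a + w * circ t))) \<le> B" for t
      using bd[OF inb, of t] Gn[of t] by (metis ln_exp ln_mono zero_less_norm_iff)
    have w'': "w \<noteq> 0 \<and> cmod w < h \<and> (\<forall>z\<in>?Z. cmod (z - a) \<noteq> cmod w)" using w' by blast
    note i = conjunct1[OF c[rule_format, OF w'']] and avg = conjunct2[OF c[rule_format, OF w'']]
    have "(\<integral>\<^sup>+t. ennreal (B - ln (cmod (G (a + w * circ t)))) \<partial>unif01) = 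
       ennreal (\<integral>t. B - ln (cmod (G (a + w * circ t))) \<partial>unif01)"
      using i le by (intro nn_integral_eq_integral) auto
    also have "(\<integral>t. B - ln (cmod (G (a + w * circ t))) \<partial>unif01) = B - circ_avg (\<lambda>z. ln (cmod (G z))) a w"
      using i unif01.prob_space by (simp add: circ_avg_def)
    also have "\<dots> \<le> B - ln (cmod (G a))"
    proof -
      have "(\<Sum>z\<in>?Z. zorder G z * ln (cmod (z - a))) \<le> (\<Sum>z\<in>?Z. zorder G z * ln (max (cmod w) (cmod (z - a))))"
      proof (intro sum_mono mult_left_mono)
        fix z assume z: "z \<in> ?Z"
        thus "ln (cmod (z - a)) \<le> ln (max (cmod w) (cmod (z - a)))"
          using Ga by (intro ln_mono) auto
        show "0 \<le> real_of_int (zorder G z)"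
          using zorder_holomorphic_zero[OF G' open_ball connected_ball _ nz(2), of z] z by auto
      qed
      thus ?thesis using avg c3 by simp
    qed
    finally show ?thesis by (simp add: ennreal_leI)
  qed
  have "(\<integral>\<^sup>+w. ennreal (B - ln (cmod (G w))) * indicator (ball a h) w \<partial>lborel) =
     (\<integral>\<^sup>+w. (\<integral>\<^sup>+t. ennreal (B - ln (cmod (G (a + w * circ t)))) \<partial>unif01) * indicator (ball 0 h) w \<partial>lborel)"
    by (rule nn_integral_ball_circle_average) measurable
  also have "\<dots> \<le> (\<integral>\<^sup>+w. ennreal (B - ln (cmod (G a))) * indicator (ball (0::complex) h) w \<partial>lborel)"
  proof (rule nn_integral_mono_AE)
    have "AE w in lborel. cmod (w - 0) \<notin> insert 0 ((\<lambda>z. cmod (z - a)) ` ?Z)"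
      by (rule AE_cmod_notin_finite) (use fin in auto)
    thus "AE w in lborel. (\<integral>\<^sup>+t. ennreal (B - ln (cmod (G (a + w * circ t)))) \<partial>unif01) * indicator (ball 0 h) w
      \<le> ennreal (B - ln (cmod (G a))) * indicator (ball (0::complex) h) w"
      by eventually_elim (use inner in \<open>auto simp: indicator_def\<close>)
  qed
  also have "\<dots> = ennreal (B - ln (cmod (G a))) * ennreal (pi * h\<^sup>2)"
    using h by (subst nn_integral_cmult_indicator) (auto simp: emeasure_complex_ball)
  also have "\<dots> = ennreal (pi * h\<^sup>2 * (B - ln (cmod (G a))))"
  proof -
    have "ln (cmod (G a)) \<le> B" using bd[of a] h Ga by (metis centre_in_ball ln_exp ln_mono zero_less_norm_iff)
    thus ?thesis by (subst ennreal_mult[symmetric]) (auto simp: mult.commute)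
  qed
  finally show ?thesis .
qed

section \<open>Anti-concentration of random sums\<close>

locale iid_nondegenerate = prob_space M for M :: "'a measure" +
  fixes \<xi> :: "nat \<Rightarrow> 'a \<Rightarrow> complex"
  assumes iid: "iid M \<xi>" and nondeg: "nondegenerate M (\<xi> 0)"

abbreviation gauss2 :: "(real \<times> real) measure" where
  "gauss2 \<equiv> std_normal_distribution \<Otimes>\<^sub>M std_normal_distribution"

text \<open>Inner product of a frequency vector with a complex number read as a point of the
  plane.\<close>

definition pairing :: "real \<times> real \<Rightarrow> complex \<Rightarrow> real" where
  "pairing v z = fst v * Re z + snd v * Im z"

lemma pairing_add: "pairing v (x + y) = pairing v x + pairing v y"
  and pairing_minus: "pairing v (- x) = - pairing v x"
  and pairing_0 [simp]: "pairing v 0 = 0"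
  by (simp_all add: pairing_def algebra_simps)

lemma pairing_sum: "pairing v (\<Sum>k\<in>A. f k) = (\<Sum>k\<in>A. pairing v (f k))"
  by (induction A rule: infinite_finite_induct) (simp_all add: pairing_add)

lemma measurable_pairing [measurable (raw)]:
  "f \<in> M \<rightarrow>\<^sub>M borel \<Otimes>\<^sub>M borel \<Longrightarrow> g \<in> borel_measurable M \<Longrightarrow> (\<lambda>x. pairing (f x) (g x)) \<in> borel_measurable M"
proof -
  have [measurable]: "Re \<in> borel_measurable borel" "Im \<in> borel_measurable borel"
    by (intro borel_measurable_continuous_onI continuous_intros)+
  assume [measurable]: "f \<in> M \<rightarrow>\<^sub>M borel \<Otimes>\<^sub>M borel" "g \<in> borel_measurable M"
  show ?thesis unfolding pairing_def by measurable
qed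

lemma measurable_cis [measurable (raw)]:
  "f \<in> borel_measurable M \<Longrightarrow> (\<lambda>x. cis (f x)) \<in> borel_measurable M"
  by (rule measurable_compose[of f M borel]) (auto intro!: borel_measurable_continuous_onI continuous_intros)

lemma prob_space_std_normal: "prob_space std_normal_distribution"
  using real_dist_normal_dist real_distribution.axioms(1) by blast

interpretation gauss1: prob_space std_normal_distribution by (rule prob_space_std_normal)
interpretation gauss2: pair_prob_space std_normal_distribution std_normal_distribution ..

lemma integrable_unit_bounded:
  fixes f :: "_ \<Rightarrow> 'b::{banach,second_countable_topology}"
  assumes "prob_space N" "f \<in> borel_measurable N" "\<And>x. norm (f x) \<le> 1"
  shows "integrable N f"
proof -
  interpret prob_space N by fact
  show ?thesis using assms by (intro integrable_const_bound[where B=1]) auto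
qed

lemma gauss2_char: "(\<integral>v. cis (pairing v z) \<partial>gauss2) = of_real (exp (- (cmod z)\<^sup>2 / 2))"
proof -
  have c: "(\<integral>x. cis (x * t) \<partial>std_normal_distribution) = of_real (exp (- t\<^sup>2 / 2))" for t
    using fun_cong[OF char_std_normal_distribution, of t] by (simp add: char_def cis_conv_exp mult.commute)
  have i: "integrable gauss2 (\<lambda>v. cis (pairing v z))"
    by (intro integrable_unit_bounded gauss2.prob_space_axioms) (auto simp: sets_pair_measure_cong)
  have "(\<integral>v. cis (pairing v z) \<partial>gauss2) = 
      (\<integral>x. (\<integral>y. cis (x * Re z) * cis (y * Im z) \<partial>std_normal_distribution) \<partial>std_normal_distribution)"
    using gauss2.integral_fst'[OF i] by (simp add: pairing_def cis_mult)
  also have "\<dots> = of_real (exp (- (Re z)\<^sup>2 / 2)) * of_real (exp (- (Im z)\<^sup>2 / 2))"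
    by (simp add: c)
  also have "\<dots> = of_real (exp (- (cmod z)\<^sup>2 / 2))"
    by (simp add: cmod_power2 field_simps flip: exp_add of_real_mult)
  finally show ?thesis .
qed

text \<open>The Gaussian is its own Fourier transform. Fubini therefore turns a smooth substitute
  for the indicator of small |X| into a Gaussian mean of the characteristic function of X, which
  factorises over independent summands.\<close>

lemma (in prob_space) expectation_gauss:
  assumes [measurable]: "X \<in> borel_measurable M"
  shows "of_real (expectation (\<lambda>\<omega>. exp (- (cmod (X \<omega>))\<^sup>2 / 2))) =
    (\<integral>v. expectation (\<lambda>\<omega>. cis (pairing v (X \<omega>))) \<partial>gauss2)"
proof -
  interpret P: pair_prob_space gauss2 M ..
  have "of_real (expectation (\<lambda>\<omega>. exp (- (cmod (X \<omega>))\<^sup>2 / 2))) = 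
     expectation (\<lambda>\<omega>. \<integral>v. cis (pairing v (X \<omega>)) \<partial>gauss2)"
    by (simp add: gauss2_char)
  also have "\<dots> = (\<integral>v. expectation (\<lambda>\<omega>. cis (pairing v (X \<omega>))) \<partial>gauss2)"
  proof (rule P.Fubini_integral)
    show "integrable (gauss2 \<Otimes>\<^sub>M M) (\<lambda>(v, \<omega>). cis (pairing v (X \<omega>)))"
    proof (rule integrable_unit_bounded[OF P.prob_space_axioms])
      have [measurable]: "(\<lambda>x. fst x) \<in> gauss2 \<Otimes>\<^sub>M M \<rightarrow>\<^sub>M borel \<Otimes>\<^sub>M borel"
        using measurable_fst[of gauss2 M] by (simp cong: measurable_cong_sets sets_pair_measure_cong)
      show "(\<lambda>(v, \<omega>). cis (pairing v (X \<omega>))) \<in> borel_measurable (gauss2 \<Otimes>\<^sub>M M)"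
        unfolding split_beta by measurable
    qed auto
  qed
  finally show ?thesis .
qed

section \<open>Characteristic functions of the coefficients and symmetrised random walks\<close>

context iid_nondegenerate
begin

lemma measurable_\<xi> [measurable]: "\<xi> k \<in> borel_measurable M"
  using iid unfolding iid_def indep_vars_def by auto

lemma expectation_identical:
  fixes f :: "complex \<Rightarrow> 'b::{banach,second_countable_topology}"
  assumes [measurable]: "f \<in> borel_measurable borel"
  shows "expectation (\<lambda>\<omega>. f (\<xi> k \<omega>)) = expectation (\<lambda>\<omega>. f (\<xi> 0 \<omega>))"
proof -
  have "distr M borel (\<xi> k) = distr M borel (\<xi> 0)" using iid by (auto simp: iid_def)
  hence "(\<integral>x. f x \<partial>distr M borel (\<xi> k)) = (\<integral>x. f x \<partial>distr M borel (\<xi> 0))" by simp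
  thus ?thesis by (subst (asm) (1 2) integral_distr) auto
qed

definition cf :: "complex \<Rightarrow> real \<times> real \<Rightarrow> complex" where
  "cf b v = expectation (\<lambda>\<omega>. cis (pairing v (b * \<xi> 0 \<omega>)))"

lemma norm_cf_le: "cmod (cf b v) \<le> 1"
proof -
  have "cmod (cf b v) \<le> expectation (\<lambda>\<omega>. cmod (cis (pairing v (b * \<xi> 0 \<omega>))))"
    unfolding cf_def by (rule integral_norm_bound)
  thus ?thesis by (simp add: prob_space)
qed

lemma cf_uminus: "cf (- b) v = cnj (cf b v)"
proof -
  have "cf (- b) v = expectation (\<lambda>\<omega>. cnj (cis (pairing v (b * \<xi> 0 \<omega>))))"
    by (simp add: cf_def pairing_minus cis_cnj)
  thus ?thesis by (simp add: cf_def)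
qed

lemma measurable_cf [measurable]: "cf b \<in> borel_measurable gauss2"
proof -
  have [measurable]: "(\<lambda>x. fst x) \<in> gauss2 \<Otimes>\<^sub>M M \<rightarrow>\<^sub>M borel \<Otimes>\<^sub>M borel"
    using measurable_fst[of gauss2 M] by (simp cong: measurable_cong_sets sets_pair_measure_cong)
  have "(\<lambda>(v, \<omega>). cis (pairing v (b * \<xi> 0 \<omega>))) \<in> borel_measurable (gauss2 \<Otimes>\<^sub>M M)"
    unfolding split_beta by measurable
  thus ?thesis unfolding cf_def[abs_def] by (rule borel_measurable_lebesgue_integral)
qed

lemma cf_sum:
  "expectation (\<lambda>\<omega>. cis (pairing v (\<Sum>k<N. b k * \<xi> k \<omega>))) = (\<Prod>k<N. cf (b k) v)"
proof -
  have ind: "indep_vars (\<lambda>_. borel) (\<lambda>k \<omega>. cis (pairing v (b k * \<xi> k \<omega>))) {..<N}"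
  proof (rule indep_vars_compose2[where X = \<xi> and M' = "\<lambda>_. borel"])
    show "indep_vars (\<lambda>_. borel) \<xi> {..<N}"
      using iid indep_vars_subset unfolding iid_def by blast
  qed (auto simp: pairing_def)
  have "expectation (\<lambda>\<omega>. cis (pairing v (\<Sum>k<N. b k * \<xi> k \<omega>))) = 
     expectation (\<lambda>\<omega>. \<Prod>k<N. cis (pairing v (b k * \<xi> k \<omega>)))"
    by (simp add: pairing_sum cis_conv_exp sum_distrib_left exp_sum)
  also have "\<dots> = (\<Prod>k<N. expectation (\<lambda>\<omega>. cis (pairing v (b k * \<xi> k \<omega>))))"
    by (rule indep_vars_lebesgue_integral[OF _ ind])
       (auto intro!: integrable_unit_bounded[OF prob_space_axioms] simp: pairing_def)
  also have "\<dots> = (\<Prod>k<N. cf (b k) v)"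
    unfolding cf_def by (intro prod.cong refl expectation_identical) (auto simp: pairing_def)
  finally show ?thesis .
qed

text \<open>The signs alternate so that the characteristic function of the walk is
  |\<open>cf\<close>|^(2j), hence real and nonnegative. The resulting number bounds the Gaussian
  functional of every sum that has 2 j coefficients of modulus at least 1.\<close>

definition gauss_walk :: "nat \<Rightarrow> real" where
  "gauss_walk j = expectation (\<lambda>\<omega>. exp (- (cmod (\<Sum>k<2*j. (-1) ^ k * \<xi> k \<omega>))\<^sup>2 / 2))"

text \<open>Consecutive factors pair up as \<open>cf b v\<close> times its conjugate.\<close>

lemma prod_alternating: "(\<Prod>k<2*j. cf ((-1) ^ k * b) v) = of_real (cmod (cf b v) ^ (2*j))"
proof (induction j)
  case (Suc j)
  have "2 * Suc j = Suc (Suc (2 * j))" by simp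
  hence "(\<Prod>k<2*Suc j. cf ((-1) ^ k * b) v) = (\<Prod>k<2*j. cf ((-1) ^ k * b) v) * (cf b v * cnj (cf b v))"
    by (simp only: prod.lessThan_Suc) (simp add: cf_uminus mult_ac)
  also have "\<dots> = of_real (cmod (cf b v) ^ (2*Suc j))"
    unfolding Suc complex_norm_square[symmetric] by (simp add: power_mult power2_eq_square power_add)
  finally show ?case .
qed auto

lemma alternating_cf:
  "expectation (\<lambda>\<omega>. cis (pairing v (b * (\<Sum>k<2*j. (-1) ^ k * \<xi> k \<omega>)))) = of_real (cmod (cf b v) ^ (2*j))"
proof -
  have "b * (\<Sum>k<2*j. (-1) ^ k * \<xi> k \<omega>) = (\<Sum>k<2*j. (-1) ^ k * b * \<xi> k \<omega>)" for \<omega>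
    by (simp only: sum_distrib_left mult_ac)
  thus ?thesis by (simp only: cf_sum prod_alternating)
qed

lemma integral_cf_power:
  "(\<integral>v. cmod (cf b v) ^ (2*j) \<partial>gauss2) =
     expectation (\<lambda>\<omega>. exp (- (cmod (b * (\<Sum>k<2*j. (-1) ^ k * \<xi> k \<omega>)))\<^sup>2 / 2))"
proof -
  have "complex_of_real (expectation (\<lambda>\<omega>. exp (- (cmod (b * (\<Sum>k<2*j. (-1) ^ k * \<xi> k \<omega>)))\<^sup>2 / 2))) =
     (\<integral>v. complex_of_real (cmod (cf b v) ^ (2*j)) \<partial>gauss2)"
    by (subst expectation_gauss) (auto simp: alternating_cf simp del: of_real_power)
  thus ?thesis by (simp only: integral_complex_of_real of_real_eq_iff)
qed

text \<open>Scaling the walk by a factor of modulus at least 1 can only move it away from 0.\<close>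

lemma integral_cf_power_le:
  assumes "cmod b \<ge> 1"
  shows "(\<integral>v. cmod (cf b v) ^ (2*j) \<partial>gauss2) \<le> gauss_walk j"
  unfolding integral_cf_power gauss_walk_def
proof (rule integral_mono)
  show "exp (- (cmod (b * (\<Sum>k<2*j. (-1) ^ k * \<xi> k \<omega>)))\<^sup>2 / 2) \<le> exp (- (cmod (\<Sum>k<2*j. (-1) ^ k * \<xi> k \<omega>))\<^sup>2 / 2)" for \<omega>
    using assms mult_right_mono[OF assms, of "cmod (\<Sum>k<2*j. (-1) ^ k * \<xi> k \<omega>)"]
    by (auto simp: norm_mult intro!: power_mono)
qed (auto intro!: integrable_unit_bounded[OF prob_space_axioms])

text \<open>The AM-GM step replaces the product of the different characteristic functions by
  powers of a single one, which are again characteristic functions of random walks.\<close>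

lemma expectation_gauss_sum_le:
  assumes A: "A \<subseteq> {..<N}" "card A = 2 * j" "j > 0" and b: "\<And>k. k \<in> A \<Longrightarrow> cmod (b k) \<ge> 1"
  shows "expectation (\<lambda>\<omega>. exp (- (cmod (\<Sum>k<N. b k * \<xi> k \<omega>))\<^sup>2 / 2)) \<le> gauss_walk j"
proof -
  have fin: "finite A" and ne: "A \<noteq> {}" using A finite_subset by auto
  have int: "integrable gauss2 (\<lambda>v. cmod (cf b v) ^ m)" for b m
    by (intro integrable_unit_bounded gauss2.prob_space_axioms) (auto simp: norm_power power_le_one norm_cf_le)
  have "expectation (\<lambda>\<omega>. exp (- (cmod (\<Sum>k<N. b k * \<xi> k \<omega>))\<^sup>2 / 2)) =
     cmod (of_real (expectation (\<lambda>\<omega>. exp (- (cmod (\<Sum>k<N. b k * \<xi> k \<omega>))\<^sup>2 / 2))))"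
    by (simp add: integral_nonneg_AE)
  also have "\<dots> = cmod (\<integral>v. (\<Prod>k<N. cf (b k) v) \<partial>gauss2)"
    by (subst expectation_gauss) (auto simp: cf_sum)
  also have "\<dots> \<le> (\<integral>v. cmod (\<Prod>k<N. cf (b k) v) \<partial>gauss2)" by (rule integral_norm_bound)
  also have "\<dots> \<le> (\<integral>v. (\<Sum>k\<in>A. cmod (cf (b k) v) ^ (2*j) / (2*j)) \<partial>gauss2)"
  proof (rule integral_mono)
    show "integrable gauss2 (\<lambda>v. cmod (\<Prod>k<N. cf (b k) v))"
    proof (intro integrable_unit_bounded gauss2.prob_space_axioms)
      show "norm (cmod (\<Prod>k<N. cf (b k) v)) \<le> 1" for v
        unfolding real_norm_def prod_norm[symmetric] abs_prod abs_norm_cancel by (intro prod_le_1) (simp add: norm_cf_le)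
    qed simp
    show "integrable gauss2 (\<lambda>v. \<Sum>k\<in>A. cmod (cf (b k) v) ^ (2*j) / (2*j))"
      using int by auto
    fix v
    \<comment> \<open>Factors outside \<open>A\<close> have modulus at most 1. What remains is the
      geometric mean of the numbers |\<open>cf (b k) v\<close>|^(2j), because 2 j is the cardinality
      of \<open>A\<close>.\<close>
    have "cmod (\<Prod>k<N. cf (b k) v) = (\<Prod>k\<in>A. cmod (cf (b k) v)) * (\<Prod>k\<in>{..<N} - A. cmod (cf (b k) v))"
      using A(1) by (subst prod.subset_diff[of A]) (auto simp: prod_norm[symmetric] norm_mult mult.commute)
    also have "\<dots> \<le> (\<Prod>k\<in>A. cmod (cf (b k) v)) * 1"
      by (intro mult_left_mono prod_le_1 prod_nonneg) (auto simp: norm_cf_le)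
    also have "\<dots> = (\<Prod>k\<in>A. cmod (cf (b k) v) ^ (2*j)) powr (1 / card A)"
    proof -
      have "(\<Prod>k\<in>A. cmod (cf (b k) v) ^ (2*j)) = (\<Prod>k\<in>A. cmod (cf (b k) v)) ^ (2*j)"
        by (simp add: prod_power_distrib)
      also have "\<dots> powr (1 / card A) = (\<Prod>k\<in>A. cmod (cf (b k) v))"
      proof (cases "(\<Prod>k\<in>A. cmod (cf (b k) v)) = 0")
        case False
        hence "(\<Prod>k\<in>A. cmod (cf (b k) v)) > 0" by (simp add: prod_nonneg order_less_le)
        thus ?thesis using A by (simp flip: powr_realpow add: powr_powr)
      qed (use A in simp)
      finally show ?thesis by simp
    qed
    also have "\<dots> \<le> (\<Sum>k\<in>A. cmod (cf (b k) v) ^ (2*j) / card A)"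
      by (rule arith_geom_mean) (use fin ne in auto)
    finally show "cmod (\<Prod>k<N. cf (b k) v) \<le> (\<Sum>k\<in>A. cmod (cf (b k) v) ^ (2*j) / (2*j))" using A by simp
  qed
  also have "\<dots> = (\<Sum>k\<in>A. (\<integral>v. cmod (cf (b k) v) ^ (2*j) \<partial>gauss2) / (2*j))"
    using int by (subst Bochner_Integration.integral_sum) auto
  also have "\<dots> \<le> (\<Sum>k\<in>A. gauss_walk j / (2*j))"
    by (intro sum_mono divide_right_mono integral_cf_power_le b) auto
  also have "\<dots> = gauss_walk j" using A by simp
  finally show ?thesis .
qed

text \<open>If the two agreed almost surely, independence would put the product of the common law
  with itself on the diagonal; a section of this product then concentrates the law at one point,
  contradicting non-degeneracy.\<close>

lemma not_AE_eq: "\<not> (AE \<omega> in M. \<xi> 0 \<omega> = \<xi> 1 \<omega>)"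
proof
  assume eq: "AE \<omega> in M. \<xi> 0 \<omega> = \<xi> 1 \<omega>"
  have iv: "indep_vars (\<lambda>_. borel) \<xi> UNIV" and id: "distr M borel (\<xi> 1) = distr M borel (\<xi> 0)"
    using iid by (auto simp: iid_def)
  let ?D = "distr M borel (\<xi> 0)"
  interpret D: prob_space ?D by (rule prob_space_distr) auto
  interpret DD: pair_prob_space ?D ?D ..
  have "indep_var (Pi\<^sub>M {0} (\<lambda>_. borel)) (\<lambda>\<omega>. \<lambda>k\<in>{0}. \<xi> k \<omega>) (Pi\<^sub>M {1} (\<lambda>_. borel)) (\<lambda>\<omega>. \<lambda>k\<in>{1}. \<xi> k \<omega>)"
    by (rule indep_var_restrict[OF iv]) auto
  hence "indep_var borel ((\<lambda>f. f 0) \<circ> (\<lambda>\<omega>. \<lambda>k\<in>{0}. \<xi> k \<omega>)) borel ((\<lambda>f. f 1) \<circ> (\<lambda>\<omega>. \<lambda>k\<in>{1}. \<xi> k \<omega>))"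
    by (rule indep_var_compose) auto
  hence "indep_var borel (\<xi> 0) borel (\<xi> 1)" by (simp add: o_def)
  hence d: "distr M (borel \<Otimes>\<^sub>M borel) (\<lambda>\<omega>. (\<xi> 0 \<omega>, \<xi> 1 \<omega>)) = ?D \<Otimes>\<^sub>M ?D"
    using id by (simp add: indep_var_distribution_eq)
  have "AE p in distr M (borel \<Otimes>\<^sub>M borel) (\<lambda>\<omega>. (\<xi> 0 \<omega>, \<xi> 1 \<omega>)). fst p = snd p"
    using eq by (subst AE_distr_iff) auto
  hence "AE x in ?D. AE y in ?D. fst (x, y) = snd (x, y)"
    unfolding d by (rule DD.AE_pair)
  then obtain x where "AE y in ?D. x = y"
    using D.AE_contr by (auto simp: eventually_ex elim!: eventually_mono dest!: AE_E_prob)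
  hence "AE \<omega> in M. \<xi> 0 \<omega> = x" by (subst (asm) AE_distr_iff) (auto elim: eventually_mono)
  thus False using nondeg unfolding nondegenerate_def by blast
qed

text \<open>The exceptional v lie on countably many parallel lines. Slicing along a coordinate in
  which z is nonzero reduces the claim to countable subsets of the real line.\<close>

lemma AE_gauss2_cos:
  assumes "z \<noteq> 0"
  shows "AE v in gauss2. cos (pairing v z) \<noteq> 1"
proof -
  have null: "AE x in std_normal_distribution. cos (x * a + c) \<noteq> 1" if "a \<noteq> 0" for a c
  proof -
    have "{x. cos (x * a + c) = 1} \<subseteq> range (\<lambda>n::int. (of_int n * 2 * pi - c) / a)"
      using that by (auto simp: cos_one_2pi_int field_simps)
    hence "countable {x. cos (x * a + c) = 1}" by (rule countable_subset) auto
    hence "{x. cos (x * a + c) = 1} \<in> null_sets lborel" by (rule countable_imp_null_set_lborel)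
    from AE_not_in[OF this] have "AE x in lborel. cos (x * a + c) \<noteq> 1" by simp
    thus ?thesis by (subst AE_density) auto
  qed
  have *: "AE x in std_normal_distribution. AE y in std_normal_distribution. cos (pairing (x, y) z) \<noteq> 1"
  proof (cases "Im z = 0")
    case False
    show ?thesis using null[OF False] by (auto simp: pairing_def add.commute)
  next
    case True
    hence "Re z \<noteq> 0" using assms complex_eq_iff by auto
    from null[OF this, of 0] show ?thesis using True by (auto simp: pairing_def elim: eventually_mono)
  qed
  have "{v \<in> space gauss2. cos (pairing v z) \<noteq> 1} \<in> sets gauss2"
    unfolding pairing_def by measurable
  from gauss2.AE_pair_measure[OF this *] show ?thesis .
qed

text \<open>The square of |\<open>cf 1 v\<close>| is the mean of
  \<open>cos (pairing v \<eta>)\<close> for the symmetrised variable \<eta>. Modulus 1 would force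
  this cosine to be 1 almost surely, and for almost every v that means \<eta> = 0 almost
  surely.\<close>

lemma AE_norm_cf_less: "AE v in gauss2. cmod (cf 1 v) < 1"
proof -
  define \<eta> where "\<eta> \<omega> = \<xi> 0 \<omega> - \<xi> 1 \<omega>" for \<omega>
  have [measurable]: "\<eta> \<in> borel_measurable M" unfolding \<eta>_def by measurable
  interpret P: pair_prob_space gauss2 M ..
  have "AE \<omega> in M. AE v in gauss2. \<eta> \<omega> \<noteq> 0 \<longrightarrow> cos (pairing v (\<eta> \<omega>)) \<noteq> 1"
    using AE_gauss2_cos by auto
  \<comment> \<open>The exceptional v depend on the value of \<eta>; exchanging the two
    almost-everywhere quantifiers gives one null set of v that works for almost all
    outcomes.\<close>
  hence "AE v in gauss2. AE \<omega> in M. \<eta> \<omega> \<noteq> 0 \<longrightarrow> cos (pairing v (\<eta> \<omega>)) \<noteq> 1"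
  proof (subst P.AE_commute)
    have [measurable]: "(\<lambda>x. fst x) \<in> gauss2 \<Otimes>\<^sub>M M \<rightarrow>\<^sub>M borel \<Otimes>\<^sub>M borel"
      using measurable_fst[of gauss2 M] by (simp cong: measurable_cong_sets sets_pair_measure_cong)
    show "{x \<in> space (gauss2 \<Otimes>\<^sub>M M). \<eta> (snd x) \<noteq> 0 \<longrightarrow> cos (pairing (fst x) (\<eta> (snd x))) \<noteq> 1} \<in> sets (gauss2 \<Otimes>\<^sub>M M)"
      by measurable
  qed
  thus ?thesis
  proof eventually_elim
    case (elim v)
    \<comment> \<open>For j = 1 the alternating walk is \<eta>.\<close>
    have "cmod (cf 1 v) ^ 2 = Re (expectation (\<lambda>\<omega>. cis (pairing v (\<eta> \<omega>))))"
      using alternating_cf[of v 1 1] by (simp add: \<eta>_def numeral_2_eq_2)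
    also have "\<dots> = expectation (\<lambda>\<omega>. cos (pairing v (\<eta> \<omega>)))"
      by (subst integral_Re[symmetric]) (auto intro!: integrable_unit_bounded[OF prob_space_axioms] simp: pairing_def)
    finally have sq: "cmod (cf 1 v) ^ 2 = expectation (\<lambda>\<omega>. cos (pairing v (\<eta> \<omega>)))" .
    have ic: "integrable M (\<lambda>\<omega>. cos (pairing v (\<eta> \<omega>)))"
      by (intro integrable_unit_bounded[OF prob_space_axioms]) (auto simp: pairing_def)
    show "cmod (cf 1 v) < 1"
    proof (rule ccontr)
      assume "\<not> ?thesis"
      hence "cmod (cf 1 v) = 1" using norm_cf_le[of 1 v] by simp
      hence "expectation (\<lambda>\<omega>. 1 - cos (pairing v (\<eta> \<omega>))) = 0" using sq ic by (simp add: prob_space)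
      hence "AE \<omega> in M. 1 - cos (pairing v (\<eta> \<omega>)) = 0"
        using ic by (subst (asm) integral_nonneg_eq_0_iff_AE) auto
      with elim have "AE \<omega> in M. \<eta> \<omega> = 0" by eventually_elim auto
      thus False using not_AE_eq by (simp add: \<eta>_def)
    qed
  qed
qed

text \<open>Since |\<open>cf 1 v\<close>| < 1 for almost every v, dominated convergence makes the
  Gaussian mean of its powers vanish.\<close>

lemma gauss_walk_tendsto_0: "gauss_walk \<longlonglongrightarrow> 0"
proof -
  have eq: "gauss_walk j = (\<integral>v. cmod (cf 1 v) ^ (2*j) \<partial>gauss2)" for j
    by (simp add: gauss_walk_def integral_cf_power)
  have "(\<lambda>j. \<integral>v. cmod (cf 1 v) ^ (2*j) \<partial>gauss2) \<longlonglongrightarrow> (\<integral>v. 0 \<partial>gauss2)"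
  proof (rule integral_dominated_convergence[where w="\<lambda>_. 1"])
    show "AE v in gauss2. (\<lambda>j. cmod (cf 1 v) ^ (2*j)) \<longlonglongrightarrow> 0"
      using AE_norm_cf_less
    proof eventually_elim
      case (elim v)
      hence "(\<lambda>j. (cmod (cf 1 v) ^ 2) ^ j) \<longlonglongrightarrow> 0"
        by (intro LIMSEQ_power_zero) (auto simp: power_less_one_iff abs_square_less_1)
      thus ?case by (simp add: power_mult)
    qed
  qed (auto simp: power_le_one norm_cf_le)
  thus ?thesis unfolding eq[abs_def] by simp
qed

text \<open>Division by t makes the selected coefficients at least 1 in modulus, and the bound for
  the partial sums passes to the limit. The factor exp (1/2) compensates the Gaussian weight, which
  is at least exp (-1/2) where |X| \<le> t.\<close>

lemma small_ball_series:
  assumes conv: "AE \<omega> in M. (\<lambda>N. \<Sum>k<N. b k * \<xi> k \<omega>) \<longlonglongrightarrow> X \<omega>" and [measurable]: "X \<in> borel_measurable M"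
    and A: "finite A" "card A = 2 * j" "j > 0" and b: "\<And>k. k \<in> A \<Longrightarrow> cmod (b k) \<ge> t" and t: "t > 0"
  shows "prob {\<omega>\<in>space M. cmod (X \<omega>) \<le> t} \<le> exp (1/2) * gauss_walk j"
proof -
  define c where "c k = b k / of_real t" for k
  have lim: "(\<lambda>N. expectation (\<lambda>\<omega>. exp (- (cmod (\<Sum>k<N. c k * \<xi> k \<omega>))\<^sup>2 / 2))) \<longlonglongrightarrow>
     expectation (\<lambda>\<omega>. exp (- (cmod (X \<omega> / of_real t))\<^sup>2 / 2))"
  proof (rule integral_dominated_convergence[where w="\<lambda>_. 1"])
    show "AE \<omega> in M. (\<lambda>N. exp (- (cmod (\<Sum>k<N. c k * \<xi> k \<omega>))\<^sup>2 / 2)) \<longlonglongrightarrow> exp (- (cmod (X \<omega> / of_real t))\<^sup>2 / 2)"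
      using conv
    proof eventually_elim
      case (elim \<omega>)
      have "(\<Sum>k<N. c k * \<xi> k \<omega>) = (\<Sum>k<N. b k * \<xi> k \<omega>) / of_real t" for N
        by (simp add: c_def sum_divide_distrib)
      thus ?case using t by (auto intro!: tendsto_intros elim)
    qed
  qed auto
  obtain N0 where N0: "A \<subseteq> {..<N0}" using A(1) finite_nat_iff_bounded by blast
  have "expectation (\<lambda>\<omega>. exp (- (cmod (X \<omega> / of_real t))\<^sup>2 / 2)) \<le> gauss_walk j"
  proof (rule tendsto_upperbound[OF lim])
    show "eventually (\<lambda>N. expectation (\<lambda>\<omega>. exp (- (cmod (\<Sum>k<N. c k * \<xi> k \<omega>))\<^sup>2 / 2)) \<le> gauss_walk j) sequentially"
      using eventually_ge_at_top[of N0]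
    proof eventually_elim
      case (elim N)
      show ?case
        by (rule expectation_gauss_sum_le[OF _ A(2,3)]) (use N0 elim b t in \<open>auto simp: c_def norm_divide\<close>)
    qed
  qed simp
  moreover have "prob {\<omega>\<in>space M. cmod (X \<omega>) \<le> t} \<le> expectation (\<lambda>\<omega>. exp (1/2) * exp (- (cmod (X \<omega> / of_real t))\<^sup>2 / 2))"
  proof -
    have "prob {\<omega>\<in>space M. cmod (X \<omega>) \<le> t} = expectation (indicator {\<omega>\<in>space M. cmod (X \<omega>) \<le> t})"
      by simp
    also have "\<dots> \<le> expectation (\<lambda>\<omega>. exp (1/2) * exp (- (cmod (X \<omega> / of_real t))\<^sup>2 / 2))"
    proof (rule integral_mono)
      show "integrable M (indicator {\<omega>\<in>space M. cmod (X \<omega>) \<le> t} :: _ \<Rightarrow> real)"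
        by (intro integrable_unit_bounded[OF prob_space_axioms]) (auto simp: indicator_def)
      show "integrable M (\<lambda>\<omega>. exp (1/2) * exp (- (cmod (X \<omega> / of_real t))\<^sup>2 / 2))"
        by (intro integrable_mult_right integrable_unit_bounded[OF prob_space_axioms]) auto
      fix \<omega>
      show "indicator {\<omega>\<in>space M. cmod (X \<omega>) \<le> t} \<omega> \<le> exp (1/2) * exp (- (cmod (X \<omega> / of_real t))\<^sup>2 / 2)"
      proof (cases "cmod (X \<omega>) \<le> t")
        case True
        hence "(cmod (X \<omega> / of_real t))\<^sup>2 \<le> 1" using t by (auto simp: norm_divide power_le_one)
        thus ?thesis by (auto simp: indicator_def simp flip: exp_add)
      qed (auto simp: indicator_def)
    qed
    finally show ?thesis .
  qed
  ultimately show ?thesis by (simp add: order_trans mult_left_mono)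
qed

text \<open>Where every coefficient vanishes, every walk is 0 and its Gaussian weight is 1, so the
  probability is below each \<open>gauss_walk j\<close>. This is what excludes that H vanishes
  identically.\<close>

lemma AE_ex_nonzero: "AE \<omega> in M. \<exists>k. \<xi> k \<omega> \<noteq> 0"
proof -
  let ?Z = "{\<omega>\<in>space M. \<forall>k. \<xi> k \<omega> = 0}"
  have m: "?Z \<in> events" by measurable
  have "prob ?Z \<le> gauss_walk j" for j
  proof -
    have "prob ?Z = expectation (indicator ?Z)" using m by simp
    also have "\<dots> \<le> gauss_walk j"
      unfolding gauss_walk_def
      by (rule integral_mono)
         (use m in \<open>auto intro!: integrable_unit_bounded[OF prob_space_axioms] simp: indicator_def\<close>)
    finally show ?thesis .
  qed
  hence "prob ?Z \<le> 0" using gauss_walk_tendsto_0 by (intro LIMSEQ_le_const) auto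
  hence "prob ?Z = 0" by (simp add: measure_le_0_iff)
  hence "?Z \<in> null_sets M" using m by (simp add: null_sets_def emeasure_eq_measure)
  from AE_not_in[OF this] show ?thesis by (auto elim!: AE_mp intro!: AE_I2)
qed

end

section \<open>The limiting potential\<close>

text \<open>The stationary point t of t^\<alpha> + t ln x (for \<alpha> < 1) or of -t^\<alpha> + t
  ln x (for \<alpha> > 1) satisfies t^|1 - \<alpha>| = \<open>crit_base \<alpha> x\<close>. The
  \<open>max 1 x\<close> encodes that for \<alpha> > 1 and x \<le> 1 the maximum over t \<ge> 0 sits
  at t = 0. For \<alpha> < 1 the value at x = 0 is 0, since ln 0 = 0 and division by 0 gives 0; this
  is also the limit.\<close>

definition crit_base :: "real \<Rightarrow> real \<Rightarrow> real" where
  "crit_base \<alpha> x = (if \<alpha> < 1 then \<alpha> / (- ln x) else ln (max 1 x) / \<alpha>)"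

definition crit :: "real \<Rightarrow> real \<Rightarrow> real" where
  "crit \<alpha> x = crit_base \<alpha> x powr (1 / \<bar>1 - \<alpha>\<bar>)"

text \<open>The maximal value of that expression. As a function of the modulus r, r times its
  derivative is \<open>crit\<close>, and \<open>crit\<close> is the mass that the limit measure
  gives to the disc of radius r.\<close>

definition potential :: "real \<Rightarrow> real \<Rightarrow> real" where
  "potential \<alpha> x = \<bar>1 - \<alpha>\<bar> * crit_base \<alpha> x powr (\<alpha> / \<bar>1 - \<alpha>\<bar>)"

definition radii :: "real \<Rightarrow> real set" where
  "radii \<alpha> = (if \<alpha> < 1 then {0..<1} else {0..})"

text \<open>The claimed density as a function of the modulus, extended by 0 to all radii, so that
  integrals over the domain become integrals over the plane.\<close>

definition radial_density :: "real \<Rightarrow> real \<Rightarrow> real" where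
  "radial_density \<alpha> r = (if \<alpha> > 1 \<and> r < 1 \<or> \<alpha> < 1 \<and> r \<ge> 1 then 0 else
     1 / (2 * pi * \<alpha> * \<bar>1 - \<alpha>\<bar>) * (1 / r\<^sup>2) * \<bar>ln r / \<alpha>\<bar> powr ((2 - \<alpha>) / (\<alpha> - 1)))"

lemma crit_base_nonneg: "0 < \<alpha> \<Longrightarrow> x \<in> radii \<alpha> \<Longrightarrow> 0 \<le> crit_base \<alpha> x"
  by (cases "x = 0") (auto simp: crit_base_def radii_def divide_nonneg_nonpos)

lemma continuous_on_crit_base:
  assumes "0 < \<alpha>" shows "continuous_on (radii \<alpha>) (crit_base \<alpha>)"
proof (cases "\<alpha> < 1")
  case False
  have "continuous_on (radii \<alpha>) (\<lambda>x::real. ln (max 1 x) / \<alpha>)"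
    using assms by (intro continuous_intros) auto
  thus ?thesis using False by (simp add: crit_base_def)
next
  case True
  have "continuous (at x within {0..<1}) (\<lambda>x. \<alpha> / (- ln x))" if x: "x \<in> {0..<1}" for x
  proof (cases "x = 0")
    case False
    thus ?thesis using x by (intro continuous_intros continuous_at_imp_continuous_at_within isCont_divide) (auto intro!: continuous_intros)
  next
    case True
    \<comment> \<open>The limit agrees with the default value of the quotient at 0.\<close>
    have "((\<lambda>x. \<alpha> / (- ln x)) \<longlongrightarrow> 0) (at_right 0)" using assms by real_asymp
    moreover have "at (0::real) within {0..<1} \<le> at_right 0"
      unfolding at_within_def by (intro inf_mono order_refl) auto
    ultimately have "((\<lambda>x. \<alpha> / (- ln x)) \<longlongrightarrow> 0) (at 0 within {0..<1})" by (rule tendsto_mono[rotated])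
    thus ?thesis using True by (simp add: continuous_within)
  qed
  thus ?thesis using True by (simp add: crit_base_def[abs_def] radii_def continuous_on_eq_continuous_within)
qed

lemma continuous_on_crit:
  assumes "0 < \<alpha>" "\<alpha> \<noteq> 1" shows "continuous_on (radii \<alpha>) (crit \<alpha>)"
  unfolding crit_def using assms crit_base_nonneg
  by (intro continuous_on_powr' continuous_on_crit_base continuous_on_const) auto

lemma continuous_on_potential:
  assumes "0 < \<alpha>" "\<alpha> \<noteq> 1" shows "continuous_on (radii \<alpha>) (potential \<alpha>)"
  unfolding potential_def using assms crit_base_nonneg
  by (intro continuous_on_mult continuous_on_powr' continuous_on_crit_base continuous_on_const) auto

lemma crit_nonneg: "0 \<le> crit \<alpha> x" and potential_nonneg: "0 \<le> potential \<alpha> x"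
  by (simp_all add: crit_def potential_def)

lemma crit_0 [simp]: "crit \<alpha> 0 = 0" and potential_0 [simp]: "potential \<alpha> 0 = 0"
  by (simp_all add: crit_def potential_def crit_base_def)

lemma radial_density_nonneg: "0 < \<alpha> \<Longrightarrow> 0 \<le> radial_density \<alpha> r"
  by (simp add: radial_density_def)

lemma measurable_radial_density [measurable]: "radial_density \<alpha> \<in> borel_measurable borel"
  unfolding radial_density_def by measurable

lemma crit_base_deriv:
  assumes "0 < \<alpha>" "\<alpha> \<noteq> 1" "0 < x" "x \<noteq> 1" "x \<in> radii \<alpha>" "\<alpha> > 1 \<Longrightarrow> x > 1"
  shows "crit_base \<alpha> x > 0"
    and "(crit_base \<alpha> has_real_derivative (if \<alpha> < 1 then (crit_base \<alpha> x)\<^sup>2 else 1) / (\<alpha> * x)) (at x)"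
proof -
  show pos: "crit_base \<alpha> x > 0" using assms by (auto simp: crit_base_def radii_def divide_pos_neg)
  show "(crit_base \<alpha> has_real_derivative (if \<alpha> < 1 then (crit_base \<alpha> x)\<^sup>2 else 1) / (\<alpha> * x)) (at x)"
  proof (cases "\<alpha> < 1")
    case True
    hence x: "x < 1" using assms by (auto simp: radii_def)
    hence "ln x \<noteq> 0" using assms by simp
    hence "((\<lambda>x. \<alpha> / (- ln x)) has_real_derivative (\<alpha> / (- ln x))\<^sup>2 / (\<alpha> * x)) (at x)"
      using assms by (auto intro!: derivative_eq_intros simp: field_simps power2_eq_square)
    thus ?thesis using True by (simp add: crit_base_def[abs_def])
  next
    case False
    hence x: "x > 1" using assms by auto
    have "((\<lambda>x. ln x / \<alpha>) has_real_derivative 1 / (\<alpha> * x)) (at x)"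
      using assms by (auto intro!: derivative_eq_intros simp: field_simps)
    hence "(crit_base \<alpha> has_real_derivative 1 / (\<alpha> * x)) (at x)"
      by (rule has_field_derivative_transform_within_open[of _ _ _ "{1<..}"])
         (use False x in \<open>auto simp: crit_base_def\<close>)
    thus ?thesis using False by simp
  qed
qed

text \<open>The radial Laplacian in two steps: r u'(r) is the mass of the disc, and the derivative
  of the mass is 2 pi r times the density. Both reduce to identities between exponents over |1 -
  \<alpha>|. The point x = 1 is left out because for \<alpha> > 1 the zero branch and the
  logarithmic branch meet there.\<close>

lemma deriv_crit_potential:
  assumes a: "0 < \<alpha>" "\<alpha> \<noteq> 1" and x: "0 < x" "x \<noteq> 1" "x \<in> radii \<alpha>"
  shows "(crit \<alpha> has_real_derivative 2 * pi * x * radial_density \<alpha> x) (at x)"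
    and "(potential \<alpha> has_real_derivative crit \<alpha> x / x) (at x)"
proof -
  have "(crit \<alpha> has_real_derivative 2 * pi * x * radial_density \<alpha> x) (at x) \<and>
    (potential \<alpha> has_real_derivative crit \<alpha> x / x) (at x)"
  proof (cases "\<alpha> > 1 \<and> x < 1")
    case True
    have z: "crit \<alpha> y = 0" "potential \<alpha> y = 0" if "y < 1" for y
      using True that by (simp_all add: crit_def potential_def crit_base_def)
    have d0: "((\<lambda>_. 0) has_real_derivative 0) (at x)" by simp
    show ?thesis using True z
      by (auto simp: radial_density_def
          intro!: has_field_derivative_transform_within_open[OF d0, of "{..<1}"])
  next
    case False
    hence x1: "\<alpha> > 1 \<Longrightarrow> x > 1" using x by auto
    let ?q = "crit_base \<alpha> x" and ?b = "\<bar>1 - \<alpha>\<bar>"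
    note q = crit_base_deriv[OF a x x1]
    let ?q' = "(if \<alpha> < 1 then ?q\<^sup>2 else 1) / (\<alpha> * x)"
    have b: "?b > 0" using a by simp
    have "(crit \<alpha> has_real_derivative 1 / ?b * ?q powr (1 / ?b - 1) * ?q') (at x)"
      using DERIV_fun_powr[OF q(2,1), of "1 / ?b"] by (simp add: crit_def[abs_def])
    moreover have "1 / ?b * ?q powr (1 / ?b - 1) * ?q' = 2 * pi * x * radial_density \<alpha> x"
    proof (cases "\<alpha> < 1")
      case True
      hence xl: "x < 1" using x by (auto simp: radii_def)
      hence ln: "ln x < 0" using x by simp
      have "\<bar>ln x / \<alpha>\<bar> = inverse ?q" using True ln a by (simp add: crit_base_def)
      moreover have "inverse ?q powr ((2 - \<alpha>) / (\<alpha> - 1)) = ?q powr (- ((2 - \<alpha>) / (\<alpha> - 1)))"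
        using q(1) by (simp add: powr_minus inverse_powr)
      moreover have "- ((2 - \<alpha>) / (\<alpha> - 1)) = (1 / ?b - 1) + 2" using True by (simp add: field_simps)
      ultimately have "\<bar>ln x / \<alpha>\<bar> powr ((2 - \<alpha>) / (\<alpha> - 1)) = ?q powr (1 / ?b - 1) * ?q\<^sup>2"
        using q(1) by (simp only: powr_add) (simp add: powr_numeral)
      thus ?thesis using True xl x a by (simp add: radial_density_def power2_eq_square field_simps)
    next
      case False
      hence x1: "x > 1" using x1 a by auto
      have "\<bar>ln x / \<alpha>\<bar> = ?q" using False x1 a by (simp add: crit_base_def)
      moreover have "(2 - \<alpha>) / (\<alpha> - 1) = 1 / ?b - 1" using False a by (simp add: field_simps)
      ultimately have "\<bar>ln x / \<alpha>\<bar> powr ((2 - \<alpha>) / (\<alpha> - 1)) = ?q powr (1 / ?b - 1)" by simp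
      thus ?thesis using False x1 a by (simp add: radial_density_def power2_eq_square field_simps)
    qed
    ultimately have 1: "(crit \<alpha> has_real_derivative 2 * pi * x * radial_density \<alpha> x) (at x)" by simp
    have "(potential \<alpha> has_real_derivative ?b * (\<alpha> / ?b * ?q powr (\<alpha> / ?b - 1) * ?q')) (at x)"
      using DERIV_cmult[OF DERIV_fun_powr[OF q(2,1), of "\<alpha> / ?b"], of ?b] by (simp add: potential_def[abs_def])
    moreover have "?b * (\<alpha> / ?b * ?q powr (\<alpha> / ?b - 1) * ?q') = crit \<alpha> x / x"
    proof (cases "\<alpha> < 1")
      case True
      have "1 / ?b = (\<alpha> / ?b - 1) + 2" using True by (simp add: field_simps)
      hence "crit \<alpha> x = ?q powr (\<alpha> / ?b - 1) * ?q\<^sup>2"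
        unfolding crit_def using q(1) by (simp only: powr_add) (simp add: powr_numeral)
      thus ?thesis using True a x by (simp add: field_simps)
    next
      case False
      have "1 / ?b = \<alpha> / ?b - 1" using False a by (simp add: field_simps)
      hence "crit \<alpha> x = ?q powr (\<alpha> / ?b - 1)" by (simp add: crit_def)
      thus ?thesis using False a x by (simp add: field_simps)
    qed
    ultimately show ?thesis using 1 by simp
  qed
  thus "(crit \<alpha> has_real_derivative 2 * pi * x * radial_density \<alpha> x) (at x)"
    "(potential \<alpha> has_real_derivative crit \<alpha> x / x) (at x)" by auto
qed

text \<open>The potential is the Legendre transform of the growth exponent of the coefficients,
  and \<open>crit\<close> is the maximiser.\<close>

definition coeff_exp :: "real \<Rightarrow> real \<Rightarrow> real" where
  "coeff_exp \<alpha> t = (if \<alpha> < 1 then t powr \<alpha> else - (t powr \<alpha>))"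

text \<open>Weighted arithmetic-geometric mean inequality for u and 1.\<close>

lemma bernoulli_powr_le:
  assumes "0 < \<beta>" "\<beta> < 1" "u \<ge> 0" shows "u powr \<beta> \<le> 1 + \<beta> * (u - (1::real))"
proof (cases "u = 0")
  case False
  have "u powr \<beta> * 1 powr (1 - \<beta>) \<le> \<beta> * u + (1 - \<beta>) * 1"
    by (rule Youngs_inequality_0) (use assms False in auto)
  thus ?thesis by (simp add: algebra_simps)
qed (use assms in simp)

text \<open>The concave case for the exponent 1 / \<beta> at the point u^\<beta>.\<close>

lemma bernoulli_powr_ge:
  assumes "1 < \<beta>" "u \<ge> 0" shows "u powr \<beta> \<ge> 1 + \<beta> * (u - (1::real))"
proof -
  have "(u powr \<beta>) powr (1 / \<beta>) \<le> 1 + 1 / \<beta> * (u powr \<beta> - 1)"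
    by (rule bernoulli_powr_le) (use assms in auto)
  also have "(u powr \<beta>) powr (1 / \<beta>) = u" using assms by (simp add: powr_powr)
  finally have "\<beta> * u \<le> \<beta> * (1 + 1 / \<beta> * (u powr \<beta> - 1))" using assms by (intro mult_left_mono) auto
  thus ?thesis using assms by (simp add: algebra_simps)
qed

lemma potential_eq_crit:
  assumes a: "0 < \<alpha>" "\<alpha> \<noteq> 1" and x: "0 < x" "x \<in> radii \<alpha>"
  shows "coeff_exp \<alpha> (crit \<alpha> x) + crit \<alpha> x * ln x = potential \<alpha> x"
    and "t \<ge> 0 \<Longrightarrow> coeff_exp \<alpha> t + t * ln x \<le> potential \<alpha> x"
proof -
  let ?q = "crit_base \<alpha> x" and ?b = "\<bar>1 - \<alpha>\<bar>"
  have b: "?b > 0" using a by simp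
  have "coeff_exp \<alpha> (crit \<alpha> x) + crit \<alpha> x * ln x = potential \<alpha> x \<and>
     (t \<ge> 0 \<longrightarrow> coeff_exp \<alpha> t + t * ln x \<le> potential \<alpha> x)"
  proof (cases "\<alpha> > 1 \<and> x \<le> 1")
    case True
    have "t * ln x \<le> 0" if "t \<ge> 0" using that True x by (simp add: mult_nonneg_nonpos)
    hence "t \<ge> 0 \<Longrightarrow> coeff_exp \<alpha> t + t * ln x \<le> 0"
      using True by (simp add: coeff_exp_def order_trans[OF _ powr_ge_zero])
    moreover have "crit \<alpha> x = 0" "potential \<alpha> x = 0" using True by (simp_all add: crit_def potential_def crit_base_def max_def)
    ultimately show ?thesis using True by (simp add: coeff_exp_def)
  next
    case False
    have x1: "x \<noteq> 1" using False a x by (auto simp: radii_def)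
    have q: "?q > 0" by (rule crit_base_deriv(1)[OF a x(1) x1 x(2)]) (use False in auto)
    have T: "crit \<alpha> x > 0" using q by (simp add: crit_def)
    have Ta: "crit \<alpha> x powr \<alpha> = ?q powr (\<alpha> / ?b)" by (simp add: crit_def powr_powr)
    have Ts: "crit \<alpha> x * ln x = (if \<alpha> < 1 then - \<alpha> else \<alpha>) * ?q powr (\<alpha> / ?b)"
    proof (cases "\<alpha> < 1")
      case True
      have lx: "ln x = - \<alpha> / ?q" using True x1 x a q by (simp add: crit_base_def)
      have "1 / ?b = \<alpha> / ?b + 1" using True by (simp add: field_simps)
      hence "crit \<alpha> x = ?q powr (\<alpha> / ?b) * ?q" using q unfolding crit_def by (simp only: powr_add) simp
      thus ?thesis using True lx q by simp
    next
      case f: False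
      have lx: "ln x = \<alpha> * ?q" using f False a by (simp add: crit_base_def)
      have "\<alpha> / ?b = 1 / ?b + 1" using f a by (simp add: field_simps)
      hence "?q powr (\<alpha> / ?b) = crit \<alpha> x * ?q" using q unfolding crit_def by (simp only: powr_add) simp
      thus ?thesis using f lx by simp
    qed
    have eq: "coeff_exp \<alpha> (crit \<alpha> x) + crit \<alpha> x * ln x = potential \<alpha> x"
      unfolding coeff_exp_def potential_def Ta Ts using a by (simp add: algebra_simps)
    have "coeff_exp \<alpha> t + t * ln x \<le> potential \<alpha> x" if t: "t \<ge> 0"
    proof -
      let ?T = "crit \<alpha> x"
      \<comment> \<open>Measured in units of the maximiser, every term is a multiple of
        \<open>?T powr \<alpha>\<close>, and the claim becomes Bernoulli's inequality in u.\<close>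
      define u where "u = t / ?T"
      have u: "u \<ge> 0" "t = u * ?T" using t T by (auto simp: u_def)
      have pot: "potential \<alpha> x = ?b * ?T powr \<alpha>" by (simp only: potential_def Ta)
      have tp: "t powr \<alpha> = u powr \<alpha> * ?T powr \<alpha>" using u T by (simp add: powr_mult)
      have tl: "t * ln x = u * ((if \<alpha> < 1 then - \<alpha> else \<alpha>) * ?T powr \<alpha>)" using u Ts Ta by (simp add: mult_ac)
      show ?thesis
      proof (cases "\<alpha> < 1")
        case True
        have "u powr \<alpha> * ?T powr \<alpha> \<le> (1 + \<alpha> * (u - 1)) * ?T powr \<alpha>"
          by (intro mult_right_mono bernoulli_powr_le) (use True a u in auto)
        thus ?thesis using True by (simp add: coeff_exp_def tp tl pot algebra_simps)
      next
        case False
        have "u powr \<alpha> * ?T powr \<alpha> \<ge> (1 + \<alpha> * (u - 1)) * ?T powr \<alpha>"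
          by (intro mult_right_mono bernoulli_powr_ge) (use False a u in auto)
        thus ?thesis using False a by (simp add: coeff_exp_def tp tl pot algebra_simps)
      qed
    qed
    thus ?thesis using eq by blast
  qed
  thus "coeff_exp \<alpha> (crit \<alpha> x) + crit \<alpha> x * ln x = potential \<alpha> x"
    "t \<ge> 0 \<Longrightarrow> coeff_exp \<alpha> t + t * ln x \<le> potential \<alpha> x" by auto
qed

lemma potential_integral:
  assumes a: "0 < \<alpha>" "\<alpha> \<noteq> 1" and s: "0 < s" "s \<le> R" "R \<in> radii \<alpha>"
  shows "(\<integral>\<^sup>+r. ennreal ((ln R - ln (max s r)) * (2 * pi * r * radial_density \<alpha> r)) * indicator {0..R} r \<partial>lborel)
    = ennreal (potential \<alpha> R - potential \<alpha> s)"
proof -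
  \<comment> \<open>Antiderivative found by integration by parts: for r > s the term
    -\<open>crit \<alpha> r\<close> / r from the logarithm is cancelled by the derivative of the
    potential, and for r < s the potential term is constant. Only the corners s and 1 are left
    out.\<close>
  define F where "F r = (ln R - ln (max s r)) * crit \<alpha> r + potential \<alpha> (max s r)" for r
  have sub: "{0..R} \<subseteq> radii \<alpha>" using s by (auto simp: radii_def split: if_splits)
  have contF: "continuous_on {0..R} F"
    unfolding F_def
  proof (intro continuous_intros)
    show "continuous_on {0..R} (crit \<alpha>)" by (rule continuous_on_subset[OF continuous_on_crit[OF a] sub])
    show "continuous_on {0..R} (\<lambda>r. potential \<alpha> (max s r))"
      by (rule continuous_on_compose2[OF continuous_on_potential[OF a]])
         (use s in \<open>auto simp: radii_def intro!: continuous_intros split: if_splits\<close>)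
  qed (use s in \<open>auto simp: max_def split: if_splits\<close>)
  have "((\<lambda>r. (ln R - ln (max s r)) * (2 * pi * r * radial_density \<alpha> r)) has_integral (F R - F 0)) {0..R}"
  proof (rule fundamental_theorem_of_calculus_interior_strong[of "{s, 1}"])
    fix r assume r: "r \<in> {0<..<R} - {s, 1}"
    hence rr: "0 < r" "r \<noteq> 1" "r \<in> radii \<alpha>" using sub by auto
    note d = deriv_crit_potential[OF a rr]
    have "(F has_real_derivative (ln R - ln (max s r)) * (2 * pi * r * radial_density \<alpha> r)) (at r)"
    proof (cases "r < s")
      case True
      have "((\<lambda>r. (ln R - ln s) * crit \<alpha> r + potential \<alpha> s) has_real_derivative (ln R - ln s) * (2 * pi * r * radial_density \<alpha> r) + 0) (at r)"
        by (intro DERIV_add DERIV_cmult d DERIV_const)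
      thus ?thesis using True
        by (intro has_field_derivative_transform_within_open[of _ _ _ "{..<s}" F]) (auto simp: F_def max_def)
    next
      case False
      hence rs: "r > s" using r by auto
      have "((\<lambda>r. (ln R - ln r) * crit \<alpha> r + potential \<alpha> r) has_real_derivative 
          ((0 - 1 / r) * crit \<alpha> r + (2 * pi * r * radial_density \<alpha> r) * (ln R - ln r)) + crit \<alpha> r / r) (at r)"
        using rr by (intro DERIV_add DERIV_mult DERIV_diff d DERIV_const) (auto intro!: derivative_eq_intros)
      hence "((\<lambda>r. (ln R - ln r) * crit \<alpha> r + potential \<alpha> r) has_real_derivative 
          (ln R - ln (max s r)) * (2 * pi * r * radial_density \<alpha> r)) (at r)"
        using rs by (simp add: max_def mult.commute)
      thus ?thesis using rs
        by (intro has_field_derivative_transform_within_open[of _ _ _ "{s<..}" F]) (auto simp: F_def max_def)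
    qed
    thus "(F has_vector_derivative (ln R - ln (max s r)) * (2 * pi * r * radial_density \<alpha> r)) (at r)"
      by (simp add: has_real_derivative_iff_has_vector_derivative)
  qed (use s contF in auto)
  also have "F R - F 0 = potential \<alpha> R - potential \<alpha> s" using s by (simp add: F_def max_def)
  finally have hi: "((\<lambda>r. (ln R - ln (max s r)) * (2 * pi * r * radial_density \<alpha> r)) has_integral (potential \<alpha> R - potential \<alpha> s)) {0..R}" .
  have nn: "0 \<le> (ln R - ln (max s r)) * (2 * pi * r * radial_density \<alpha> r)" if "r \<in> {0..R}" for r
    using that s a by (intro mult_nonneg_nonneg) (auto simp: radial_density_nonneg intro!: ln_mono)
  have "(\<integral>\<^sup>+r. ennreal (indicator {0..R} r * ((ln R - ln (max s r)) * (2 * pi * r * radial_density \<alpha> r))) \<partial>lborel)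
    = ennreal (potential \<alpha> R - potential \<alpha> s)"
    by (rule nn_integral_has_integral_lebesgue[OF nn hi])
  thus ?thesis by (subst (asm) nn_integral_cong[where v="\<lambda>r. ennreal ((ln R - ln (max s r)) * (2 * pi * r * radial_density \<alpha> r)) * indicator {0..R} r"])
     (auto simp: indicator_def)
qed

lemma crit_integral:
  assumes a: "0 < \<alpha>" "\<alpha> \<noteq> 1" and R: "R \<in> radii \<alpha>"
  shows "(\<integral>\<^sup>+r. ennreal (2 * pi * r * radial_density \<alpha> r) * indicator {0..R} r \<partial>lborel) = ennreal (crit \<alpha> R)"
proof -
  have sub: "{0..R} \<subseteq> radii \<alpha>" using R by (auto simp: radii_def split: if_splits)
  have "((\<lambda>r. 2 * pi * r * radial_density \<alpha> r) has_integral (crit \<alpha> R - crit \<alpha> 0)) {0..R}"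
  proof (rule fundamental_theorem_of_calculus_interior_strong[of "{1}"])
    show "continuous_on {0..R} (crit \<alpha>)" by (rule continuous_on_subset[OF continuous_on_crit[OF a] sub])
    fix r assume r: "r \<in> {0<..<R} - {1}"
    hence rr: "0 < r" "r \<noteq> 1" "r \<in> radii \<alpha>" using sub by auto
    show "(crit \<alpha> has_vector_derivative 2 * pi * r * radial_density \<alpha> r) (at r)"
      using deriv_crit_potential(1)[OF a rr] by (simp add: has_real_derivative_iff_has_vector_derivative)
  qed (use R in \<open>auto simp: radii_def split: if_splits\<close>)
  hence hi: "((\<lambda>r. 2 * pi * r * radial_density \<alpha> r) has_integral (crit \<alpha> R)) {0..R}" by simp
  have nn: "0 \<le> 2 * pi * r * radial_density \<alpha> r" if "r \<in> {0..R}" for r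
    using that a by (auto simp: radial_density_nonneg)
  have "(\<integral>\<^sup>+r. ennreal (indicator {0..R} r * (2 * pi * r * radial_density \<alpha> r)) \<partial>lborel) = ennreal (crit \<alpha> R)"
    by (rule nn_integral_has_integral_lebesgue[OF nn hi])
  thus ?thesis by (subst (asm) nn_integral_cong[where v="\<lambda>r. ennreal (2 * pi * r * radial_density \<alpha> r) * indicator {0..R} r"])
     (auto simp: indicator_def)
qed

section \<open>Logarithmic potential and Jensen identity of the limit measure\<close>

abbreviation lim_density :: "real \<Rightarrow> complex \<Rightarrow> ennreal" where
  "lim_density \<alpha> z \<equiv> ennreal (radial_density \<alpha> (cmod z))"

lemma nn_integral_limit_measure:
  assumes a: "0 < \<alpha>" "\<alpha> \<noteq> 1" and f [measurable]: "f \<in> borel_measurable borel"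
  shows "(\<integral>\<^sup>+z. f z \<partial>limit_measure \<alpha>) = (\<integral>\<^sup>+z. lim_density \<alpha> z * f z \<partial>lborel)"
proof -
  let ?g = "\<lambda>z. ennreal (if \<alpha> > 1 \<and> z \<in> ball 0 1 then 0 else limit_density \<alpha> z)"
  have [measurable]: "ball (0::complex) 1 \<in> sets borel" by simp
  have [measurable]: "limit_density \<alpha> \<in> borel_measurable borel"
    unfolding limit_density_def by measurable
  have U: "H_domain \<alpha> \<inter> space lborel \<in> sets lborel" by (simp add: H_domain_def)
  have g [measurable]: "?g \<in> borel_measurable borel" by measurable
  have "(\<integral>\<^sup>+z. f z \<partial>limit_measure \<alpha>) = (\<integral>\<^sup>+z. ?g z * f z \<partial>restrict_space lborel (H_domain \<alpha>))"
    unfolding limit_measure_def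
    by (subst nn_integral_density) (auto intro!: measurable_restrict_space1)
  also have "\<dots> = (\<integral>\<^sup>+z. ?g z * f z * indicator (H_domain \<alpha>) z \<partial>lborel)"
    by (subst nn_integral_restrict_space[OF U]) simp
  also have "\<dots> = (\<integral>\<^sup>+z. lim_density \<alpha> z * f z \<partial>lborel)"
    by (intro nn_integral_cong) (use a in \<open>auto simp: H_domain_def radial_density_def limit_density_def indicator_def\<close>)
  finally show ?thesis .
qed

lemma nn_integral_lim_radial:
  assumes [measurable]: "g \<in> borel_measurable borel" and a: "0 < \<alpha>"
  shows "(\<integral>\<^sup>+z. lim_density \<alpha> z * (g (cmod z) * indicator (cball 0 R) z) \<partial>lborel) =
    (\<integral>\<^sup>+r. g r * (ennreal (2 * pi * r * radial_density \<alpha> r) * indicator {0..R} r) \<partial>lborel)"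
proof -
  have "(\<integral>\<^sup>+z. lim_density \<alpha> z * (g (cmod z) * indicator (cball 0 R) z) \<partial>lborel) =
     (\<integral>\<^sup>+z. (\<lambda>r. ennreal (radial_density \<alpha> r) * (g r * indicator {..R} r)) (cmod z) \<partial>lborel)"
    by (intro nn_integral_cong) (auto simp: indicator_def)
  also have "\<dots> = (\<integral>\<^sup>+r. ennreal (radial_density \<alpha> r) * (g r * indicator {..R} r) * (ennreal (2 * pi * r) * indicator {0..} r) \<partial>lborel)"
    by (rule nn_integral_lborel_radial) measurable
  also have "\<dots> = (\<integral>\<^sup>+r. g r * (ennreal (2 * pi * r * radial_density \<alpha> r) * indicator {0..R} r) \<partial>lborel)"
    by (intro nn_integral_cong) (auto simp: indicator_def ennreal_mult' radial_density_nonneg[OF a] mult_ac)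
  finally show ?thesis .
qed

lemma nn_integral_lim_circle_average:
  assumes [measurable]: "f \<in> borel_measurable borel"
  shows "(\<integral>\<^sup>+z. lim_density \<alpha> z * f z \<partial>lborel) =
     (\<integral>\<^sup>+z. lim_density \<alpha> z * (\<integral>\<^sup>+t. f (z * circ t) \<partial>unif01) \<partial>lborel)"
proof -
  have "(\<integral>\<^sup>+z. lim_density \<alpha> z * f z \<partial>lborel) =
     (\<integral>\<^sup>+z. (\<integral>\<^sup>+t. lim_density \<alpha> (z * circ t) * f (z * circ t) \<partial>unif01) \<partial>lborel)"
    by (rule nn_integral_lborel_circle_average) measurable
  also have "\<dots> = (\<integral>\<^sup>+z. lim_density \<alpha> z * (\<integral>\<^sup>+t. f (z * circ t) \<partial>unif01) \<partial>lborel)"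
    by (intro nn_integral_cong) (simp add: norm_mult nn_integral_cmult)
  finally show ?thesis .
qed

lemma emeasure_lim_cball:
  assumes a: "0 < \<alpha>" "\<alpha> \<noteq> 1" and R: "R \<in> radii \<alpha>"
  shows "(\<integral>\<^sup>+z. lim_density \<alpha> z * indicator (cball 0 R) z \<partial>lborel) = ennreal (crit \<alpha> R)"
  using nn_integral_lim_radial[of "\<lambda>_. 1" \<alpha> R] crit_integral[OF a R] a by simp

lemma measurable_potential [measurable]: "potential \<alpha> \<in> borel_measurable borel"
  unfolding potential_def crit_base_def by measurable

lemma potential_mono:
  assumes a: "0 < \<alpha>" "\<alpha> \<noteq> 1" and x: "0 \<le> x" "x \<le> y" "y \<in> radii \<alpha>"
  shows "potential \<alpha> x \<le> potential \<alpha> y"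
proof (cases "x = 0")
  case True
  thus ?thesis by (simp add: potential_nonneg)
next
  case False
  hence x0: "0 < x" using x by simp
  have "crit_base \<alpha> x \<le> crit_base \<alpha> y"
  proof (cases "\<alpha> < 1")
    case True
    hence "0 < - ln y" "- ln y \<le> - ln x" using x x0 by (auto simp: radii_def)
    thus ?thesis using True a x0
      unfolding crit_base_def by (simp only: if_True) (intro divide_left_mono mult_pos_pos; linarith)
  next
    case False
    thus ?thesis using x a by (auto simp: crit_base_def intro!: divide_right_mono)
  qed
  moreover have "0 \<le> crit_base \<alpha> x" using x a by (intro crit_base_nonneg) (auto simp: radii_def split: if_splits)
  ultimately show ?thesis unfolding potential_def using a by (intro mult_left_mono powr_mono2) auto
qed

text \<open>The logarithm is subtracted from ln (2 R), which bounds it for all distances that occur.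
  Nonnegative integrands keep the later exchanges of integrals within Tonelli's theorem, in spite of
  the logarithmic singularity.\<close>

lemma circ_nn_integral_log_gap:
  assumes w: "cmod w + cmod (z - a) \<le> 2 * R" "w \<noteq> 0" "cmod (z - a) \<noteq> cmod w"
  shows "(\<integral>\<^sup>+t. ennreal (ln (2 * R) - ln (cmod (a + w * circ t - z))) \<partial>unif01) =
    ennreal (ln (2 * R) - ln (max (cmod w) (cmod (z - a))))"
proof -
  note l = circ_avg_ln_dist[OF w(3,2)]
  have "0 \<le> ln (2 * R) - ln (cmod (a + w * circ t - z))" for t
  proof -
    have "cmod (a + w * circ t - z) \<le> cmod (w * circ t) + cmod (z - a)"
      using norm_triangle_ineq4[of "w * circ t" "z - a"] by (simp add: algebra_simps)
    hence "cmod (a + w * circ t - z) \<le> 2 * R" using w(1) by (simp add: norm_mult)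
    moreover have "cmod (a + w * circ t - z) \<noteq> 0"
    proof
      assume "cmod (a + w * circ t - z) = 0"
      hence "z = a + w * circ t" by simp
      thus False using w(3) by (simp add: norm_mult)
    qed
    ultimately have "ln (cmod (a + w * circ t - z)) \<le> ln (2 * R)" by (intro ln_mono) auto
    thus ?thesis by simp
  qed
  hence "(\<integral>\<^sup>+t. ennreal (ln (2 * R) - ln (cmod (a + w * circ t - z))) \<partial>unif01) = 
     ennreal (\<integral>t. ln (2 * R) - ln (cmod (a + w * circ t - z)) \<partial>unif01)"
    using l by (intro nn_integral_eq_integral) auto
  also have "(\<integral>t. ln (2 * R) - ln (cmod (a + w * circ t - z)) \<partial>unif01) = ln (2 * R) - ln (max (cmod w) (cmod (z - a)))"
    using l unif01.prob_space by (simp add: circ_avg_def)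
  finally show ?thesis .
qed

text \<open>The density is radial, so z may be averaged over rotations, which replaces ln |w - z| by
  the logarithm of the larger of |w| and |z|; then \<open>potential_integral\<close> applies.
  Splitting ln (2 R) into ln 2 + ln R produces the term with the mass
  \<open>crit \<alpha> R\<close>.\<close>

lemma lim_log_potential:
  assumes a: "0 < \<alpha>" "\<alpha> \<noteq> 1" and R: "R \<in> radii \<alpha>" and w: "0 < cmod w" "cmod w \<le> R"
  shows "(\<integral>\<^sup>+z. lim_density \<alpha> z * (ennreal (ln (2 * R) - ln (cmod (w - z))) * indicator (cball 0 R) z) \<partial>lborel)
    = ennreal (ln 2 * crit \<alpha> R + (potential \<alpha> R - potential \<alpha> (cmod w)))"
proof -
  have [measurable]: "cball (0::complex) R \<in> sets borel" by simp
  have "(\<integral>\<^sup>+z. lim_density \<alpha> z * (ennreal (ln (2 * R) - ln (cmod (w - z))) * indicator (cball 0 R) z) \<partial>lborel) =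
    (\<integral>\<^sup>+z. lim_density \<alpha> z * (\<integral>\<^sup>+t. ennreal (ln (2 * R) - ln (cmod (w - z * circ t))) * indicator (cball 0 R) (z * circ t) \<partial>unif01) \<partial>lborel)"
    by (rule nn_integral_lim_circle_average) measurable
  also have "\<dots> = (\<integral>\<^sup>+z. lim_density \<alpha> z * ((ennreal (ln 2) + ennreal (ln R - ln (max (cmod w) (cmod z)))) * indicator (cball 0 R) z) \<partial>lborel)"
  proof (rule nn_integral_cong_AE)
    have "AE z in lborel. cmod (z - 0) \<notin> {0, cmod w}" by (rule AE_cmod_notin_finite) simp
    thus "AE z in lborel. lim_density \<alpha> z * (\<integral>\<^sup>+t. ennreal (ln (2 * R) - ln (cmod (w - z * circ t))) * indicator (cball 0 R) (z * circ t) \<partial>unif01)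
      = lim_density \<alpha> z * ((ennreal (ln 2) + ennreal (ln R - ln (max (cmod w) (cmod z)))) * indicator (cball 0 R) z)"
    proof eventually_elim
      case (elim z)
      show ?case
      proof (cases "z \<in> cball 0 R")
        case True
        hence zR: "cmod z + cmod (w - 0) \<le> 2 * R" using w by simp
        have "(\<integral>\<^sup>+t. ennreal (ln (2 * R) - ln (cmod (w - z * circ t))) * indicator (cball 0 R) (z * circ t) \<partial>unif01) =
          (\<integral>\<^sup>+t. ennreal (ln (2 * R) - ln (cmod (0 + z * circ t - w))) \<partial>unif01)"
          using True by (intro nn_integral_cong) (simp add: norm_mult norm_minus_commute)
        also have "\<dots> = ennreal (ln (2 * R) - ln (max (cmod z) (cmod (w - 0))))"
          by (rule circ_nn_integral_log_gap[OF zR]) (use elim in auto)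
        also have "\<dots> = ennreal (ln 2) + ennreal (ln R - ln (max (cmod w) (cmod z)))"
        proof -
          have "ln (2 * R) = ln 2 + ln R" using order.strict_trans2[OF w] by (simp add: ln_mult)
          moreover have "ln (max (cmod w) (cmod z)) \<le> ln R" using w True by (intro ln_mono) (auto simp: less_max_iff_disj)
          ultimately show ?thesis by (simp add: max.commute add_diff_eq flip: ennreal_plus)
        qed
        finally show ?thesis using True by simp
      qed (simp add: norm_mult)
    qed
  qed
  also have "\<dots> = (\<integral>\<^sup>+z. ennreal (ln 2) * (lim_density \<alpha> z * indicator (cball 0 R) z) +
      lim_density \<alpha> z * ((\<lambda>r. ennreal (ln R - ln (max (cmod w) r))) (cmod z) * indicator (cball 0 R) z) \<partial>lborel)"
    by (intro nn_integral_cong) (simp add: algebra_simps)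
  also have "\<dots> = ennreal (ln 2) * (\<integral>\<^sup>+z. lim_density \<alpha> z * indicator (cball 0 R) z \<partial>lborel) +
      (\<integral>\<^sup>+z. lim_density \<alpha> z * ((\<lambda>r. ennreal (ln R - ln (max (cmod w) r))) (cmod z) * indicator (cball 0 R) z) \<partial>lborel)"
    by (subst nn_integral_add) (auto simp: nn_integral_cmult)
  also have "(\<integral>\<^sup>+z. lim_density \<alpha> z * ((\<lambda>r. ennreal (ln R - ln (max (cmod w) r))) (cmod z) * indicator (cball 0 R) z) \<partial>lborel)
     = (\<integral>\<^sup>+r. ennreal ((ln R - ln (max (cmod w) r)) * (2 * pi * r * radial_density \<alpha> r)) * indicator {0..R} r \<partial>lborel)"
  proof (subst nn_integral_lim_radial[OF _ a(1)], goal_cases)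
    case 2
    show ?case
    proof (intro nn_integral_cong)
      fix r show "ennreal (ln R - ln (max (cmod w) r)) * (ennreal (2 * pi * r * radial_density \<alpha> r) * indicator {0..R} r) =
        ennreal ((ln R - ln (max (cmod w) r)) * (2 * pi * r * radial_density \<alpha> r)) * indicator {0..R} r"
      proof (cases "r \<in> {0..R}")
        case True
        hence "ln (max (cmod w) r) \<le> ln R" using w by (intro ln_mono) (auto simp: less_max_iff_disj)
        thus ?thesis using True radial_density_nonneg[OF a(1), of r] by (subst ennreal_mult) auto
      qed simp
    qed
  qed simp
  also have "\<dots> = ennreal (potential \<alpha> R - potential \<alpha> (cmod w))" by (rule potential_integral[OF a w R])
  also have "(\<integral>\<^sup>+z. lim_density \<alpha> z * indicator (cball 0 R) z \<partial>lborel) = ennreal (crit \<alpha> R)"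
    by (rule emeasure_lim_cball[OF a R])
  also have "ennreal (ln 2) * ennreal (crit \<alpha> R) + ennreal (potential \<alpha> R - potential \<alpha> (cmod w)) =
     ennreal (ln 2 * crit \<alpha> R + (potential \<alpha> R - potential \<alpha> (cmod w)))"
    using potential_mono[OF a _ w(2) R] crit_nonneg[of \<alpha> R] by (subst ennreal_mult[symmetric]) auto
  finally show ?thesis .
qed

lemma integrable_potential_circ:
  assumes a: "0 < \<alpha>" "\<alpha> \<noteq> 1" and R: "R \<in> radii \<alpha>" "cmod a + \<bar>r\<bar> \<le> R"
  shows "integrable unif01 (\<lambda>t. potential \<alpha> (cmod (a + of_real r * circ t)))"
proof (rule unif01.integrable_const_bound[where B="potential \<alpha> R"])
  show "AE t in unif01. norm (potential \<alpha> (cmod (a + of_real r * circ t))) \<le> potential \<alpha> R"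
  proof (rule AE_I2)
    fix t
    have "cmod (a + of_real r * circ t) \<le> R"
      using R(2) norm_triangle_ineq[of a "of_real r * circ t"] by (simp add: norm_mult)
    thus "norm (potential \<alpha> (cmod (a + of_real r * circ t))) \<le> potential \<alpha> R"
      using potential_mono[OF a _ _ R(1)] potential_nonneg by simp
  qed
qed measurable

text \<open>The previous identity integrated over w on the circle about a. The condition
  \<open>cmod a \<noteq> r\<close> keeps this circle away from the origin, since the identity is
  stated for |w| > 0.\<close>

lemma lim_log_circ:
  assumes a: "0 < \<alpha>" "\<alpha> \<noteq> 1" and R: "R \<in> radii \<alpha>" "cmod a + r \<le> R" and r: "0 < r" "cmod a \<noteq> r"
  shows "(\<integral>\<^sup>+z. lim_density \<alpha> z * (ennreal (ln (2 * R) - ln (max r (cmod (z - a)))) * indicator (cball 0 R) z) \<partial>lborel)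
    = ennreal (ln 2 * crit \<alpha> R + (potential \<alpha> R - circ_avg (\<lambda>z. potential \<alpha> (cmod z)) a (of_real r)))"
proof -
  have [measurable]: "cball (0::complex) R \<in> sets borel" by simp
  interpret P: pair_sigma_finite unif01 "lborel :: complex measure" ..
  let ?w = "\<lambda>t. a + of_real r * circ t"
  have wR: "cmod (?w t) \<le> R" for t
    using R(2) r norm_triangle_ineq[of a "of_real r * circ t"] by (simp add: norm_mult)
  have w0: "0 < cmod (?w t)" for t
  proof -
    have "a = - (of_real r * circ t) \<Longrightarrow> False" using r by (auto simp: norm_mult)
    thus ?thesis by (auto simp: add_eq_0_iff2)
  qed
  note int = integrable_potential_circ[OF a R(1), of a r]
  have int': "integrable unif01 (\<lambda>t. potential \<alpha> (cmod (?w t)))" using int R r by auto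
  have "(\<integral>\<^sup>+z. lim_density \<alpha> z * (ennreal (ln (2 * R) - ln (max r (cmod (z - a)))) * indicator (cball 0 R) z) \<partial>lborel) =
    (\<integral>\<^sup>+z. (\<integral>\<^sup>+t. lim_density \<alpha> z * (ennreal (ln (2 * R) - ln (cmod (?w t - z))) * indicator (cball 0 R) z) \<partial>unif01) \<partial>lborel)"
  proof (rule nn_integral_cong_AE)
    have "AE z in lborel. cmod (z - a) \<notin> {r}" by (rule AE_cmod_notin_finite) simp
    thus "AE z in lborel. lim_density \<alpha> z * (ennreal (ln (2 * R) - ln (max r (cmod (z - a)))) * indicator (cball 0 R) z)
      = (\<integral>\<^sup>+t. lim_density \<alpha> z * (ennreal (ln (2 * R) - ln (cmod (?w t - z))) * indicator (cball 0 R) z) \<partial>unif01)"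
    proof eventually_elim
      case (elim z)
      show ?case
      proof (cases "z \<in> cball 0 R")
        case True
        hence "cmod (of_real r) + cmod (z - a) \<le> 2 * R"
          using R(2) r norm_triangle_ineq4[of z a] by simp
        from circ_nn_integral_log_gap[OF this] elim r True show ?thesis
          by (simp add: nn_integral_cmult)
      qed simp
    qed
  qed
  also have "\<dots> = (\<integral>\<^sup>+t. (\<integral>\<^sup>+z. lim_density \<alpha> z * (ennreal (ln (2 * R) - ln (cmod (?w t - z))) * indicator (cball 0 R) z) \<partial>lborel) \<partial>unif01)"
    by (rule P.Fubini') measurable
  also have "\<dots> = (\<integral>\<^sup>+t. ennreal (ln 2 * crit \<alpha> R + (potential \<alpha> R - potential \<alpha> (cmod (?w t)))) \<partial>unif01)"
    using lim_log_potential[OF a R(1) w0 wR] by simp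
  also have "\<dots> = ennreal (\<integral>t. ln 2 * crit \<alpha> R + (potential \<alpha> R - potential \<alpha> (cmod (?w t))) \<partial>unif01)"
    using int' potential_mono[OF a _ wR R(1)] crit_nonneg[of \<alpha> R]
    by (intro nn_integral_eq_integral) auto
  also have "(\<integral>t. ln 2 * crit \<alpha> R + (potential \<alpha> R - potential \<alpha> (cmod (?w t))) \<partial>unif01) =
    ln 2 * crit \<alpha> R + (potential \<alpha> R - circ_avg (\<lambda>z. potential \<alpha> (cmod z)) a (of_real r))"
    using int' unif01.prob_space by (simp add: circ_avg_def)
  finally show ?thesis .
qed

lemma circ_avg_potential_le:
  assumes a: "0 < \<alpha>" "\<alpha> \<noteq> 1" and R: "R \<in> radii \<alpha>" "cmod a + r \<le> R" and r: "0 \<le> r"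
  shows "circ_avg (\<lambda>z. potential \<alpha> (cmod z)) a (of_real r) \<le> potential \<alpha> R"
  unfolding circ_avg_def
proof (rule unif01.integral_le_const)
  show "integrable unif01 (\<lambda>t. potential \<alpha> (cmod (a + of_real r * circ t)))"
    using integrable_potential_circ[OF a R(1), of a r] R r by auto
  show "AE t in unif01. potential \<alpha> (cmod (a + of_real r * circ t)) \<le> potential \<alpha> R"
  proof (rule AE_I2)
    fix t
    have "cmod (a + of_real r * circ t) \<le> R"
      using R(2) r norm_triangle_ineq[of a "of_real r * circ t"] by (simp add: norm_mult)
    thus "potential \<alpha> (cmod (a + of_real r * circ t)) \<le> potential \<alpha> R"
      using potential_mono[OF a _ _ R(1)] by simp
  qed
qed

text \<open>Jensen's identity for the limit measure, the counterpart of
  \<open>jensen_jkernel\<close>: subtracting two radii removes the constant that depends on R.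
  Outside \<open>cball 0 R\<close> the kernel vanishes, because |z - a| \<ge> r there.\<close>

lemma lim_jkernel:
  assumes a: "0 < \<alpha>" "\<alpha> \<noteq> 1" and R: "R \<in> radii \<alpha>" "cmod a + r \<le> R" and r: "0 < r" "cmod a \<noteq> r" "cmod a \<noteq> r / 2"
  shows "(\<integral>\<^sup>+z. lim_density \<alpha> z * ennreal (jkernel r (cmod (z - a))) \<partial>lborel) =
    ennreal (circ_avg (\<lambda>z. potential \<alpha> (cmod z)) a (of_real r) - circ_avg (\<lambda>z. potential \<alpha> (cmod z)) a (of_real (r / 2)))"
    (is "?K = ennreal (?A1 - ?A2)")
    and "circ_avg (\<lambda>z. potential \<alpha> (cmod z)) a (of_real (r / 2)) \<le> circ_avg (\<lambda>z. potential \<alpha> (cmod z)) a (of_real r)"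
proof -
  have [measurable]: "cball (0::complex) R \<in> sets borel" by simp
  let ?f = "\<lambda>r z. lim_density \<alpha> z * (ennreal (ln (2 * R) - ln (max r (cmod (z - a)))) * indicator (cball 0 R) z)"
  let ?c = "ln 2 * crit \<alpha> R + potential \<alpha> R"
  have R2: "cmod a + r / 2 \<le> R" using R r by auto
  have f1: "(\<integral>\<^sup>+z. ?f r z \<partial>lborel) = ennreal (?c - ?A1)"
    using lim_log_circ[OF a R r(1,2)] by (simp add: algebra_simps)
  have f2: "(\<integral>\<^sup>+z. ?f (r / 2) z \<partial>lborel) = ennreal (?c - ?A2)"
    using lim_log_circ[OF a R(1) R2 _ r(3)] r by (simp add: algebra_simps)
  have c1: "0 \<le> ?c - ?A1" using circ_avg_potential_le[OF a R] r crit_nonneg[of \<alpha> R] by (simp add: add_increasing)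
  have c2: "0 \<le> ?c - ?A2" using circ_avg_potential_le[OF a R(1) R2] r crit_nonneg[of \<alpha> R] by (simp add: add_increasing)
  have "(\<integral>\<^sup>+z. ?f (r / 2) z \<partial>lborel) = (\<integral>\<^sup>+z. ?f r z + lim_density \<alpha> z * ennreal (jkernel r (cmod (z - a))) \<partial>lborel)"
  proof (intro nn_integral_cong)
    fix z
    show "?f (r / 2) z = ?f r z + lim_density \<alpha> z * ennreal (jkernel r (cmod (z - a)))"
    proof (cases "z \<in> cball 0 R")
      case True
      hence "cmod (z - a) \<le> 2 * R" using R r norm_triangle_ineq4[of z a] by simp
      hence "max r (cmod (z - a)) \<le> 2 * R" using R r norm_ge_zero[of a] by (auto simp del: norm_ge_zero)
      hence "ln (max r (cmod (z - a))) \<le> ln (2 * R)" using r by (intro ln_mono) auto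
      hence "ennreal (ln (2 * R) - ln (max (r / 2) (cmod (z - a)))) = 
        ennreal (ln (2 * R) - ln (max r (cmod (z - a)))) + ennreal (jkernel r (cmod (z - a)))"
        using jkernel_nonneg[OF r(1)] by (subst ennreal_plus[symmetric]) (auto simp: jkernel_def)
      thus ?thesis using True by (simp add: distrib_left)
    next
      case False
      hence "r \<le> cmod (z - a)" using R norm_triangle_ineq2[of z a] by auto
      thus ?thesis using False by (simp add: jkernel_eq_0[OF r(1)])
    qed
  qed
  also have "\<dots> = (\<integral>\<^sup>+z. ?f r z \<partial>lborel) + ?K" by (rule nn_integral_add) measurable
  finally have eq: "ennreal (?c - ?A2) = ennreal (?c - ?A1) + ?K" unfolding f1 f2 .
  have "ennreal (?c - ?A1) \<le> ennreal (?c - ?A2)" unfolding eq by simp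
  thus le: "?A2 \<le> ?A1" using c2 by (simp add: ennreal_le_iff)
  have "ennreal (?c - ?A2) = ennreal (?c - ?A1) + ennreal (?A1 - ?A2)"
    using c1 le by (subst ennreal_plus[symmetric]) auto
  hence "ennreal (?c - ?A1) + ?K = ennreal (?c - ?A1) + ennreal (?A1 - ?A2)" by (rule trans[OF eq[symmetric]])
  thus "?K = ennreal (?A1 - ?A2)" unfolding ennreal_add_left_cancel by simp
qed

section \<open>The random series\<close>

text \<open>Scale-free form of the deterministic coefficient: for n > 0, n^(1-\<alpha>) k^\<alpha> =
  n (k/n)^\<alpha>.\<close>

definition weight :: "real \<Rightarrow> nat \<Rightarrow> nat \<Rightarrow> real" where
  "weight \<alpha> n k = exp (real n * coeff_exp \<alpha> (real k / real n))"

text \<open>The deterministic form in which the log moment reaches the analytic part; it makes the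
  series converge on the whole domain for n > 0.\<close>

definition subexponential :: "(nat \<Rightarrow> complex) \<Rightarrow> bool" where
  "subexponential c \<longleftrightarrow> (\<forall>\<epsilon>>0. \<exists>C. \<forall>k. cmod (c k) \<le> C * exp (\<epsilon> * real k))"

lemma H_eq_weight:
  assumes "n > 0"
  shows "H \<alpha> c n z = (\<Sum>k. c k * of_real (weight \<alpha> n k) * z ^ k)"
proof -
  have "real n powr (1 - \<alpha>) * real k powr \<alpha> = real n * (real k / real n) powr \<alpha>" for k
    using assms by (simp add: powr_divide powr_diff)
  thus ?thesis by (simp add: H_def weight_def coeff_exp_def)
qed

lemma weight_power_eq:
  assumes "n > 0" "x > 0"
  shows "weight \<alpha> n k * x ^ k = exp (n * (coeff_exp \<alpha> (k / n) + k / n * ln x))"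
proof -
  have "n * (coeff_exp \<alpha> (k / n) + k / n * ln x) = n * coeff_exp \<alpha> (k / n) + k * ln x"
    using assms by (simp add: distrib_left)
  moreover have "exp (k * ln x) = x ^ k" using assms by (simp add: exp_of_nat_mult)
  ultimately show ?thesis by (simp add: weight_def exp_add)
qed

lemma weight_power_le:
  assumes a: "0 < \<alpha>" "\<alpha> \<noteq> 1" and n: "n > 0" and x: "0 < x" "x \<in> radii \<alpha>"
  shows "weight \<alpha> n k * x ^ k \<le> exp (n * potential \<alpha> x)"
proof -
  have "n * (coeff_exp \<alpha> (k / n) + k / n * ln x) \<le> n * potential \<alpha> x"
    by (intro mult_left_mono potential_eq_crit(2)[OF a x]) auto
  thus ?thesis by (simp add: weight_power_eq[OF n x(1)])
qed

lemma weight_pos: "weight \<alpha> n k > 0"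
  by (simp add: weight_def)

text \<open>One factor exp (\<epsilon> k) pays for the growth of the coefficients, a second one
  leaves a geometric series of ratio exp (-\<epsilon>). Hence the potential is evaluated at the
  enlarged radius x exp (2 \<epsilon>).\<close>

lemma H_bound:
  assumes a: "0 < \<alpha>" "\<alpha> \<noteq> 1" and n: "n > 0" and e: "\<epsilon> > 0"
    and c: "\<And>k. cmod (c k) \<le> C * exp (\<epsilon> * real k)"
    and x: "0 < x" "x * exp (2 * \<epsilon>) \<in> radii \<alpha>" and z: "cmod z \<le> x"
  shows "summable (\<lambda>k. c k * of_real (weight \<alpha> n k) * z ^ k)"
    and "cmod (H \<alpha> c n z) \<le> C / (1 - exp (- \<epsilon>)) * exp (n * potential \<alpha> (x * exp (2 * \<epsilon>)))"
proof -
  let ?y = "x * exp (2 * \<epsilon>)"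
  have y: "0 < ?y" using x by simp
  have C: "C \<ge> 0" using order_trans[OF norm_ge_zero c[of 0]] by simp
  have bd: "cmod (c k * of_real (weight \<alpha> n k) * z ^ k) \<le> C * exp (n * potential \<alpha> ?y) * exp (- \<epsilon>) ^ k" for k
  proof -
    have "cmod (c k * of_real (weight \<alpha> n k) * z ^ k) = cmod (c k) * weight \<alpha> n k * cmod z ^ k"
      using weight_pos[of \<alpha> n k] by (simp add: norm_mult norm_power)
    also have "\<dots> \<le> (C * exp (\<epsilon> * k)) * weight \<alpha> n k * x ^ k"
      by (intro mult_mono c power_mono order_refl z mult_nonneg_nonneg)
         (use x C weight_pos[of \<alpha> n k] in auto)
    also have "\<dots> = C * (weight \<alpha> n k * ?y ^ k) * exp (- \<epsilon>) ^ k"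
    proof -
      have "exp (2 * \<epsilon>) ^ k * exp (- \<epsilon>) ^ k = exp (\<epsilon> * k)"
        by (simp add: algebra_simps flip: exp_of_nat_mult exp_add)
      hence "?y ^ k * exp (- \<epsilon>) ^ k = x ^ k * exp (\<epsilon> * k)" by (simp only: power_mult_distrib mult.assoc)
      thus ?thesis by (simp add: mult_ac)
    qed
    also have "\<dots> \<le> C * exp (n * potential \<alpha> ?y) * exp (- \<epsilon>) ^ k"
      by (intro mult_right_mono mult_left_mono weight_power_le a n y x C) auto
    finally show ?thesis .
  qed
  have g: "(\<lambda>k. C * exp (n * potential \<alpha> ?y) * exp (- \<epsilon>) ^ k) sums (C * exp (n * potential \<alpha> ?y) * (1 / (1 - exp (- \<epsilon>))))"
    using e by (intro sums_mult geometric_sums) simp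
  have sn: "summable (\<lambda>k. cmod (c k * of_real (weight \<alpha> n k) * z ^ k))"
    by (rule summable_comparison_test'[OF sums_summable[OF g], of 0]) (use bd in simp)
  show "summable (\<lambda>k. c k * of_real (weight \<alpha> n k) * z ^ k)" by (rule summable_norm_cancel[OF sn])
  have "cmod (H \<alpha> c n z) \<le> (\<Sum>k. cmod (c k * of_real (weight \<alpha> n k) * z ^ k))"
    unfolding H_eq_weight[OF n] by (rule summable_norm[OF sn])
  also have "\<dots> \<le> (\<Sum>k. C * exp (n * potential \<alpha> ?y) * exp (- \<epsilon>) ^ k)"
    by (rule suminf_le[OF bd sn sums_summable[OF g]])
  also have "\<dots> = C * exp (n * potential \<alpha> ?y) * (1 / (1 - exp (- \<epsilon>)))"
    using g by (rule sums_unique[symmetric])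
  finally show "cmod (H \<alpha> c n z) \<le> C / (1 - exp (- \<epsilon>)) * exp (n * potential \<alpha> (x * exp (2 * \<epsilon>)))" by simp
qed

lemma mem_H_domain: "z \<in> H_domain \<alpha> \<longleftrightarrow> cmod z \<in> radii \<alpha>"
  by (auto simp: H_domain_def radii_def)

lemma open_H_domain [simp]: "open (H_domain \<alpha>)" and connected_H_domain [simp]: "connected (H_domain \<alpha>)"
  by (auto simp: H_domain_def)

lemma radii_room:
  assumes "x \<in> radii \<alpha>"
  obtains y \<epsilon> where "x < y" "y \<in> radii \<alpha>" "\<epsilon> > 0" "y * exp (2 * \<epsilon>) \<in> radii \<alpha>"
proof (cases "\<alpha> < 1")
  case True
  hence x: "0 \<le> x" "x < 1" using assms by (auto simp: radii_def)
  then obtain y where y: "x < y" "y < 1" using dense by blast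
  obtain u where u: "y < u" "u < 1" using y dense by blast
  \<comment> \<open>The enlarged radius y exp (2 \<epsilon>) is made equal to u, which gives
    \<epsilon> = ln (u / y) / 2.\<close>
  show ?thesis
    by (rule that[of y "ln (u / y) / 2"]) (use True x y u in \<open>auto simp: radii_def\<close>)
next
  case False
  thus ?thesis using assms by (intro that[of "x + 1" 1]) (auto simp: radii_def)
qed

lemma H_sums:
  assumes a: "0 < \<alpha>" "\<alpha> \<noteq> 1" and n: "n > 0" and c: "subexponential c" and z: "z \<in> H_domain \<alpha>"
  shows "(\<lambda>k. c k * of_real (weight \<alpha> n k) * z ^ k) sums H \<alpha> c n z"
proof -
  from z have "cmod z \<in> radii \<alpha>" by (simp add: mem_H_domain)
  then obtain y \<epsilon> where y: "cmod z < y" "y \<in> radii \<alpha>" "\<epsilon> > 0" "y * exp (2 * \<epsilon>) \<in> radii \<alpha>" by (rule radii_room)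
  obtain C where C: "\<And>k. cmod (c k) \<le> C * exp (\<epsilon> * real k)" using c y(3) unfolding subexponential_def by blast
  have "0 < y" using y(1) by (rule le_less_trans[OF norm_ge_zero])
  from H_bound(1)[OF a n y(3) C this y(4)] y(1)
  show ?thesis by (simp add: H_eq_weight[OF n] summable_sums)
qed

lemma holomorphic_H:
  assumes a: "0 < \<alpha>" "\<alpha> \<noteq> 1" and n: "n > 0" and c: "subexponential c"
  shows "H \<alpha> c n holomorphic_on H_domain \<alpha>"
proof -
  have *: "H \<alpha> c n holomorphic_on ball 0 r" if "ball 0 r \<subseteq> H_domain \<alpha>" for r
    by (rule power_series_holomorphic[where a = "\<lambda>k. c k * of_real (weight \<alpha> n k)"])
       (use H_sums[OF a n c] that in auto)
  show ?thesis
  proof (cases "\<alpha> < 1")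
    case True
    thus ?thesis using *[of 1] by (simp add: H_domain_def)
  next
    case False
    have "H \<alpha> c n field_differentiable (at z)" for z
      using *[of "cmod z + 1"] False by (intro holomorphic_on_imp_differentiable_at[of _ "ball 0 (cmod z + 1)"]) (auto simp: H_domain_def)
    thus ?thesis using False by (simp add: H_domain_def holomorphic_on_open field_differentiable_def)
  qed
qed

lemma H_not_identically_0:
  assumes a: "0 < \<alpha>" "\<alpha> \<noteq> 1" and n: "n > 0" and c: "subexponential c" and nz: "c k \<noteq> 0"
  shows "\<exists>z\<in>H_domain \<alpha>. H \<alpha> c n z \<noteq> 0"
proof (cases "H \<alpha> c n 0 = 0")
  case False
  thus ?thesis by (intro bexI[of _ 0]) (auto simp: H_domain_def)
next
  case True
  have "H \<alpha> c n 0 = c 0 * of_real (weight \<alpha> n 0)"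
    unfolding H_eq_weight[OF n] by (subst suminf_finite[of "{0}"]) auto
  hence k: "k > 0" using True nz weight_pos[of \<alpha> n 0] by (cases k) auto
  have ball1: "z \<in> H_domain \<alpha>" if "cmod z < 1" for z using that by (auto simp: H_domain_def)
  obtain s where s: "s > 0" "\<And>z. z \<in> cball 0 s - {0} \<Longrightarrow> H \<alpha> c n z \<noteq> 0"
  proof (rule powser_0_nonzero[of 1 0 "\<lambda>k. c k * of_real (weight \<alpha> n k)" "H \<alpha> c n" k])
    show "(\<lambda>k. c k * of_real (weight \<alpha> n k) * (x - 0) ^ k) sums H \<alpha> c n x" if "norm (x - 0) < 1" for x
      using H_sums[OF a n c ball1, of x] that by simp
    show "c k * of_real (weight \<alpha> n k) \<noteq> 0" using nz weight_pos[of \<alpha> n k] by simp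
  qed (use True k in auto)
  \<comment> \<open>The radius s from the isolation of zeros is cut down to 1/2 so that the witness
    also lies in the unit disc.\<close>
  have "H \<alpha> c n (of_real (min s (1/2))) \<noteq> 0" using s(1) by (intro s(2)) auto
  moreover have "of_real (min s (1/2)) \<in> H_domain \<alpha>" using s(1) by (intro ball1) (auto simp: min_def)
  ultimately show ?thesis by blast
qed

text \<open>The exponent is continuous at its maximiser and k / n moves in steps of 1 / n. Hence m
  consecutive indices, starting at the integer part of n times \<open>crit \<alpha> x\<close>, all
  come within \<epsilon> of the maximum once (m + 1) / n is small.\<close>

lemma eventually_weight_ge:
  assumes a: "0 < \<alpha>" "\<alpha> \<noteq> 1" and x: "0 < x" "x \<in> radii \<alpha>" and e: "\<epsilon> > 0"
  shows "eventually (\<lambda>n. \<exists>A. finite A \<and> card A = m \<and>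
    (\<forall>k\<in>A. weight \<alpha> n k * x ^ k \<ge> exp (real n * (potential \<alpha> x - \<epsilon>)))) sequentially"
proof -
  define g where "g t = coeff_exp \<alpha> t + t * ln x" for t
  let ?T = "crit \<alpha> x"
  have "continuous_on {0..} g"
    unfolding g_def coeff_exp_def using a
    by (cases "\<alpha> < 1") (auto intro!: continuous_intros continuous_on_powr')
  hence "\<exists>d>0. \<forall>t\<in>{0..}. dist t ?T < d \<longrightarrow> dist (g t) (g ?T) < \<epsilon>"
    unfolding continuous_on_iff using e crit_nonneg by auto
  then obtain d where d: "d > 0" "\<And>t. t \<ge> 0 \<Longrightarrow> \<bar>t - ?T\<bar> < d \<Longrightarrow> \<bar>g t - g ?T\<bar> < \<epsilon>"
    by (auto simp: dist_real_def)
  have gT: "g ?T = potential \<alpha> x" unfolding g_def by (rule potential_eq_crit(1)[OF a x])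
  have "eventually (\<lambda>n. (real m + 1) / real n < d) sequentially"
    by (rule order_tendstoD[OF _ d(1)]) real_asymp
  moreover have "eventually (\<lambda>n::nat. n > 0) sequentially" by (rule eventually_gt_at_top)
  ultimately show ?thesis
  proof eventually_elim
    case (elim n)
    let ?k0 = "nat \<lfloor>n * ?T\<rfloor>"
    show ?case
    proof (intro exI[of _ "{?k0..<?k0 + m}"] conjI ballI)
      fix k assume k: "k \<in> {?k0..<?k0 + m}"
      have nT: "0 \<le> n * ?T" using crit_nonneg by simp
      have "real ?k0 \<le> n * ?T" "n * ?T < real ?k0 + 1" using nT by (auto simp: of_nat_nat)
      moreover have "real ?k0 \<le> real k" "real k \<le> real ?k0 + real m" using k by (simp_all flip: of_nat_add)
      ultimately have "\<bar>k - n * ?T\<bar> \<le> real m + 1" by linarith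
      hence "\<bar>k - n * ?T\<bar> / n \<le> (real m + 1) / n" by (intro divide_right_mono) auto
      moreover have "k / n - ?T = (k - n * ?T) / n" using elim by (simp add: field_simps)
      ultimately have "\<bar>k / n - ?T\<bar> < d" using elim by (simp add: abs_divide)
      hence "g (k / n) \<ge> potential \<alpha> x - \<epsilon>" using d(2)[of "k / n"] gT by simp
      hence "exp (n * (potential \<alpha> x - \<epsilon>)) \<le> exp (n * g (k / n))" by (simp add: mult_left_mono)
      also have "\<dots> = weight \<alpha> n k * x ^ k"
        using elim x by (simp add: weight_power_eq g_def)
      finally show "exp (n * (potential \<alpha> x - \<epsilon>)) \<le> weight \<alpha> n k * x ^ k" .
    qed auto
  qed
qed

section \<open>Growth of the random coefficients and lower bounds at fixed points\<close>

locale random_series = iid_nondegenerate +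
  fixes \<alpha> :: real
  assumes \<alpha>: "0 < \<alpha>" "\<alpha> \<noteq> 1"
    and log_moment: "integrable M (\<lambda>\<omega>. ln (1 + cmod (\<xi> 0 \<omega>)))"
begin

abbreviation HH :: "nat \<Rightarrow> 'a \<Rightarrow> complex \<Rightarrow> complex" where
  "HH n \<omega> \<equiv> H \<alpha> (\<lambda>k. \<xi> k \<omega>) n"

lemma measurable_HH_pair [measurable]: "(\<lambda>(\<omega>, z). HH n \<omega> z) \<in> borel_measurable (M \<Otimes>\<^sub>M borel)"
  unfolding H_def split_beta by (cases "\<alpha> < 1") auto

lemma measurable_HH [measurable]: "(\<lambda>\<omega>. HH n \<omega> z) \<in> borel_measurable M"
  unfolding H_def by (cases "\<alpha> < 1") auto

lemma prob_log_eq: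
  "prob {\<omega>\<in>space M. ln (1 + cmod (\<xi> k \<omega>)) > c} = expectation (\<lambda>\<omega>. if ln (1 + cmod (\<xi> 0 \<omega>)) > c then 1 else 0)"
proof -
  have "prob {\<omega>\<in>space M. ln (1 + cmod (\<xi> k \<omega>)) > c} = expectation (indicator {\<omega>\<in>space M. ln (1 + cmod (\<xi> k \<omega>)) > c})"
    by simp
  also have "\<dots> = expectation (\<lambda>\<omega>. (\<lambda>z. if ln (1 + cmod z) > c then 1 else 0) (\<xi> k \<omega>))"
    by (intro Bochner_Integration.integral_cong) (auto simp: indicator_def)
  also have "\<dots> = expectation (\<lambda>\<omega>. (\<lambda>z. if ln (1 + cmod z) > c then 1 else 0) (\<xi> 0 \<omega>))"
    by (rule expectation_identical) measurable
  finally show ?thesis by simp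
qed

text \<open>At most X / \<epsilon> + 1 indices k satisfy \<epsilon> k < X, so the partial sums of
  the probabilities are bounded by means of the log moment.\<close>

lemma log_tail_summable:
  assumes e: "\<epsilon> > 0"
  shows "summable (\<lambda>k. prob {\<omega>\<in>space M. ln (1 + cmod (\<xi> k \<omega>)) > \<epsilon> * real k})"
proof -
  define X where "X \<omega> = ln (1 + cmod (\<xi> 0 \<omega>))" for \<omega>
  have [measurable]: "X \<in> borel_measurable M" unfolding X_def by measurable
  have X0: "X \<omega> \<ge> 0" for \<omega> by (simp add: X_def)
  have eq: "prob {\<omega>\<in>space M. ln (1 + cmod (\<xi> k \<omega>)) > \<epsilon> * real k} = expectation (\<lambda>\<omega>. if X \<omega> > \<epsilon> * k then 1 else 0)" for k
    unfolding X_def by (rule prob_log_eq)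
  have int: "integrable M (\<lambda>\<omega>. if X \<omega> > \<epsilon> * real k then 1 else 0 :: real)" for k
    by (intro integrable_unit_bounded[OF prob_space_axioms]) auto
  show ?thesis
    unfolding eq
  proof (rule summableI_nonneg_bounded)
    fix N
    have cnt: "(\<Sum>k<N. if X \<omega> > \<epsilon> * real k then 1 else 0 :: real) \<le> X \<omega> / \<epsilon> + 1" for \<omega>
    proof -
      have "(\<Sum>k<N. if X \<omega> > \<epsilon> * real k then 1 else 0 :: real) = card {k\<in>{..<N}. X \<omega> > \<epsilon> * real k}"
        by (simp add: sum.If_cases Int_def)
      also have "\<dots> \<le> card {..nat \<lfloor>X \<omega> / \<epsilon>\<rfloor>}"
      proof (intro of_nat_mono card_mono subsetI)
        fix k assume "k \<in> {k\<in>{..<N}. X \<omega> > \<epsilon> * real k}"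
        hence "real k \<le> X \<omega> / \<epsilon>" using e by (simp add: field_simps)
        thus "k \<in> {..nat \<lfloor>X \<omega> / \<epsilon>\<rfloor>}" by (simp add: le_nat_floor)
      qed auto
      also have "\<dots> \<le> X \<omega> / \<epsilon> + 1" using X0[of \<omega>] e by (simp add: of_nat_nat)
      finally show ?thesis .
    qed
    have "(\<Sum>k<N. expectation (\<lambda>\<omega>. if X \<omega> > \<epsilon> * real k then 1 else 0 :: real)) = expectation (\<lambda>\<omega>. \<Sum>k<N. if X \<omega> > \<epsilon> * real k then 1 else 0)"
      using int by (subst Bochner_Integration.integral_sum) auto
    also have "\<dots> \<le> expectation (\<lambda>\<omega>. X \<omega> / \<epsilon> + 1)"
      using log_moment int cnt by (intro integral_mono) (auto simp: X_def[abs_def])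
    finally show "(\<Sum>k<N. expectation (\<lambda>\<omega>. if X \<omega> > \<epsilon> * real k then 1 else 0)) \<le> expectation (\<lambda>\<omega>. X \<omega> / \<epsilon> + 1)" .
  qed (auto intro!: integral_nonneg_AE)
qed

text \<open>Off this event |\<xi> k| is at most exp (\<epsilon> m) exp (\<epsilon> k) for all k.
  Encoding the constant as a shift by m turns the union bound into the tail of one series.\<close>

definition unbounded_by :: "real \<Rightarrow> nat \<Rightarrow> 'a set" where
  "unbounded_by \<epsilon> m = {\<omega>\<in>space M. \<exists>k. ln (1 + cmod (\<xi> k \<omega>)) > \<epsilon> * real (k + m)}"

lemma unbounded_by_sets [measurable]: "unbounded_by \<epsilon> m \<in> events"
  unfolding unbounded_by_def by measurable

lemma bounded_by:
  assumes "\<omega> \<in> space M" "\<omega> \<notin> unbounded_by \<epsilon> m"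
  shows "cmod (\<xi> k \<omega>) \<le> exp (\<epsilon> * real m) * exp (\<epsilon> * real k)"
proof -
  have "ln (1 + cmod (\<xi> k \<omega>)) \<le> \<epsilon> * real (k + m)" using assms by (auto simp: unbounded_by_def not_less)
  moreover have "1 + cmod (\<xi> k \<omega>) > 0" by (simp add: add_pos_nonneg)
  ultimately have "1 + cmod (\<xi> k \<omega>) \<le> exp (\<epsilon> * real (k + m))" by (metis exp_ln exp_le_cancel_iff)
  thus ?thesis by (simp add: algebra_simps exp_add)
qed

text \<open>By identical distribution the k-th event has the probability of the term with index k +
  m of the summable series, so the union bound is a tail of that series.\<close>

lemma prob_unbounded_by_tendsto_0:
  assumes e: "\<epsilon> > 0"
  shows "(\<lambda>m. prob (unbounded_by \<epsilon> m)) \<longlonglongrightarrow> 0"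
proof -
  let ?p = "\<lambda>k. prob {\<omega>\<in>space M. ln (1 + cmod (\<xi> k \<omega>)) > \<epsilon> * real k}"
  let ?q = "\<lambda>m k. prob {\<omega>\<in>space M. ln (1 + cmod (\<xi> k \<omega>)) > \<epsilon> * real (k + m)}"
  have q: "?q m k = ?p (k + m)" for m k by (simp only: prob_log_eq)
  have sp: "summable ?p" by (rule log_tail_summable[OF e])
  have le: "prob (unbounded_by \<epsilon> m) \<le> (\<Sum>k. ?p (k + m))" for m
  proof -
    have "unbounded_by \<epsilon> m = (\<Union>k. {\<omega>\<in>space M. ln (1 + cmod (\<xi> k \<omega>)) > \<epsilon> * real (k + m)})"
      by (auto simp: unbounded_by_def)
    moreover have "prob (\<Union>k. {\<omega>\<in>space M. ln (1 + cmod (\<xi> k \<omega>)) > \<epsilon> * real (k + m)}) \<le> (\<Sum>k. ?q m k)"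
    proof (rule finite_measure_subadditive_countably)
      show "summable (?q m)" using sp summable_iff_shift[of ?p m] by (simp only: q)
    qed auto
    ultimately show ?thesis by (simp only: q)
  qed
  have lim: "(\<lambda>m. \<Sum>k. ?p (k + m)) \<longlonglongrightarrow> 0" by (rule suminf_exist_split2[OF sp])
  show ?thesis
    by (rule tendsto_sandwich[OF _ _ tendsto_const lim])
       (rule always_eventually, rule allI, rule measure_nonneg, rule always_eventually, rule allI, rule le)
qed

text \<open>The rates 1 / (i + 1) reduce the claim to countably many; for each of them the
  probability of \<open>unbounded_by\<close> tends to 0 in m, so the intersection over m is
  null.\<close>

lemma AE_subexponential: "AE \<omega> in M. subexponential (\<lambda>k. \<xi> k \<omega>)"
proof -
  have "AE \<omega> in M. \<exists>m. \<omega> \<notin> unbounded_by (1 / real (Suc i)) m" for i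
  proof -
    let ?N = "\<Inter>m. unbounded_by (1 / real (Suc i)) m"
    have N: "?N \<in> events" by (intro sets.countable_INT) auto
    have "prob ?N \<le> prob (unbounded_by (1 / real (Suc i)) m)" for m by (intro finite_measure_mono) auto
    hence "prob ?N \<le> 0" using prob_unbounded_by_tendsto_0[of "1 / real (Suc i)"] by (intro LIMSEQ_le_const) auto
    hence "?N \<in> null_sets M" using N by (simp add: null_sets_def emeasure_eq_measure measure_le_0_iff)
    from AE_not_in[OF this] show ?thesis by eventually_elim auto
  qed
  hence "AE \<omega> in M. \<forall>i. \<exists>m. \<omega> \<notin> unbounded_by (1 / real (Suc i)) m" by (simp add: AE_all_countable)
  thus ?thesis
  proof (rule AE_mp, intro AE_I2 impI)
    fix \<omega> assume w: "\<omega> \<in> space M" "\<forall>i. \<exists>m. \<omega> \<notin> unbounded_by (1 / real (Suc i)) m"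
    show "subexponential (\<lambda>k. \<xi> k \<omega>)"
      unfolding subexponential_def
    proof (intro allI impI)
      fix \<epsilon> :: real assume "\<epsilon> > 0"
      then obtain i where i: "1 / real (Suc i) < \<epsilon>" using nat_approx_posE by blast
      obtain m where m: "\<omega> \<notin> unbounded_by (1 / real (Suc i)) m" using w(2) by blast
      show "\<exists>C. \<forall>k. cmod (\<xi> k \<omega>) \<le> C * exp (\<epsilon> * real k)"
      proof (intro exI allI)
        fix k
        have "cmod (\<xi> k \<omega>) \<le> exp (1 / real (Suc i) * real m) * exp (1 / real (Suc i) * real k)" by (rule bounded_by[OF w(1) m])
        also have "\<dots> \<le> exp (1 / real (Suc i) * real m) * exp (\<epsilon> * real k)"
          using i by (intro mult_left_mono iffD2[OF exp_le_cancel_iff] mult_right_mono) auto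
        finally show "cmod (\<xi> k \<omega>) \<le> exp (1 / real (Suc i) * real m) * exp (\<epsilon> * real k)" .
      qed
    qed
  qed
qed

text \<open>The number j is fixed by the desired bound d, before n: for large n there are 2 j terms
  above the threshold, and the small-ball estimate depends on j alone. The origin is excluded
  because only the constant term survives there.\<close>

lemma prob_HH_small_tendsto_0:
  assumes z: "z \<in> H_domain \<alpha>" "z \<noteq> 0" and e: "\<epsilon> > 0"
  shows "(\<lambda>n. prob {\<omega>\<in>space M. cmod (HH n \<omega> z) \<le> exp (n * (potential \<alpha> (cmod z) - \<epsilon>))}) \<longlonglongrightarrow> 0"
proof (rule order_tendstoI)
  fix d :: real assume d: "d > 0"
  have x: "0 < cmod z" "cmod z \<in> radii \<alpha>" using z by (auto simp: mem_H_domain)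
  have "(\<lambda>j. exp (1/2) * gauss_walk j) \<longlonglongrightarrow> exp (1/2) * 0" by (intro tendsto_intros gauss_walk_tendsto_0)
  hence "eventually (\<lambda>j. exp (1/2) * gauss_walk j < d) sequentially" using d by (intro order_tendstoD) auto
  moreover have "eventually (\<lambda>j::nat. j > 0) sequentially" by (rule eventually_gt_at_top)
  ultimately have "eventually (\<lambda>j. exp (1/2) * gauss_walk j < d \<and> j > 0) sequentially" by eventually_elim auto
  then obtain j where j: "exp (1/2) * gauss_walk j < d" "j > 0" by (auto simp: eventually_sequentially)
  show "eventually (\<lambda>n. prob {\<omega>\<in>space M. cmod (HH n \<omega> z) \<le> exp (n * (potential \<alpha> (cmod z) - \<epsilon>))} < d) sequentially"
    using eventually_weight_ge[OF \<alpha> x e, of "2 * j"] eventually_gt_at_top[of 0]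
  proof eventually_elim
    case (elim n)
    then obtain A where A: "finite A" "card A = 2 * j"
      "\<And>k. k \<in> A \<Longrightarrow> weight \<alpha> n k * cmod z ^ k \<ge> exp (n * (potential \<alpha> (cmod z) - \<epsilon>))" by blast
    have "prob {\<omega>\<in>space M. cmod (HH n \<omega> z) \<le> exp (n * (potential \<alpha> (cmod z) - \<epsilon>))} \<le> exp (1/2) * gauss_walk j"
    proof (rule small_ball_series[where b = "\<lambda>k. of_real (weight \<alpha> n k) * z ^ k" and A = A])
      show "AE \<omega> in M. (\<lambda>N. \<Sum>k<N. of_real (weight \<alpha> n k) * z ^ k * \<xi> k \<omega>) \<longlonglongrightarrow> HH n \<omega> z"
        using AE_subexponential
      proof eventually_elim
        case (elim \<omega>)
        from H_sums[OF \<alpha> \<open>0 < n\<close> this z(1)] show ?case by (simp add: sums_def mult_ac)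
      qed
      show "exp (n * (potential \<alpha> (cmod z) - \<epsilon>)) \<le> cmod (of_real (weight \<alpha> n k) * z ^ k)" if "k \<in> A" for k
        using A(3)[OF that] weight_pos[of \<alpha> n k] by (simp add: norm_mult norm_power)
    qed (use A j in auto)
    thus ?case using j by simp
  qed
next
  fix d :: real assume d: "d < 0"
  show "eventually (\<lambda>n. d < prob {\<omega>\<in>space M. cmod (HH n \<omega> z) \<le> exp (n * (potential \<alpha> (cmod z) - \<epsilon>))}) sequentially"
    using d by (intro always_eventually allI) (auto intro: less_le_trans[OF _ measure_nonneg])
qed

end

section \<open>Convergence of the logarithmic potentials in probability\<close>

text \<open>The centres form a grid of spacing h shifted by h / 2, which keeps the origin out, where
  no lower bound for |H_n| is available. Every point of the disc is within h / sqrt 2 of a centre,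
  and the number of centres times h^2 is bounded independently of h.\<close>

lemma finite_disc_cover:
  assumes h: "0 < h" "h \<le> 1" and x: "0 \<le> x"
  obtains S :: "complex set" where "finite S" "0 \<notin> S" "\<And>a. a \<in> S \<Longrightarrow> cmod a \<le> x + h"
    "cball 0 x \<subseteq> (\<Union>a\<in>S. ball a h)" "real (card S) * h\<^sup>2 \<le> (2 * x + 5)\<^sup>2"
proof -
  define N where "N = \<lceil>x / h\<rceil> + 1"
  define g where "g = (\<lambda>(i::int, j::int). Complex (h * (of_int i + 1/2)) (h * (of_int j + 1/2)))"
  define S where "S = {a \<in> g ` ({-N..N} \<times> {-N..N}). cmod a \<le> x + h}"
  have N0: "N \<ge> 0" using h x unfolding N_def by (smt (verit) divide_nonneg_pos zero_le_ceiling)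
  have fin: "finite S" unfolding S_def by auto
  have half: "of_int i + 1/2 \<noteq> (0::real)" for i :: int
  proof
    assume "of_int i + 1/2 = (0::real)"
    hence "of_int (2 * i + 1) = (of_int 0 :: real)" by simp
    hence "2 * i + 1 = 0" by (simp only: of_int_eq_iff)
    thus False by presburger
  qed
  show thesis
  proof (rule that[OF fin])
    show "0 \<notin> S" using half h by (auto simp: S_def g_def complex_eq_iff)
    show "cmod a \<le> x + h" if "a \<in> S" for a using that by (simp add: S_def)
    show "cball 0 x \<subseteq> (\<Union>a\<in>S. ball a h)"
    proof
      fix w :: complex assume "w \<in> cball 0 x"
      hence w: "cmod w \<le> x" by simp
      define i j where "i = \<lfloor>Re w / h\<rfloor>" and "j = \<lfloor>Im w / h\<rfloor>"
      have bound: "\<lfloor>u / h\<rfloor> \<in> {-N..N} \<and> \<bar>h * (of_int \<lfloor>u / h\<rfloor> + 1/2) - u\<bar> \<le> h / 2" if "\<bar>u\<bar> \<le> x" for u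
      proof
        have "\<bar>u / h\<bar> \<le> x / h" using that h by (simp add: abs_divide divide_right_mono)
        hence "u / h \<le> x / h" "- (x / h) \<le> u / h" by linarith+
        thus "\<lfloor>u / h\<rfloor> \<in> {-N..N}" unfolding N_def by (auto; linarith)
        have "\<bar>of_int \<lfloor>u / h\<rfloor> + 1/2 - u / h\<bar> \<le> 1/2" by linarith
        hence "h * \<bar>of_int \<lfloor>u / h\<rfloor> + 1/2 - u / h\<bar> \<le> h * (1/2)" using h by (intro mult_left_mono) auto
        moreover have "h * \<bar>of_int \<lfloor>u / h\<rfloor> + 1/2 - u / h\<bar> = \<bar>h * (of_int \<lfloor>u / h\<rfloor> + 1/2 - u / h)\<bar>" using h by (simp add: abs_mult)
        moreover have "h * (of_int \<lfloor>u / h\<rfloor> + 1/2 - u / h) = h * (of_int \<lfloor>u / h\<rfloor> + 1/2) - u"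
          using h by (simp add: right_diff_distrib)
        ultimately show "\<bar>h * (of_int \<lfloor>u / h\<rfloor> + 1/2) - u\<bar> \<le> h / 2" by simp
      qed
      have re: "\<bar>Re w\<bar> \<le> x" and im: "\<bar>Im w\<bar> \<le> x" using w abs_Re_le_cmod[of w] abs_Im_le_cmod[of w] by auto
      have "cmod (g (i, j) - w) \<le> sqrt ((h/2)\<^sup>2 + (h/2)\<^sup>2)"
        unfolding cmod_def g_def i_def j_def using bound[OF re] bound[OF im]
        by (intro real_sqrt_le_mono add_mono) (auto intro!: abs_le_square_iff[THEN iffD1] simp: h less_imp_le)
      also have "\<dots> < sqrt (h\<^sup>2)" using h by (intro real_sqrt_less_mono) (simp add: power2_eq_square)
      finally have d: "cmod (g (i, j) - w) < h" using h by simp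
      have "cmod (g (i, j)) \<le> x + h" using d w norm_triangle_sub[of "g (i, j)" w] by simp
      hence "g (i, j) \<in> S" unfolding S_def using bound[OF re] bound[OF im] by (auto simp: i_def j_def)
      thus "w \<in> (\<Union>a\<in>S. ball a h)" using d by (auto simp: dist_norm)
    qed
    have "card S \<le> card (g ` ({-N..N} \<times> {-N..N}))" unfolding S_def by (intro card_mono) auto
    also have "\<dots> \<le> card ({-N..N} \<times> {-N..N})" by (rule card_image_le) auto
    also have "\<dots> = nat (2 * N + 1) ^ 2" by (simp add: card_cartesian_product power2_eq_square)
    finally have "real (card S) \<le> real (nat (2 * N + 1)) ^ 2" by (metis of_nat_le_iff of_nat_power)
    also have "real (nat (2 * N + 1)) = 2 * of_int N + 1" using N0 by simp
    finally have "real (card S) * h\<^sup>2 \<le> (2 * of_int N + 1)\<^sup>2 * h\<^sup>2" by (rule mult_right_mono) simp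
    also have "\<dots> = ((2 * of_int N + 1) * h)\<^sup>2" by (simp add: power_mult_distrib)
    also have "\<dots> \<le> (2 * x + 5)\<^sup>2"
    proof (rule power_mono)
      have "of_int N \<le> x / h + 2" unfolding N_def by linarith
      hence "(2 * of_int N + 1) * h \<le> (2 * (x / h + 2) + 1) * h" using h by (intro mult_right_mono) auto
      also have "\<dots> = 2 * x + 5 * h" using h by (simp add: field_simps)
      finally show "(2 * of_int N + 1) * h \<le> 2 * x + 5" using h by simp
      show "0 \<le> (2 * of_int N + 1) * h" using N0 h by simp
    qed
    finally show "real (card S) * h\<^sup>2 \<le> (2 * x + 5)\<^sup>2" .
  qed
qed

text \<open>Values in \<open>ennreal\<close> allow integration without a prior proof that ln |H| is
  integrable. At zeros of H the convention ln 0 = 0 gives a finite value.\<close>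

definition log_gap :: "real \<Rightarrow> (nat \<Rightarrow> complex) \<Rightarrow> nat \<Rightarrow> complex \<Rightarrow> ennreal" where
  "log_gap \<alpha> c n w = ennreal \<bar>ln (cmod (H \<alpha> c n w)) / n - potential \<alpha> (cmod w)\<bar>"

lemma measurable_H_arg [measurable]: "H \<alpha> c n \<in> borel_measurable borel"
  unfolding H_def[abs_def] by (cases "\<alpha> < 1") auto

lemma measurable_log_gap [measurable]: "log_gap \<alpha> c n \<in> borel_measurable borel"
  unfolding log_gap_def[abs_def] by measurable

text \<open>On the disc the gap is at most the sum of \<beta> - ln |H| / n and |\<beta> -
  potential|. The first summand is nonnegative, and the sub-mean value property bounds its integral
  by the area of the disc times its value at the centre, which is at most \<beta> -
  \<gamma>.\<close>

lemma log_gap_ball: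
  assumes a: "0 < \<alpha>" "\<alpha> \<noteq> 1" and n: "n > 0" and sub: "subexponential c"
    and e: "\<epsilon> > 0" and c: "\<And>k. cmod (c k) \<le> C * exp (\<epsilon> * real k)"
    and h: "0 < h" and dom: "(cmod z + h) * exp (2 * \<epsilon>) \<in> radii \<alpha>"
    and \<beta>: "C / (1 - exp (- \<epsilon>)) * exp (n * potential \<alpha> ((cmod z + h) * exp (2 * \<epsilon>))) \<le> exp (n * \<beta>)" "\<beta> \<ge> 0"
    and \<gamma>: "exp (n * \<gamma>) \<le> cmod (H \<alpha> c n z)"
    and \<kappa>: "\<And>w. w \<in> ball z h \<Longrightarrow> \<bar>\<beta> - potential \<alpha> (cmod w)\<bar> \<le> \<kappa>"
  shows "(\<integral>\<^sup>+w. log_gap \<alpha> c n w * indicator (ball z h) w \<partial>lborel) \<le> ennreal (pi * h\<^sup>2 * (\<beta> - \<gamma> + \<kappa>))"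
proof -
  have [measurable]: "ball z h \<in> sets borel" by simp
  let ?x = "cmod z + h"
  have x: "0 < ?x" using h by (simp add: add_nonneg_pos)
  \<comment> \<open>A disc slightly larger than \<open>ball z h\<close> on which H is still
    holomorphic: |z| + R is at most (|z| + h) exp (2 \<epsilon>).\<close>
  define R where "R = h * exp (2 * \<epsilon>)"
  have "h * 1 < R" unfolding R_def using e h by (intro mult_strict_left_mono) auto
  hence hR: "h < R" by simp
  have "ball z R \<subseteq> H_domain \<alpha>"
  proof
    fix w assume "w \<in> ball z R"
    hence "cmod w < cmod z + R" using norm_triangle_sub[of w z] by (simp add: dist_norm norm_minus_commute)
    also have "cmod z * 1 + R \<le> cmod z * exp (2 * \<epsilon>) + R" using e by (intro add_right_mono mult_left_mono) auto
    hence "cmod z + R \<le> ?x * exp (2 * \<epsilon>)" by (simp add: R_def distrib_right)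
    finally show "w \<in> H_domain \<alpha>" using dom by (auto simp: mem_H_domain radii_def split: if_splits)
  qed
  hence G: "H \<alpha> c n holomorphic_on ball z R" using holomorphic_H[OF a n sub] holomorphic_on_subset by blast
  have Hz: "H \<alpha> c n z \<noteq> 0" using \<gamma> by (auto dest: order.strict_trans2[OF exp_gt_zero])
  have bd: "cmod (H \<alpha> c n w) \<le> exp (n * \<beta>)" if "w \<in> ball z h" for w
  proof -
    have "cmod w \<le> ?x" using that norm_triangle_sub[of w z] by (simp add: dist_norm norm_minus_commute)
    from H_bound(2)[OF a n e c x dom this] \<beta> show ?thesis by linarith
  qed
  have zh: "z \<in> ball z h" using h by simp
  have \<kappa>0: "\<kappa> \<ge> 0" using \<kappa>[OF zh] by simp
  have "(\<integral>\<^sup>+w. log_gap \<alpha> c n w * indicator (ball z h) w \<partial>lborel) \<le>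
    (\<integral>\<^sup>+w. ennreal (1 / n) * (ennreal (n * \<beta> - ln (cmod (H \<alpha> c n w))) * indicator (ball z h) w) + ennreal \<kappa> * indicator (ball z h) w \<partial>lborel)"
  proof (rule nn_integral_mono)
    fix w
    show "log_gap \<alpha> c n w * indicator (ball z h) w \<le> 
      ennreal (1 / n) * (ennreal (n * \<beta> - ln (cmod (H \<alpha> c n w))) * indicator (ball z h) w) + ennreal \<kappa> * indicator (ball z h) w"
    proof (cases "w \<in> ball z h")
      case True
      \<comment> \<open>At a zero the convention ln 0 = 0 turns the bound into 0 \<le> n \<beta>,
        which is where \<open>\<beta> \<ge> 0\<close> enters.\<close>
      have ub: "ln (cmod (H \<alpha> c n w)) \<le> n * \<beta>"
      proof (cases "H \<alpha> c n w = 0")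
        case False
        hence "ln (cmod (H \<alpha> c n w)) \<le> ln (exp (n * \<beta>))" using bd[OF True] by (intro ln_mono) auto
        thus ?thesis by simp
      qed (use \<beta> in simp)
      have eq: "1 / n * (n * \<beta> - ln (cmod (H \<alpha> c n w))) = \<beta> - ln (cmod (H \<alpha> c n w)) / n"
        using n by (simp add: field_simps)
      have "0 \<le> 1 / n * (n * \<beta> - ln (cmod (H \<alpha> c n w)))" using ub by simp
      hence "\<bar>ln (cmod (H \<alpha> c n w)) / n - potential \<alpha> (cmod w)\<bar> \<le> 1 / n * (n * \<beta> - ln (cmod (H \<alpha> c n w))) + \<kappa>"
        using \<kappa>[OF True] unfolding eq by linarith
      hence "log_gap \<alpha> c n w \<le> ennreal (1 / n * (n * \<beta> - ln (cmod (H \<alpha> c n w))) + \<kappa>)"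
        unfolding log_gap_def by (rule ennreal_leI)
      also have "\<dots> = ennreal (1 / n) * ennreal (n * \<beta> - ln (cmod (H \<alpha> c n w))) + ennreal \<kappa>"
        using ub \<kappa>0 by (subst ennreal_mult[symmetric]) (auto simp flip: ennreal_plus)
      finally show ?thesis using True by simp
    qed simp
  qed
  also have "\<dots> = ennreal (1 / n) * (\<integral>\<^sup>+w. ennreal (n * \<beta> - ln (cmod (H \<alpha> c n w))) * indicator (ball z h) w \<partial>lborel) + ennreal \<kappa> * ennreal (pi * h\<^sup>2)"
    using h by (subst nn_integral_add) (auto simp: nn_integral_cmult nn_integral_cmult_indicator emeasure_complex_ball)
  also have "\<dots> \<le> ennreal (1 / n) * ennreal (pi * h\<^sup>2 * (n * \<beta> - ln (cmod (H \<alpha> c n z)))) + ennreal \<kappa> * ennreal (pi * h\<^sup>2)"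
    by (intro add_right_mono mult_left_mono nn_integral_upper_gap_ball[OF G h hR Hz _ bd]) auto
  also have "\<dots> \<le> ennreal (1 / n) * ennreal (pi * h\<^sup>2 * (n * \<beta> - n * \<gamma>)) + ennreal \<kappa> * ennreal (pi * h\<^sup>2)"
  proof -
    have "ln (exp (n * \<gamma>)) \<le> ln (cmod (H \<alpha> c n z))" using \<gamma> by (intro ln_mono) auto
    thus ?thesis using h by (intro add_right_mono mult_left_mono ennreal_leI) auto
  qed
  also have "\<dots> = ennreal (pi * h\<^sup>2 * (\<beta> - \<gamma> + \<kappa>))"
  proof -
    have "exp (n * \<gamma>) \<le> exp (n * \<beta>)" using \<gamma> bd[OF zh] by (rule order_trans)
    hence "\<gamma> \<le> \<beta>" using n by simp
    have "1 / n * (pi * h\<^sup>2 * (n * \<beta> - n * \<gamma>)) = pi * h\<^sup>2 * (\<beta> - \<gamma>)" using n by (simp add: field_simps)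
    hence "ennreal (1 / n) * ennreal (pi * h\<^sup>2 * (n * \<beta> - n * \<gamma>)) = ennreal (pi * h\<^sup>2 * (\<beta> - \<gamma>))"
      by (subst ennreal_mult'[symmetric]) auto
    moreover have "ennreal \<kappa> * ennreal (pi * h\<^sup>2) = ennreal (pi * h\<^sup>2 * \<kappa>)"
      using \<kappa>0 by (subst ennreal_mult[symmetric]) (auto simp: mult.commute)
    ultimately show ?thesis using \<kappa>0 \<open>\<gamma> \<le> \<beta>\<close> by (simp add: distrib_left flip: ennreal_plus)
  qed
  finally show ?thesis .
qed

context random_series
begin

text \<open>The exceptional event collects two failures: coefficients too large for the upper bound,
  and values of H too small at one of finitely many centres. The centres are fixed before n, so the
  second probability is a finite sum of null sequences. Off the event the estimate is
  deterministic.\<close>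

lemma log_gap_small:
  assumes x: "x \<in> radii \<alpha>" and \<delta>: "\<delta> > 0" and \<eta>: "\<eta> > 0"
  shows "eventually (\<lambda>n. \<exists>B\<in>events. prob B \<le> \<eta> \<and> (\<forall>\<omega>\<in>space M - B. subexponential (\<lambda>k. \<xi> k \<omega>) \<longrightarrow>
    (\<integral>\<^sup>+w. log_gap \<alpha> (\<lambda>k. \<xi> k \<omega>) n w * indicator (cball 0 x) w \<partial>lborel) \<le> ennreal \<delta>)) sequentially"
proof -
  have x0: "x \<ge> 0" using x by (auto simp: radii_def split: if_splits)
  \<comment> \<open>The 6 adds the losses on one disc: 1 in the upper bound, 1 in the lower bound at
    the centre, 1 for the change of the potential from the centre to the enlarged radius, and 3 for
    comparing the upper bound with the potential on the disc. The rest, pi (2 x + 5)^2, bounds the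
    total area of the discs.\<close>
  define \<theta> where "\<theta> = \<delta> / (6 * pi * (2 * x + 5)\<^sup>2)"
  have \<theta>: "\<theta> > 0" using \<delta> x0 by (simp add: \<theta>_def)
  obtain y \<epsilon>0 where y: "x < y" "y \<in> radii \<alpha>" "\<epsilon>0 > 0" "y * exp (2 * \<epsilon>0) \<in> radii \<alpha>" using radii_room[OF x] by blast
  let ?Y = "y * exp (2 * \<epsilon>0)"
  have y0: "y > 0" using x0 y by simp
  have sub: "{0..?Y} \<subseteq> radii \<alpha>" using y by (auto simp: radii_def split: if_splits)
  have "uniformly_continuous_on {0..?Y} (potential \<alpha>)"
    by (rule compact_uniformly_continuous[OF continuous_on_subset[OF continuous_on_potential[OF \<alpha>] sub]]) simp
  then obtain d where d: "d > 0" "\<And>s t. s \<in> {0..?Y} \<Longrightarrow> t \<in> {0..?Y} \<Longrightarrow> \<bar>s - t\<bar> < d \<Longrightarrow> \<bar>potential \<alpha> s - potential \<alpha> t\<bar> < \<theta>"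
    unfolding uniformly_continuous_on_def dist_real_def using \<theta> by meson
  have "((\<lambda>\<epsilon>. y * (exp (2 * \<epsilon>) - 1)) \<longlongrightarrow> 0) (at_right 0)" by real_asymp
  hence "eventually (\<lambda>\<epsilon>. y * (exp (2 * \<epsilon>) - 1) < d / 2) (at_right 0)" using d by (intro order_tendstoD) auto
  moreover have "eventually (\<lambda>\<epsilon>. \<epsilon> \<in> {0<..<\<epsilon>0}) (at_right 0)" using y(3) by (rule eventually_at_right_real)
  ultimately have "eventually (\<lambda>\<epsilon>. y * (exp (2 * \<epsilon>) - 1) < d / 2 \<and> \<epsilon> \<in> {0<..<\<epsilon>0}) (at_right 0)" by eventually_elim auto
  then obtain \<epsilon> where \<epsilon>: "y * (exp (2 * \<epsilon>) - 1) < d / 2" "0 < \<epsilon>" "\<epsilon> < \<epsilon>0"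
    using eventually_happens[of _ "at_right (0::real)"] by (auto simp: trivial_limit_at_right_real)
  \<comment> \<open>The three bounds serve the cover, the inclusion of all discs in the disc of
    radius y, and a variation of the potential below \<theta>.\<close>
  define h where "h = Min {1, (y - x) / 2, d / 4}"
  have h: "0 < h" "h \<le> 1" "2 * h \<le> y - x" "h < d / 2" using y d by (auto simp: h_def min_def field_simps)
  obtain S :: "complex set" where S: "finite S" "0 \<notin> S" "\<And>a. a \<in> S \<Longrightarrow> cmod a \<le> x + h"
    "cball 0 x \<subseteq> (\<Union>a\<in>S. ball a h)" "real (card S) * h\<^sup>2 \<le> (2 * x + 5)\<^sup>2"
    using finite_disc_cover[OF h(1,2) x0] by blast
  have top: "(cmod a + h) * exp (2 * \<epsilon>) \<in> {0..?Y}" "(cmod a + h) * exp (2 * \<epsilon>) - cmod a < d" "cmod a + h \<le> y" if a: "a \<in> S" for a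
  proof -
    show le: "cmod a + h \<le> y" using S(3)[OF a] h by simp
    have "(cmod a + h) * exp (2 * \<epsilon>) \<le> y * exp (2 * \<epsilon>0)" using le \<epsilon> y0 h by (intro mult_mono) auto
    thus "(cmod a + h) * exp (2 * \<epsilon>) \<in> {0..?Y}" using h by simp
    have "(cmod a + h) * (exp (2 * \<epsilon>) - 1) \<le> y * (exp (2 * \<epsilon>) - 1)" using le \<epsilon> by (intro mult_right_mono) auto
    hence "(cmod a + h) * exp (2 * \<epsilon>) - (cmod a + h) < d / 2" using \<epsilon>(1) by (simp add: right_diff_distrib)
    thus "(cmod a + h) * exp (2 * \<epsilon>) - cmod a < d" using h by simp
  qed
  have yY: "y \<le> ?Y" using y0 y(3) by simp
  have aU: "a \<in> H_domain \<alpha>" "a \<noteq> 0" if "a \<in> S" for a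
    using S(2) that top(3)[OF that] h yY sub by (auto simp: mem_H_domain intro!: subsetD[OF sub])
  have "eventually (\<lambda>m. prob (unbounded_by \<epsilon> m) < \<eta> / 2) sequentially"
    using prob_unbounded_by_tendsto_0[OF \<epsilon>(2)] \<eta> by (intro order_tendstoD) auto
  then obtain m where m: "prob (unbounded_by \<epsilon> m) < \<eta> / 2" by (auto simp: eventually_sequentially)
  define C where "C = exp (\<epsilon> * real m)"
  define L where "L n a = {\<omega>\<in>space M. cmod (HH n \<omega> a) \<le> exp (n * (potential \<alpha> (cmod a) - \<theta>))}" for n a
  have L [measurable]: "L n a \<in> events" for n a unfolding L_def by measurable
  have "(\<lambda>n. \<Sum>a\<in>S. prob (L n a)) \<longlonglongrightarrow> (\<Sum>a\<in>S. 0)"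
    unfolding L_def using \<theta> aU by (intro tendsto_sum prob_HH_small_tendsto_0) auto
  hence "eventually (\<lambda>n. (\<Sum>a\<in>S. prob (L n a)) < \<eta> / 2) sequentially" using \<eta> by (intro order_tendstoD) auto
  moreover have "eventually (\<lambda>n. ln (C / (1 - exp (- \<epsilon>))) / real n < \<theta>) sequentially"
    by (rule order_tendstoD[OF _ \<theta>]) real_asymp
  moreover have "eventually (\<lambda>n::nat. n > 0) sequentially" by (rule eventually_gt_at_top)
  ultimately show ?thesis
  proof eventually_elim
    case (elim n)
    let ?B = "unbounded_by \<epsilon> m \<union> (\<Union>a\<in>S. L n a)"
    show ?case
    proof (intro bexI[of _ ?B] conjI ballI impI)
      show B: "?B \<in> events" using S(1) by (intro sets.Un unbounded_by_sets sets.finite_UN L)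
      have "prob ?B \<le> prob (unbounded_by \<epsilon> m) + prob (\<Union>a\<in>S. L n a)"
        using S(1) by (intro measure_Un_le unbounded_by_sets sets.finite_UN L)
      also have "prob (\<Union>a\<in>S. L n a) \<le> (\<Sum>a\<in>S. prob (L n a))" using S(1) by (intro finite_measure_subadditive_finite) auto
      finally show "prob ?B \<le> \<eta>" using m elim by simp
      fix \<omega> assume \<omega>: "\<omega> \<in> space M - ?B" and sub': "subexponential (\<lambda>k. \<xi> k \<omega>)"
      have each: "(\<integral>\<^sup>+w. log_gap \<alpha> (\<lambda>k. \<xi> k \<omega>) n w * indicator (ball a h) w \<partial>lborel) \<le> ennreal (pi * h\<^sup>2 * (6 * \<theta>))"
        if a: "a \<in> S" for a
      proof -
        let ?P = "potential \<alpha> ((cmod a + h) * exp (2 * \<epsilon>))"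
        have in1: "(cmod a + h) * exp (2 * \<epsilon>) \<in> {0..?Y}" and in2: "cmod a \<in> {0..?Y}"
          using top[OF a] h yY by auto
        have le: "cmod a \<le> (cmod a + h) * exp (2 * \<epsilon>)"
          using mult_mono[of "cmod a" "cmod a + h" 1 "exp (2 * \<epsilon>)"] h \<epsilon> by simp
        have P1: "\<bar>?P - potential \<alpha> (cmod a)\<bar> < \<theta>" using d(2)[OF in1 in2] top(2)[OF a] le by simp
        have "(\<integral>\<^sup>+w. log_gap \<alpha> (\<lambda>k. \<xi> k \<omega>) n w * indicator (ball a h) w \<partial>lborel) \<le>
          ennreal (pi * h\<^sup>2 * ((?P + \<theta>) - (potential \<alpha> (cmod a) - \<theta>) + 3 * \<theta>))"
        proof (rule log_gap_ball[OF \<alpha> _ sub' \<epsilon>(2) _ h(1)])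
          show "n > 0" using elim by simp
          show "cmod (\<xi> k \<omega>) \<le> C * exp (\<epsilon> * real k)" for k
            unfolding C_def using \<omega> by (intro bounded_by) auto
          show "(cmod a + h) * exp (2 * \<epsilon>) \<in> radii \<alpha>" using in1 sub by blast
          show "C / (1 - exp (- \<epsilon>)) * exp (n * ?P) \<le> exp (n * (?P + \<theta>))"
          proof -
            have "C / (1 - exp (- \<epsilon>)) > 0" using \<epsilon> by (simp add: C_def)
            hence "C / (1 - exp (- \<epsilon>)) = exp (ln (C / (1 - exp (- \<epsilon>))))" by simp
            also have "\<dots> \<le> exp (n * \<theta>)" using elim by (simp add: field_simps)
            finally have "C / (1 - exp (- \<epsilon>)) * exp (n * ?P) \<le> exp (n * \<theta>) * exp (n * ?P)" by (intro mult_right_mono) auto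
            thus ?thesis by (simp add: algebra_simps exp_add)
          qed
          show "0 \<le> ?P + \<theta>" using potential_nonneg \<theta> by (simp add: add_nonneg_nonneg)
          show "exp (n * (potential \<alpha> (cmod a) - \<theta>)) \<le> cmod (HH n \<omega> a)" using \<omega> a by (auto simp: L_def)
          fix w assume w: "w \<in> ball a h"
          have wa: "\<bar>cmod a - cmod w\<bar> < h" using w norm_triangle_ineq3[of a w] by (simp add: dist_norm)
          hence "cmod w \<in> {0..?Y}" using top(3)[OF a] yY by auto
          hence "\<bar>potential \<alpha> (cmod a) - potential \<alpha> (cmod w)\<bar> < \<theta>" using d(2)[OF in2] wa h d by simp
          thus "\<bar>?P + \<theta> - potential \<alpha> (cmod w)\<bar> \<le> 3 * \<theta>" using P1 by linarith
        qed
        also have "\<dots> \<le> ennreal (pi * h\<^sup>2 * (6 * \<theta>))"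
          using P1 by (intro ennreal_leI mult_left_mono) auto
        finally show ?thesis .
      qed
      have "(\<integral>\<^sup>+w. log_gap \<alpha> (\<lambda>k. \<xi> k \<omega>) n w * indicator (cball 0 x) w \<partial>lborel) \<le>
        (\<integral>\<^sup>+w. (\<Sum>a\<in>S. log_gap \<alpha> (\<lambda>k. \<xi> k \<omega>) n w * indicator (ball a h) w) \<partial>lborel)"
      proof (rule nn_integral_mono)
        fix w
        show "log_gap \<alpha> (\<lambda>k. \<xi> k \<omega>) n w * indicator (cball 0 x) w \<le> (\<Sum>a\<in>S. log_gap \<alpha> (\<lambda>k. \<xi> k \<omega>) n w * indicator (ball a h) w)"
        proof (cases "w \<in> cball 0 x")
          case True
          then obtain a where a: "a \<in> S" "w \<in> ball a h" using S(4) by blast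
          have "log_gap \<alpha> (\<lambda>k. \<xi> k \<omega>) n w * indicator (cball 0 x) w \<le> log_gap \<alpha> (\<lambda>k. \<xi> k \<omega>) n w * indicator (ball a h) w"
            using a True by simp
          also have "\<dots> \<le> (\<Sum>a\<in>S. log_gap \<alpha> (\<lambda>k. \<xi> k \<omega>) n w * indicator (ball a h) w)"
            by (rule member_le_sum[OF a(1)]) (use S(1) in auto)
          finally show ?thesis .
        qed simp
      qed
      also have "\<dots> = (\<Sum>a\<in>S. \<integral>\<^sup>+w. log_gap \<alpha> (\<lambda>k. \<xi> k \<omega>) n w * indicator (ball a h) w \<partial>lborel)"
        by (rule nn_integral_sum) (auto intro!: borel_measurable_times_ennreal borel_measurable_indicator)
      also have "\<dots> \<le> (\<Sum>a\<in>S. ennreal (pi * h\<^sup>2 * (6 * \<theta>)))" by (rule sum_mono[OF each])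
      also have "\<dots> = ennreal (real (card S) * (pi * h\<^sup>2 * (6 * \<theta>)))" 
        using \<theta> by (simp add: ennreal_mult ennreal_of_nat_eq_real_of_nat)
      also have "\<dots> \<le> ennreal \<delta>"
      proof (rule ennreal_leI)
        have "real (card S) * (pi * h\<^sup>2 * (6 * \<theta>)) = (real (card S) * h\<^sup>2) * (6 * pi * \<theta>)" by simp
        also have "\<dots> \<le> (2 * x + 5)\<^sup>2 * (6 * pi * \<theta>)" using \<theta> by (intro mult_right_mono S(5)) auto
        also have "\<dots> = \<delta>" using x0 by (simp add: \<theta>_def)
        finally show "real (card S) * (pi * h\<^sup>2 * (6 * \<theta>)) \<le> \<delta>" .
      qed
      finally show "(\<integral>\<^sup>+w. log_gap \<alpha> (\<lambda>k. \<xi> k \<omega>) n w * indicator (cball 0 x) w \<partial>lborel) \<le> ennreal \<delta>" .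
    qed
  qed
qed

end

section \<open>Recovering zeros from circle averages\<close>

text \<open>Test functions extended by 0 to the whole plane, where they can be convolved
  freely.\<close>

definition supported_in :: "(complex \<Rightarrow> real) \<Rightarrow> real \<Rightarrow> bool" where
  "supported_in \<phi> x \<longleftrightarrow> continuous_on UNIV \<phi> \<and> (\<forall>z. cmod z > x \<longrightarrow> \<phi> z = 0)"

lemma supported_in_measurable: "supported_in \<phi> x \<Longrightarrow> \<phi> \<in> borel_measurable borel"
  by (simp add: supported_in_def borel_measurable_continuous_onI)

lemma supported_in_bounded:
  assumes "supported_in \<phi> x"
  obtains B where "B > 0" "\<And>z. \<bar>\<phi> z\<bar> \<le> B"
proof -
  have "continuous_on (cball 0 x) \<phi>" using assms unfolding supported_in_def by (blast intro: continuous_on_subset)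
  hence "bounded (\<phi> ` cball 0 x)" by (intro compact_imp_bounded compact_continuous_image) auto
  then obtain B where B: "B > 0" "\<And>z. z \<in> cball 0 x \<Longrightarrow> \<bar>\<phi> z\<bar> \<le> B"
    unfolding bounded_pos real_norm_def by blast
  have "\<bar>\<phi> z\<bar> \<le> B" for z
    using B assms by (cases "cmod z \<le> x") (auto simp: supported_in_def)
  thus thesis using that B(1) by blast
qed

lemma supported_in_modulus:
  assumes "supported_in \<phi> x" and "\<eta> > 0"
  obtains d where "d > 0" "\<And>a z. cmod (a - z) < d \<Longrightarrow> \<bar>\<phi> a - \<phi> z\<bar> \<le> \<eta>"
proof -
  have "continuous_on (cball 0 (x + 1)) \<phi>" using assms unfolding supported_in_def by (blast intro: continuous_on_subset)
  hence "uniformly_continuous_on (cball 0 (x + 1)) \<phi>" by (rule compact_uniformly_continuous) simp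
  then obtain d where d: "d > 0" "\<And>a z. a \<in> cball 0 (x + 1) \<Longrightarrow> z \<in> cball 0 (x + 1) \<Longrightarrow> dist z a < d \<Longrightarrow> dist (\<phi> z) (\<phi> a) < \<eta>"
    unfolding uniformly_continuous_on_def using assms(2) by meson
  show thesis
  proof (rule that[of "min d 1"])
    fix a z :: complex assume az: "cmod (a - z) < min d 1"
    show "\<bar>\<phi> a - \<phi> z\<bar> \<le> \<eta>"
    proof (cases "cmod a \<le> x \<or> cmod z \<le> x")
      case True
      hence "a \<in> cball 0 (x + 1)" "z \<in> cball 0 (x + 1)"
        using az norm_triangle_ineq3[of a z] by auto
      thus ?thesis using d(2)[of z a] az by (simp add: dist_norm)
    next
      case False
      thus ?thesis using assms by (auto simp: supported_in_def)
    qed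
  qed (use d in auto)
qed

lemma emeasure_lborel_balls_finite [simp]:
  fixes a :: "'a::euclidean_space"
  shows "emeasure lborel (ball a r) < top" "emeasure lborel (cball a r) < top"
  using emeasure_bounded_finite[of "ball a r"] emeasure_bounded_finite[of "cball a r"] by auto

lemma integrable_bounded_support:
  fixes f :: "complex \<Rightarrow> real"
  assumes "f \<in> borel_measurable borel" "\<And>z. \<bar>f z\<bar> \<le> B" "\<And>z. cmod (z - a) > x \<Longrightarrow> f z = 0"
  shows "integrable lborel f"
  by (rule integrableI_bounded_set[where A = "cball a x" and B = B])
     (use assms in \<open>auto simp: dist_norm norm_minus_commute\<close>)

definition jmass :: "real \<Rightarrow> real" where
  "jmass r = (\<integral>a. jkernel r (cmod a) \<partial>lborel)"

text \<open>Convolution with the Jensen kernel, whose total mass is \<open>jmass r\<close>; divided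
  by that mass it is a mollification of \<phi>.\<close>

definition smear :: "real \<Rightarrow> (complex \<Rightarrow> real) \<Rightarrow> complex \<Rightarrow> real" where
  "smear r \<phi> z = (\<integral>a. \<phi> a * jkernel r (cmod (z - a)) \<partial>lborel)"

lemma integrable_jkernel: "r > 0 \<Longrightarrow> integrable lborel (\<lambda>a. jkernel r (cmod (z - a)))"
  by (rule integrable_bounded_support[where B = "ln 2" and a = z and x = r])
     (auto simp: jkernel_le jkernel_nonneg norm_minus_commute intro!: jkernel_eq_0)

lemma jmass_shift: 
  assumes "r > 0" shows "(\<integral>a. jkernel r (cmod (z - a)) \<partial>lborel) = jmass r"
proof -
  have "(\<integral>a. jkernel r (cmod (z - a)) \<partial>lborel) = (\<integral>a. jkernel r (cmod (z - a)) \<partial>distr lborel borel ((+) z))"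
    by (simp add: lborel_distr_plus)
  also have "\<dots> = jmass r" unfolding jmass_def by (subst integral_distr) auto
  finally show ?thesis .
qed

lemma jmass_pos: assumes r: "r > 0" shows "jmass r > 0"
proof -
  have i: "integrable lborel (\<lambda>a::complex. jkernel r (cmod a))" using integrable_jkernel[OF r, of 0] by simp
  have "(\<integral>a. ln 2 * indicator (ball (0::complex) (r / 2)) a \<partial>lborel) \<le> jmass r"
    unfolding jmass_def
  proof (rule integral_mono[OF _ i])
    show "integrable lborel (\<lambda>a. ln 2 * indicator (ball (0::complex) (r / 2)) a :: real)"
      by (intro integrable_mult_right integrable_real_indicator) auto
    show "ln 2 * indicator (ball (0::complex) (r / 2)) a \<le> jkernel r (cmod a)" for a
      using jkernel_eq_ln2[OF r, of "cmod a"] jkernel_nonneg[OF r] by (auto simp: indicator_def)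
  qed
  moreover have "(\<integral>a. ln 2 * indicator (ball (0::complex) (r / 2)) a \<partial>lborel) = ln 2 * (pi * (r / 2)\<^sup>2)"
    using r by (simp add: measure_def emeasure_complex_ball)
  moreover have "ln 2 * (pi * (r / 2)\<^sup>2) > 0" using r by simp
  ultimately show ?thesis by linarith
qed

text \<open>The kernel is nonnegative and vanishes at distance r and beyond, so a bound for the
  oscillation of \<phi> within that distance can be integrated.\<close>

lemma smear_approx:
  assumes r: "r > 0" and \<phi>: "supported_in \<phi> x" and \<eta>: "\<And>a. cmod (a - z) < r \<Longrightarrow> \<bar>\<phi> a - \<phi> z\<bar> \<le> \<eta>"
  shows "\<bar>smear r \<phi> z - \<phi> z * jmass r\<bar> \<le> \<eta> * jmass r"
proof -
  note [measurable] = supported_in_measurable[OF \<phi>]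
  obtain B where B: "B > 0" "\<And>z. \<bar>\<phi> z\<bar> \<le> B" using supported_in_bounded[OF \<phi>] by blast
  have i1: "integrable lborel (\<lambda>a. \<phi> a * jkernel r (cmod (z - a)))"
    by (rule integrable_bounded_support[where B = "B * ln 2" and a = z and x = r])
       (use B r in \<open>auto simp: abs_mult jkernel_nonneg jkernel_le norm_minus_commute jkernel_eq_0 intro!: mult_mono\<close>)
  have i2: "integrable lborel (\<lambda>a. \<phi> z * jkernel r (cmod (z - a)))" using integrable_jkernel[OF r] by simp
  have "smear r \<phi> z - \<phi> z * jmass r = (\<integral>a. \<phi> a * jkernel r (cmod (z - a)) - \<phi> z * jkernel r (cmod (z - a)) \<partial>lborel)"
    unfolding smear_def using i1 i2 by (simp add: Bochner_Integration.integral_diff jmass_shift[OF r])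
  also have "\<bar>\<dots>\<bar> \<le> (\<integral>a. \<bar>\<phi> a * jkernel r (cmod (z - a)) - \<phi> z * jkernel r (cmod (z - a))\<bar> \<partial>lborel)"
    by (rule integral_abs_bound)
  also have "\<dots> \<le> (\<integral>a. \<eta> * jkernel r (cmod (z - a)) \<partial>lborel)"
  proof (rule integral_mono)
    show "integrable lborel (\<lambda>a. \<bar>\<phi> a * jkernel r (cmod (z - a)) - \<phi> z * jkernel r (cmod (z - a))\<bar>)" using i1 i2 by auto
    show "integrable lborel (\<lambda>a. \<eta> * jkernel r (cmod (z - a)))" using integrable_jkernel[OF r] by simp
    fix a
    have "\<bar>\<phi> a * jkernel r (cmod (z - a)) - \<phi> z * jkernel r (cmod (z - a))\<bar> = \<bar>\<phi> a - \<phi> z\<bar> * jkernel r (cmod (z - a))"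
      using jkernel_nonneg[OF r] by (simp add: abs_mult flip: left_diff_distrib)
    also have "\<dots> \<le> \<eta> * jkernel r (cmod (z - a))"
      using \<eta>[of a] jkernel_nonneg[OF r] jkernel_eq_0[OF r, of "cmod (z - a)"]
      by (cases "cmod (a - z) < r") (auto intro!: mult_right_mono simp: norm_minus_commute)
    finally show "\<bar>\<phi> a * jkernel r (cmod (z - a)) - \<phi> z * jkernel r (cmod (z - a))\<bar> \<le> \<eta> * jkernel r (cmod (z - a))" .
  qed
  also have "\<dots> = \<eta> * jmass r" by (simp add: jmass_shift[OF r])
  finally show ?thesis .
qed

lemma smear_eq_0:
  assumes r: "r > 0" and \<phi>: "supported_in \<phi> x" and z: "cmod z \<ge> x + r"
  shows "smear r \<phi> z = 0"
proof -
  have "\<phi> a * jkernel r (cmod (z - a)) = 0" for a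
  proof (cases "cmod a \<le> x")
    case True
    hence "cmod (z - a) \<ge> r" using z norm_triangle_ineq2[of z a] by linarith
    thus ?thesis by (simp add: jkernel_eq_0[OF r])
  qed (use \<phi> in \<open>auto simp: supported_in_def\<close>)
  thus ?thesis unfolding smear_def by (simp only: integral_zero)
qed

lemma measurable_smear [measurable]:
  assumes "supported_in \<phi> x" shows "smear r \<phi> \<in> borel_measurable borel"
proof -
  note [measurable] = supported_in_measurable[OF assms]
  have "(\<lambda>(z, a). \<phi> a * jkernel r (cmod (z - a))) \<in> borel_measurable (borel \<Otimes>\<^sub>M lborel)" by measurable
  thus ?thesis unfolding smear_def[abs_def] by (rule lborel.borel_measurable_lebesgue_integral)
qed

definition zero_sum :: "(complex \<Rightarrow> complex) \<Rightarrow> real \<Rightarrow> (complex \<Rightarrow> real) \<Rightarrow> real" where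
  "zero_sum G y f = (\<Sum>z | z \<in> cball 0 y \<and> G z = 0. of_int (zorder G z) * f z)"

text \<open>The quantity through which zeros and limit are compared: for u = ln |G| it is the zero
  sum of the smeared \<phi>, for the potential it is the integral of the smeared \<phi> against the
  limit density.\<close>

definition circ_diff :: "real \<Rightarrow> (complex \<Rightarrow> real) \<Rightarrow> (complex \<Rightarrow> real) \<Rightarrow> real" where
  "circ_diff r \<phi> u = (\<integral>a. \<phi> a * (circ_avg u a (of_real r) - circ_avg u a (of_real (r / 2))) \<partial>lborel)"

lemma AE_zeros_circles:
  assumes "finite Z" "finite D"
  shows "AE a in lborel. \<forall>z\<in>Z. cmod (z - a) \<notin> D"
proof -
  have "AE a in lborel. cmod (a - z) \<notin> D" for z :: complex by (rule AE_cmod_notin_finite[OF assms(2)])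
  hence "AE a in lborel. \<forall>z\<in>Z. cmod (a - z) \<notin> D" using assms by (simp add: AE_finite_all)
  thus ?thesis by (simp add: norm_minus_commute)
qed

lemma measurable_circ_avg [measurable]:
  assumes [measurable]: "u \<in> borel_measurable borel"
  shows "(\<lambda>a. circ_avg u a w) \<in> borel_measurable borel"
  unfolding circ_avg_def by measurable

text \<open>Holomorphy slightly beyond the closed disc of radius y makes the zeros in it finite in
  number. Borel measurability is stated for the whole plane because G is a total function with
  arbitrary values elsewhere.\<close>

locale analytic_fn =
  fixes G :: "complex \<Rightarrow> complex" and y :: real
  assumes hol: "\<exists>Y>y. G holomorphic_on ball 0 Y" and nz: "\<exists>z. cmod z \<le> y \<and> G z \<noteq> 0" and y0: "y > 0"
    and meas [measurable]: "G \<in> borel_measurable borel"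
begin

definition Z where "Z = {z \<in> cball 0 y. G z = 0}"

lemma finite_Z: "finite Z"
proof -
  obtain Y where Y: "Y > y" "G holomorphic_on ball 0 Y" using hol by blast
  have "\<exists>w\<in>ball 0 Y. G w \<noteq> 0" using nz Y by force
  moreover have "cball 0 y \<subseteq> ball 0 Y" using Y(1) by (auto simp: subset_iff)
  ultimately show ?thesis
    unfolding Z_def by (intro holomorphic_finite_zeros[OF Y(2) open_ball connected_ball]) auto
qed

lemma zorder_nonneg: "z \<in> Z \<Longrightarrow> zorder G z \<ge> 0"
proof -
  assume z: "z \<in> Z"
  obtain Y where Y: "Y > y" "G holomorphic_on ball 0 Y" using hol by blast
  have "\<exists>w\<in>ball 0 Y. G w \<noteq> 0" using nz Y by force
  from zorder_holomorphic_zero[OF Y(2) open_ball connected_ball _ this, of z] z Y show ?thesis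
    unfolding Z_def by auto
qed

lemma zero_sum_eq: "zero_sum G y f = (\<Sum>z\<in>Z. of_int (zorder G z) * f z)"
  by (simp add: zero_sum_def Z_def)

text \<open>Almost every centre has no zero on either of its two circles, and for |a| \<le> x the
  disc of radius y - x about a stays within the disc of radius y.\<close>

lemma jensen_AE:
  assumes r: "0 < r" and x: "x + r < y"
  shows "AE a in lborel. cmod a \<le> x \<longrightarrow>
    circ_avg (\<lambda>z. ln (cmod (G z))) a (of_real r) - circ_avg (\<lambda>z. ln (cmod (G z))) a (of_real (r / 2)) =
      (\<Sum>z\<in>Z. zorder G z * jkernel r (cmod (z - a))) \<and>
    integrable unif01 (\<lambda>t. ln (cmod (G (a + of_real r * circ t)))) \<and>
    integrable unif01 (\<lambda>t. ln (cmod (G (a + of_real (r / 2) * circ t))))"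
proof -
  have "AE a in lborel. \<forall>z\<in>Z. cmod (z - a) \<notin> {r, r / 2}" by (rule AE_zeros_circles[OF finite_Z]) simp
  thus ?thesis
  proof eventually_elim
    case (elim a)
    show ?case
    proof
      assume a: "cmod a \<le> x"
      define R where "R = y - x"
      have R: "r < R" using x by (simp add: R_def)
      have sub: "ball a R \<subseteq> ball 0 y"
      proof
        fix w assume "w \<in> ball a R"
        hence "cmod w < cmod a + R" using norm_triangle_sub[of w a] by (simp add: dist_norm norm_minus_commute)
        thus "w \<in> ball 0 y" using a by (simp add: R_def)
      qed
      obtain Y where Y: "Y > y" "G holomorphic_on ball 0 Y" using hol by blast
      have G: "G holomorphic_on ball a R" by (rule holomorphic_on_subset[OF Y(2)]) (use sub Y in auto)
      have nz': "\<exists>w\<in>ball a R. G w \<noteq> 0"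
      proof (rule ccontr)
        assume "\<not> ?thesis"
        hence "ball a R \<subseteq> Z" using sub by (force simp: Z_def)
        hence "finite (ball a R)" using finite_Z by (rule finite_subset)
        moreover have "uncountable (ball a R)" using R r by (intro uncountable_ball) simp
        ultimately show False using countable_finite by blast
      qed
      have circ: "cmod (z - a) \<notin> {r, r / 2}" if "z \<in> ball a R" "G z = 0" for z
        using elim that sub by (force simp: Z_def)
      note J = jensen_jkernel[OF G nz' r R circ]
      have "(\<Sum>z | z \<in> ball a r \<and> G z = 0. zorder G z * jkernel r (cmod (z - a))) = (\<Sum>z\<in>Z. zorder G z * jkernel r (cmod (z - a)))"
      proof (rule sum.mono_neutral_left[OF finite_Z])
        show "{z \<in> ball a r. G z = 0} \<subseteq> Z"
        proof
          fix z assume z: "z \<in> {z \<in> ball a r. G z = 0}"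
          hence "z \<in> ball 0 y" using sub R by (intro subsetD[OF sub]) auto
          thus "z \<in> Z" using z by (auto simp: Z_def)
        qed
        show "\<forall>z\<in>Z - {z \<in> ball a r. G z = 0}. zorder G z * jkernel r (cmod (z - a)) = 0"
          using jkernel_eq_0[OF r] by (auto simp: Z_def dist_norm norm_minus_commute) (metis not_less)
      qed
      thus "circ_avg (\<lambda>z. ln (cmod (G z))) a (of_real r) - circ_avg (\<lambda>z. ln (cmod (G z))) a (of_real (r / 2)) =
          (\<Sum>z\<in>Z. zorder G z * jkernel r (cmod (z - a))) \<and>
        integrable unif01 (\<lambda>t. ln (cmod (G (a + of_real r * circ t)))) \<and>
        integrable unif01 (\<lambda>t. ln (cmod (G (a + of_real (r / 2) * circ t))))"
        using J(1) J(2)[of r] J(2)[of "r / 2"] by simp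
    qed
  qed
qed

text \<open>Jensen's identity integrated over the centres. The sum over the zeros is finite and
  exchanges with the integral; for one fixed zero the integral over the centre is the
  convolution.\<close>

lemma circ_diff_ln:
  assumes \<phi>: "supported_in \<phi> x" and r: "0 < r" and x: "x + r < y"
  shows "circ_diff r \<phi> (\<lambda>z. ln (cmod (G z))) = zero_sum G y (smear r \<phi>)"
    and "integrable lborel (\<lambda>a. \<phi> a * (circ_avg (\<lambda>z. ln (cmod (G z))) a (of_real r) - circ_avg (\<lambda>z. ln (cmod (G z))) a (of_real (r / 2))))"
proof -
  note [measurable] = supported_in_measurable[OF \<phi>]
  let ?u = "\<lambda>z. ln (cmod (G z))"
  obtain B where B: "B > 0" "\<And>z. \<bar>\<phi> z\<bar> \<le> B" using supported_in_bounded[OF \<phi>] by blast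
  have i1: "integrable lborel (\<lambda>a. \<phi> a * jkernel r (cmod (z - a)))" for z
    by (rule integrable_bounded_support[where B = "B * ln 2" and a = z and x = r])
       (use B r in \<open>auto simp: abs_mult jkernel_nonneg jkernel_le norm_minus_commute jkernel_eq_0 intro!: mult_mono\<close>)
  have i2: "integrable lborel (\<lambda>a. \<Sum>z\<in>Z. zorder G z * (\<phi> a * jkernel r (cmod (z - a))))" using i1 by auto
  have ae: "AE a in lborel. \<phi> a * (circ_avg ?u a (of_real r) - circ_avg ?u a (of_real (r / 2))) =
     (\<Sum>z\<in>Z. zorder G z * (\<phi> a * jkernel r (cmod (z - a))))"
    using jensen_AE[OF r x]
  proof eventually_elim
    case (elim a)
    show ?case
    proof (cases "cmod a \<le> x")
      case True
      with elim show ?thesis by (simp add: sum_distrib_left mult_ac)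
    next
      case False
      hence "\<phi> a = 0" using \<phi> by (auto simp: supported_in_def)
      thus ?thesis by simp
    qed
  qed
  show "integrable lborel (\<lambda>a. \<phi> a * (circ_avg ?u a (of_real r) - circ_avg ?u a (of_real (r / 2))))"
    by (rule integrable_cong_AE_imp[OF i2]) (use ae in \<open>auto elim: eventually_mono\<close>)
  have "circ_diff r \<phi> ?u = (\<integral>a. (\<Sum>z\<in>Z. zorder G z * (\<phi> a * jkernel r (cmod (z - a)))) \<partial>lborel)"
    unfolding circ_diff_def by (rule integral_cong_AE[OF _ _ ae]) measurable
  also have "\<dots> = (\<Sum>z\<in>Z. zorder G z * smear r \<phi> z)"
    unfolding smear_def using i1 by (subst Bochner_Integration.integral_sum) auto
  finally show "circ_diff r \<phi> ?u = zero_sum G y (smear r \<phi>)" by (simp add: zero_sum_eq)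
qed

lemma zero_sum_approx:
  assumes "\<And>z. \<bar>f z - g z\<bar> \<le> h z"
  shows "\<bar>zero_sum G y f - zero_sum G y g\<bar> \<le> zero_sum G y h"
proof -
  have "\<bar>zero_sum G y f - zero_sum G y g\<bar> = \<bar>\<Sum>z\<in>Z. zorder G z * (f z - g z)\<bar>"
    by (simp add: zero_sum_eq right_diff_distrib sum_subtractf)
  also have "\<dots> \<le> (\<Sum>z\<in>Z. \<bar>zorder G z * (f z - g z)\<bar>)" by (rule sum_abs)
  also have "\<dots> \<le> (\<Sum>z\<in>Z. zorder G z * h z)"
    using assms zorder_nonneg by (intro sum_mono) (auto simp: abs_mult intro!: mult_left_mono)
  also have "\<dots> = zero_sum G y h" by (simp add: zero_sum_eq)
  finally show ?thesis .
qed

lemma zero_sum_mono: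
  assumes "\<And>z. cmod z \<le> y \<Longrightarrow> f z \<le> g z"
  shows "zero_sum G y f \<le> zero_sum G y g"
  unfolding zero_sum_eq using assms zorder_nonneg
  by (intro sum_mono mult_left_mono) (auto simp: Z_def)

end

text \<open>For a fixed angle the point on the circle is a translate of the centre, and this
  translation sends the disc of radius x into the one of radius x + |\<rho>|.\<close>

lemma nn_integral_circ_average_ball:
  assumes [measurable]: "g \<in> borel_measurable borel"
  shows "(\<integral>\<^sup>+a. indicator (cball 0 x) a * (\<integral>\<^sup>+t. g (a + of_real \<rho> * circ t) \<partial>unif01) \<partial>lborel)
     \<le> (\<integral>\<^sup>+w. g w * indicator (cball 0 (x + \<bar>\<rho>\<bar>)) w \<partial>lborel)"
proof -
  interpret P: pair_sigma_finite unif01 "lborel :: complex measure" ..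
  have [measurable]: "cball (0::complex) c \<in> sets borel" for c by simp
  have "(\<integral>\<^sup>+a. indicator (cball 0 x) a * (\<integral>\<^sup>+t. g (a + of_real \<rho> * circ t) \<partial>unif01) \<partial>lborel) =
     (\<integral>\<^sup>+a. (\<integral>\<^sup>+t. indicator (cball 0 x) a * g (a + of_real \<rho> * circ t) \<partial>unif01) \<partial>lborel)"
    by (intro nn_integral_cong nn_integral_cmult[symmetric]) measurable
  also have "\<dots> = (\<integral>\<^sup>+t. (\<integral>\<^sup>+a. indicator (cball 0 x) a * g (a + of_real \<rho> * circ t) \<partial>lborel) \<partial>unif01)"
    by (rule P.Fubini') measurable
  also have "\<dots> \<le> (\<integral>\<^sup>+t. (\<integral>\<^sup>+w. g w * indicator (cball 0 (x + \<bar>\<rho>\<bar>)) w \<partial>lborel) \<partial>unif01)"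
  proof (rule nn_integral_mono)
    fix t
    have "(\<integral>\<^sup>+a. indicator (cball 0 x) a * g (a + of_real \<rho> * circ t) \<partial>lborel) \<le>
      (\<integral>\<^sup>+a. (\<lambda>w. g w * indicator (cball 0 (x + \<bar>\<rho>\<bar>)) w) (of_real \<rho> * circ t + a) \<partial>lborel)"
    proof (rule nn_integral_mono)
      fix a
      have "cmod (of_real \<rho> * circ t + a) \<le> x + \<bar>\<rho>\<bar>" if "cmod a \<le> x"
        using norm_triangle_ineq[of "of_real \<rho> * circ t" a] that by (simp add: norm_mult)
      thus "indicator (cball 0 x) a * g (a + of_real \<rho> * circ t) \<le> 
        (\<lambda>w. g w * indicator (cball 0 (x + \<bar>\<rho>\<bar>)) w) (of_real \<rho> * circ t + a)"
        by (auto simp: indicator_def add.commute)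
    qed
    also have "\<dots> = (\<integral>\<^sup>+w. g w * indicator (cball 0 (x + \<bar>\<rho>\<bar>)) w \<partial>lborel)"
      by (rule nn_integral_lborel_translate) measurable
    finally show "(\<integral>\<^sup>+a. indicator (cball 0 x) a * g (a + of_real \<rho> * circ t) \<partial>lborel) \<le>
      (\<integral>\<^sup>+w. g w * indicator (cball 0 (x + \<bar>\<rho>\<bar>)) w \<partial>lborel)" .
  qed
  also have "\<dots> = (\<integral>\<^sup>+w. g w * indicator (cball 0 (x + \<bar>\<rho>\<bar>)) w \<partial>lborel)"
    by (simp add: unif01.emeasure_space_1[simplified])
  finally show ?thesis .
qed

section \<open>Comparison of zero sums with the integral against the limit density\<close>

lemma lim_density_integrable:
  assumes a: "0 < \<alpha>" "\<alpha> \<noteq> 1" and y: "y \<in> radii \<alpha>"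
    and f [measurable]: "f \<in> borel_measurable borel" and B: "\<And>z. \<bar>f z\<bar> \<le> B" "\<And>z. cmod z > y \<Longrightarrow> f z = 0"
  shows "integrable lborel (\<lambda>z::complex. radial_density \<alpha> (cmod z) * f z)"
    and "\<bar>\<integral>z. radial_density \<alpha> (cmod z) * f z \<partial>lborel\<bar> \<le> B * crit \<alpha> y"
proof -
  have [measurable]: "cball (0::complex) y \<in> sets borel" by simp
  let ?g = "\<lambda>z::complex. radial_density \<alpha> (cmod z) * indicator (cball 0 y) z"
  have B0: "B \<ge> 0" using order_trans[OF abs_ge_zero B(1)] .
  have g: "(\<integral>\<^sup>+z. ennreal (?g z) \<partial>lborel) = ennreal (crit \<alpha> y)"
    using emeasure_lim_cball[OF a y] radial_density_nonneg[OF a(1)] by (simp add: ennreal_mult ennreal_indicator)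
  have ig: "integrable lborel ?g"
    using g radial_density_nonneg[OF a(1)] by (intro integrableI_nonneg) auto
  have "(\<integral>z. ?g z \<partial>lborel) = enn2real (\<integral>\<^sup>+z. ennreal (?g z) \<partial>lborel)"
    using radial_density_nonneg[OF a(1)] by (intro integral_eq_nn_integral) auto
  hence ic: "(\<integral>z. ?g z \<partial>lborel) = crit \<alpha> y" unfolding g by (simp add: crit_nonneg)
  have bd: "\<bar>radial_density \<alpha> (cmod z) * f z\<bar> \<le> B * ?g z" for z
    using B radial_density_nonneg[OF a(1), of "cmod z"] mult_right_mono[OF B(1)[of z], of "radial_density \<alpha> (cmod z)"]
    by (cases "cmod z \<le> y") (auto simp: abs_mult mult.commute)
  show i: "integrable lborel (\<lambda>z::complex. radial_density \<alpha> (cmod z) * f z)"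
  proof (rule Bochner_Integration.integrable_bound)
    show "integrable lborel (\<lambda>z. B * ?g z)" using ig by (rule integrable_mult_right)
    show "AE z in lborel. norm (radial_density \<alpha> (cmod z) * f z) \<le> norm (B * ?g z)"
      using bd by (auto intro!: order_trans[OF _ abs_ge_self])
  qed measurable
  have "\<bar>\<integral>z. radial_density \<alpha> (cmod z) * f z \<partial>lborel\<bar> \<le> (\<integral>z. \<bar>radial_density \<alpha> (cmod z) * f z\<bar> \<partial>lborel)"
    by (rule integral_abs_bound)
  also have "\<dots> \<le> (\<integral>z. B * ?g z \<partial>lborel)" using i ig bd by (intro integral_mono) auto
  also have "\<dots> = B * crit \<alpha> y" using ic by simp
  finally show "\<bar>\<integral>z. radial_density \<alpha> (cmod z) * f z \<partial>lborel\<bar> \<le> B * crit \<alpha> y" .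
qed

lemma circ_avg_potential_nonneg: "0 \<le> circ_avg (\<lambda>z. potential \<alpha> (cmod z)) a w"
  unfolding circ_avg_def by (intro integral_nonneg_AE) (simp add: potential_nonneg)

lemma integrable_circ_diff_potential:
  assumes a: "0 < \<alpha>" "\<alpha> \<noteq> 1" and y: "y \<in> radii \<alpha>" and \<phi>: "supported_in \<phi> x" and r: "0 < r" "x + r \<le> y"
  shows "integrable lborel (\<lambda>a. \<phi> a * (circ_avg (\<lambda>z. potential \<alpha> (cmod z)) a (of_real r) - circ_avg (\<lambda>z. potential \<alpha> (cmod z)) a (of_real (r / 2))))"
proof -
  note [measurable] = supported_in_measurable[OF \<phi>]
  obtain B where B: "B > 0" "\<And>z. \<bar>\<phi> z\<bar> \<le> B" using supported_in_bounded[OF \<phi>] by blast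
  let ?A = "\<lambda>a r. circ_avg (\<lambda>z. potential \<alpha> (cmod z)) a (of_real r)"
  show ?thesis
  proof (rule integrable_bounded_support[where B = "B * potential \<alpha> y" and a = 0 and x = x])
    show "\<bar>\<phi> a * (?A a r - ?A a (r / 2))\<bar> \<le> B * potential \<alpha> y" for a
    proof (cases "cmod a \<le> x")
      case True
      have "?A a r \<le> potential \<alpha> y"
        by (rule circ_avg_potential_le[OF assms(1,2) y]) (use True r in auto)
      moreover have "?A a (r / 2) \<le> potential \<alpha> y"
        by (rule circ_avg_potential_le[OF assms(1,2) y]) (use True r in auto)
      moreover have "0 \<le> ?A a r" "0 \<le> ?A a (r / 2)" by (rule circ_avg_potential_nonneg)+
      ultimately have "\<bar>?A a r - ?A a (r / 2)\<bar> \<le> potential \<alpha> y" by linarith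
      thus ?thesis unfolding abs_mult using B by (intro mult_mono) auto
    next
      case False
      thus ?thesis using \<phi> B potential_nonneg[of \<alpha> y] by (auto simp: supported_in_def)
    qed
    show "\<phi> a * (?A a r - ?A a (r / 2)) = 0" if "x < cmod (a - 0)" for a
      using that \<phi> by (auto simp: supported_in_def)
  qed measurable
qed

text \<open>\<open>lim_jkernel\<close> combined with Fubini. Absolute integrability comes from the
  same identity: the kernel is nonnegative, so the inner integral of the modulus is |\<phi> a| times
  the difference of the averages.\<close>

lemma circ_diff_potential:
  assumes a: "0 < \<alpha>" "\<alpha> \<noteq> 1" and y: "y \<in> radii \<alpha>" and \<phi>: "supported_in \<phi> x" and r: "0 < r" "x + r \<le> y"
  shows "circ_diff r \<phi> (\<lambda>z. potential \<alpha> (cmod z)) = (\<integral>z. radial_density \<alpha> (cmod z) * smear r \<phi> z \<partial>lborel)"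
proof -
  note [measurable] = supported_in_measurable[OF \<phi>]
  let ?A = "\<lambda>a r. circ_avg (\<lambda>z. potential \<alpha> (cmod z)) a (of_real r)"
  let ?D = "\<lambda>a. ?A a r - ?A a (r / 2)"
  let ?f = "\<lambda>a z. \<phi> a * (radial_density \<alpha> (cmod z) * jkernel r (cmod (z - a)))"
  have inner: "AE a in lborel. integrable lborel (?f a) \<and> (\<integral>z. ?f a z \<partial>lborel) = \<phi> a * ?D a \<and> (\<integral>z. \<bar>?f a z\<bar> \<partial>lborel) = \<bar>\<phi> a * ?D a\<bar>"
  proof -
    have "AE a in lborel. cmod (a - 0) \<notin> {r, r / 2}" by (rule AE_cmod_notin_finite) simp
    thus ?thesis
    proof eventually_elim
      case (elim a)
      show ?case
      proof (cases "cmod a \<le> x")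
        case True
        hence R: "cmod a + r \<le> y" and ne: "cmod a \<noteq> r" "cmod a \<noteq> r / 2" using r elim by auto
        note L = lim_jkernel[OF a y R r(1) ne]
        let ?k = "\<lambda>z. radial_density \<alpha> (cmod z) * jkernel r (cmod (z - a))"
        have k0: "?k z \<ge> 0" for z using radial_density_nonneg[OF assms(1)] jkernel_nonneg[OF r(1)] by simp
        have nn: "(\<integral>\<^sup>+z. ennreal (?k z) \<partial>lborel) = ennreal (?D a)"
          using L(1) radial_density_nonneg[OF assms(1)] jkernel_nonneg[OF r(1)] by (simp add: ennreal_mult)
        have ik: "integrable lborel ?k" using nn k0 by (intro integrableI_nonneg) auto
        have "(\<integral>z. ?k z \<partial>lborel) = enn2real (\<integral>\<^sup>+z. ennreal (?k z) \<partial>lborel)"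
          using k0 by (intro integral_eq_nn_integral) auto
        hence k: "(\<integral>z. ?k z \<partial>lborel) = ?D a" unfolding nn using L(2) by simp
        have absf: "\<bar>?f a z\<bar> = \<bar>\<phi> a\<bar> * ?k z" for z using k0[of z] by (simp only: abs_mult[of "\<phi> a"] abs_of_nonneg)
        have "(\<integral>z. \<bar>?f a z\<bar> \<partial>lborel) = \<bar>\<phi> a\<bar> * (\<integral>z. ?k z \<partial>lborel)"
          unfolding absf by (rule integral_mult_right_zero)
        also have "\<dots> = \<bar>\<phi> a * ?D a\<bar>" unfolding k using L(2) by (simp add: abs_mult)
        finally show ?thesis using ik k by simp
      next
        case False
        hence "\<phi> a = 0" using \<phi> by (auto simp: supported_in_def)
        thus ?thesis by simp
      qed
    qed
  qed
  have iD: "integrable lborel (\<lambda>a. \<phi> a * ?D a)" by (rule integrable_circ_diff_potential[OF assms])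
  have m: "case_prod ?f \<in> borel_measurable (lborel \<Otimes>\<^sub>M lborel)" by measurable
  have int: "integrable (lborel \<Otimes>\<^sub>M lborel) (case_prod ?f)"
  proof (rule lborel_pair.Fubini_integrable[OF m])
    have "integrable lborel (\<lambda>a. \<bar>\<phi> a * ?D a\<bar>)" using iD by (rule integrable_abs)
    thus "integrable lborel (\<lambda>a. \<integral>z. norm (case_prod ?f (a, z)) \<partial>lborel)"
      by (rule integrable_cong_AE_imp) (use inner in \<open>auto elim: eventually_mono\<close>)
    show "AE a in lborel. integrable lborel (\<lambda>z. case_prod ?f (a, z))"
      using inner by eventually_elim auto
  qed
  have "circ_diff r \<phi> (\<lambda>z. potential \<alpha> (cmod z)) = (\<integral>a. (\<integral>z. ?f a z \<partial>lborel) \<partial>lborel)"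
    unfolding circ_diff_def using inner by (intro integral_cong_AE) (auto elim: eventually_mono)
  also have "\<dots> = (\<integral>z. (\<integral>a. ?f a z \<partial>lborel) \<partial>lborel)"
    by (rule lborel_pair.Fubini_integral[OF int, symmetric])
  also have "\<dots> = (\<integral>z. radial_density \<alpha> (cmod z) * smear r \<phi> z \<partial>lborel)"
  proof (intro Bochner_Integration.integral_cong refl)
    fix z
    have "(\<integral>a. ?f a z \<partial>lborel) = (\<integral>a. radial_density \<alpha> (cmod z) * (\<phi> a * jkernel r (cmod (z - a))) \<partial>lborel)"
      by (simp only: mult_ac)
    thus "(\<integral>a. ?f a z \<partial>lborel) = radial_density \<alpha> (cmod z) * smear r \<phi> z" by (simp add: smear_def)
  qed
  finally show ?thesis .
qed

lemma analytic_fn_H: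
  assumes a: "0 < \<alpha>" "\<alpha> \<noteq> 1" and n: "n > 0" and c: "subexponential c" "c k \<noteq> 0" and y: "y \<in> radii \<alpha>" "y > 0"
  shows "analytic_fn (H \<alpha> c n) y"
proof
  obtain Y \<epsilon> where Y: "y < Y" "Y \<in> radii \<alpha>" using radii_room[OF y(1)] by blast
  have sub: "ball 0 Y \<subseteq> H_domain \<alpha>" using Y by (auto simp: mem_H_domain radii_def split: if_splits)
  show "\<exists>Y>y. H \<alpha> c n holomorphic_on ball 0 Y"
    using Y holomorphic_on_subset[OF holomorphic_H[OF a n c(1)] sub] by blast
  have sub': "cball 0 y \<subseteq> H_domain \<alpha>" using y by (auto simp: mem_H_domain radii_def split: if_splits)
  have nz: "\<exists>z\<in>H_domain \<alpha>. H \<alpha> c n z \<noteq> 0" by (rule H_not_identically_0[OF a n c])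
  show "\<exists>z. cmod z \<le> y \<and> H \<alpha> c n z \<noteq> 0"
  proof (rule ccontr)
    assume no: "\<not> ?thesis"
    have "finite {z \<in> cball 0 y. H \<alpha> c n z = 0}"
      by (rule holomorphic_finite_zeros[OF holomorphic_H[OF a n c(1)] _ _ _ sub' nz]) auto
    moreover have "{z \<in> cball 0 y. H \<alpha> c n z = 0} = cball 0 y" using no by auto
    moreover have "uncountable (cball (0::complex) y)" using y by (intro uncountable_cball)
    ultimately show False using countable_finite by force
  qed
qed (use y in auto)

text \<open>Each circle average turns the gap into a mean of integrals over translates of the disc
  of radius x, all inside the disc of radius y. The two circles account for the factor 2.\<close>

lemma circ_diff_gap:
  assumes a: "0 < \<alpha>" "\<alpha> \<noteq> 1" and n: "n > 0" and y: "y \<in> radii \<alpha>" "y > 0" and c: "subexponential c" "c k \<noteq> 0"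
    and \<phi>: "supported_in \<phi> x" "\<And>z. \<bar>\<phi> z\<bar> \<le> B" and r: "0 < r" "x + r < y"
    and gap: "(\<integral>\<^sup>+w. log_gap \<alpha> c n w * indicator (cball 0 y) w \<partial>lborel) \<le> ennreal \<delta>" and \<delta>: "\<delta> \<ge> 0"
  shows "\<bar>circ_diff r \<phi> (\<lambda>z. ln (cmod (H \<alpha> c n z))) / n - circ_diff r \<phi> (\<lambda>z. potential \<alpha> (cmod z))\<bar> \<le> 2 * B * \<delta>"
proof -
  interpret analytic_fn "H \<alpha> c n" y by (rule analytic_fn_H[OF a n c y])
  note [measurable] = supported_in_measurable[OF \<phi>(1)]
  have [measurable]: "cball (0::complex) c \<in> sets borel" for c by simp
  have B0: "B \<ge> 0" using order_trans[OF abs_ge_zero \<phi>(2)] .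
  have ennreal_distrib: "ennreal (B * (p + q)) = ennreal B * ennreal p + ennreal B * ennreal q" if "p \<ge> 0" "q \<ge> 0" for p q
    using B0 that by (simp add: ennreal_mult distrib_left)
  let ?u = "\<lambda>z. ln (cmod (H \<alpha> c n z))" and ?p = "\<lambda>z. potential \<alpha> (cmod z)"
  let ?g = "log_gap \<alpha> c n"
  let ?D = "\<lambda>u a. circ_avg u a (of_real r) - circ_avg u a (of_real (r / 2))"
  note iu = circ_diff_ln(2)[OF \<phi>(1) r]
  have ip: "integrable lborel (\<lambda>a. \<phi> a * ?D ?p a)"
    by (rule integrable_circ_diff_potential[OF a y(1) \<phi>(1) r(1)]) (use r in simp)
  have avg: "ennreal \<bar>circ_avg ?u b (of_real \<rho>) / n - circ_avg ?p b (of_real \<rho>)\<bar> \<le> (\<integral>\<^sup>+t. ?g (b + of_real \<rho> * circ t) \<partial>unif01)"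
    if i: "integrable unif01 (\<lambda>t. ?u (b + of_real \<rho> * circ t))" and b: "cmod b \<le> x" and \<rho>: "0 \<le> \<rho>" "\<rho> \<le> r" for b \<rho>
  proof -
    have i2: "integrable unif01 (\<lambda>t. ?p (b + of_real \<rho> * circ t))"
      by (rule integrable_potential_circ[OF a y(1)]) (use b \<rho> r in auto)
    have i3: "integrable unif01 (\<lambda>t. ?u (b + of_real \<rho> * circ t) / n)" using i by simp
    have "circ_avg ?u b (of_real \<rho>) / n - circ_avg ?p b (of_real \<rho>) =
       (\<integral>t. ?u (b + of_real \<rho> * circ t) / n - ?p (b + of_real \<rho> * circ t) \<partial>unif01)"
      unfolding circ_avg_def using Bochner_Integration.integral_diff[OF i3 i2] by simp
    hence "ennreal \<bar>circ_avg ?u b (of_real \<rho>) / n - circ_avg ?p b (of_real \<rho>)\<bar> \<le>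
       (\<integral>\<^sup>+t. ennreal (norm (?u (b + of_real \<rho> * circ t) / n - ?p (b + of_real \<rho> * circ t))) \<partial>unif01)"
      using integral_norm_bound_ennreal[OF Bochner_Integration.integrable_diff[OF i3 i2]] by simp
    thus ?thesis by (simp add: log_gap_def)
  qed
  have half: "(\<integral>\<^sup>+b. indicator (cball 0 x) b * (\<integral>\<^sup>+t. ?g (b + of_real \<rho> * circ t) \<partial>unif01) \<partial>lborel) \<le> ennreal \<delta>"
    if "0 \<le> \<rho>" "\<rho> \<le> r" for \<rho>
  proof -
    have "(\<integral>\<^sup>+b. indicator (cball 0 x) b * (\<integral>\<^sup>+t. ?g (b + of_real \<rho> * circ t) \<partial>unif01) \<partial>lborel) \<le>
      (\<integral>\<^sup>+w. ?g w * indicator (cball 0 (x + \<bar>\<rho>\<bar>)) w \<partial>lborel)"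
      by (rule nn_integral_circ_average_ball) measurable
    also have "\<dots> \<le> (\<integral>\<^sup>+w. ?g w * indicator (cball 0 y) w \<partial>lborel)"
      using that r by (intro nn_integral_mono) (auto simp: indicator_def)
    finally show ?thesis using gap by simp
  qed
  have iun: "integrable lborel (\<lambda>b. \<phi> b * ?D ?u b / n)" using iu by simp
  have "circ_diff r \<phi> ?u / n - circ_diff r \<phi> ?p = (\<integral>b. \<phi> b * ?D ?u b / n - \<phi> b * ?D ?p b \<partial>lborel)"
    unfolding circ_diff_def using Bochner_Integration.integral_diff[OF iun ip] by simp
  hence "ennreal \<bar>circ_diff r \<phi> ?u / n - circ_diff r \<phi> ?p\<bar> \<le> (\<integral>\<^sup>+b. ennreal (norm (\<phi> b * ?D ?u b / n - \<phi> b * ?D ?p b)) \<partial>lborel)"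
    using integral_norm_bound_ennreal[OF Bochner_Integration.integrable_diff[OF iun ip]] by simp
  also have "\<dots> \<le> (\<integral>\<^sup>+b. ennreal B * (indicator (cball 0 x) b * (\<integral>\<^sup>+t. ?g (b + of_real r * circ t) \<partial>unif01)) +
      ennreal B * (indicator (cball 0 x) b * (\<integral>\<^sup>+t. ?g (b + of_real (r / 2) * circ t) \<partial>unif01)) \<partial>lborel)"
  proof (rule nn_integral_mono_AE)
    show "AE b in lborel. ennreal (norm (\<phi> b * ?D ?u b / n - \<phi> b * ?D ?p b)) \<le>
      ennreal B * (indicator (cball 0 x) b * (\<integral>\<^sup>+t. ?g (b + of_real r * circ t) \<partial>unif01)) +
      ennreal B * (indicator (cball 0 x) b * (\<integral>\<^sup>+t. ?g (b + of_real (r / 2) * circ t) \<partial>unif01))"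
      using jensen_AE[OF r]
    proof eventually_elim
      case (elim b)
      show ?case
      proof (cases "cmod b \<le> x")
        case True
        let ?d = "\<lambda>\<rho>. circ_avg ?u b (of_real \<rho>) / n - circ_avg ?p b (of_real \<rho>)"
        have "\<phi> b * ?D ?u b / n - \<phi> b * ?D ?p b = \<phi> b * (?d r - ?d (r / 2))"
          by (simp add: diff_divide_distrib algebra_simps)
        hence "norm (\<phi> b * ?D ?u b / n - \<phi> b * ?D ?p b) \<le> B * (\<bar>?d r\<bar> + \<bar>?d (r / 2)\<bar>)"
          using \<phi>(2)[of b] B0 by (auto simp: abs_mult intro!: mult_mono)
        hence "ennreal (norm (\<phi> b * ?D ?u b / n - \<phi> b * ?D ?p b)) \<le> ennreal (B * (\<bar>?d r\<bar> + \<bar>?d (r / 2)\<bar>))"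
          by (rule ennreal_leI)
        also have "\<dots> = ennreal B * ennreal \<bar>?d r\<bar> + ennreal B * ennreal \<bar>?d (r / 2)\<bar>"
          using ennreal_distrib[of "\<bar>?d r\<bar>" "\<bar>?d (r / 2)\<bar>"] by simp
        also have "\<dots> \<le> ennreal B * (\<integral>\<^sup>+t. ?g (b + of_real r * circ t) \<partial>unif01) + ennreal B * (\<integral>\<^sup>+t. ?g (b + of_real (r / 2) * circ t) \<partial>unif01)"
          using elim True r by (intro add_mono mult_left_mono avg) auto
        finally show ?thesis using True by simp
      next
        case False
        hence "\<phi> b = 0" using \<phi>(1) by (auto simp: supported_in_def)
        thus ?thesis by simp
      qed
    qed
  qed
  also have "\<dots> = ennreal B * (\<integral>\<^sup>+b. indicator (cball 0 x) b * (\<integral>\<^sup>+t. ?g (b + of_real r * circ t) \<partial>unif01) \<partial>lborel) +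
      ennreal B * (\<integral>\<^sup>+b. indicator (cball 0 x) b * (\<integral>\<^sup>+t. ?g (b + of_real (r / 2) * circ t) \<partial>unif01) \<partial>lborel)"
    by (subst nn_integral_add) (auto simp: nn_integral_cmult)
  also have "\<dots> \<le> ennreal B * ennreal \<delta> + ennreal B * ennreal \<delta>"
    using r by (intro add_mono mult_left_mono half) auto
  also have "\<dots> = ennreal (2 * B * \<delta>)"
    using B0 \<delta> by (simp add: ennreal_mult[symmetric] flip: ennreal_plus)
  finally show ?thesis using B0 \<delta> by (simp add: ennreal_le_iff)
qed

definition bump :: "real \<Rightarrow> real \<Rightarrow> complex \<Rightarrow> real" where
  "bump p q z = max 0 (min 1 ((q - cmod z) / (q - p)))"

lemma bump:
  assumes "p < q"
  shows "supported_in (bump p q) q" "0 \<le> bump p q z" "\<bar>bump p q z\<bar> \<le> 1" "cmod z \<le> p \<Longrightarrow> bump p q z = 1"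
proof -
  have "continuous_on UNIV (bump p q)"
    unfolding bump_def[abs_def] using assms by (intro continuous_intros) auto
  moreover have "bump p q z = 0" if "cmod z > q" for z
  proof -
    have "(q - cmod z) / (q - p) \<le> 0" using assms that by (intro divide_nonpos_pos) auto
    thus ?thesis by (simp add: bump_def)
  qed
  ultimately show "supported_in (bump p q) q" by (simp add: supported_in_def)
  show "0 \<le> bump p q z" "\<bar>bump p q z\<bar> \<le> 1" by (auto simp: bump_def)
  show "bump p q z = 1" if "cmod z \<le> p"
  proof -
    have "1 \<le> (q - cmod z) / (q - p)" using assms that by (simp add: le_divide_eq)
    thus ?thesis by (simp add: bump_def)
  qed
qed

text \<open>Counting zeros is dominated by a smeared bump function, so the number of zeros per \<open>n\<close>
  stays bounded as soon as \<open>ln |H| / n\<close> is close to the potential.\<close>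

lemma zero_sum_limit:
  assumes a: "0 < \<alpha>" "\<alpha> \<noteq> 1" and x: "0 \<le> x" and s: "0 < s" "x + 4 * s \<in> radii \<alpha>"
    and \<phi>: "supported_in \<phi> x" and \<epsilon>: "\<epsilon> > 0"
  shows "\<exists>\<delta>>0. \<forall>n>0. \<forall>c. subexponential c \<longrightarrow> (\<exists>k. c k \<noteq> 0) \<longrightarrow>
    (\<integral>\<^sup>+w. log_gap \<alpha> c n w * indicator (cball 0 (x + 4 * s)) w \<partial>lborel) \<le> ennreal \<delta> \<longrightarrow>
    \<bar>zero_sum (H \<alpha> c n) (x + 4 * s) \<phi> / n - (\<integral>z. radial_density \<alpha> (cmod z) * \<phi> z \<partial>lborel)\<bar> \<le> \<epsilon>"
proof -
  let ?Y = "x + 4 * s" and ?p = "\<lambda>z. potential \<alpha> (cmod z)"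
  have Y0: "?Y > 0" using x s by simp
  \<comment> \<open>Layers of width s: the smeared \<phi> lives within x + s, \<beta> is 1 up to x +
    2 s and vanishes beyond x + 3 s, and the circles about points of its support stay within x + 4
    s.\<close>
  define \<beta> where "\<beta> = bump (x + 2 * s) (x + 3 * s)"
  have b: "supported_in \<beta> (x + 3 * s)" "\<And>z. 0 \<le> \<beta> z" "\<And>z. \<bar>\<beta> z\<bar> \<le> 1" "\<And>z. cmod z \<le> x + 2 * s \<Longrightarrow> \<beta> z = 1"
    unfolding \<beta>_def using bump[of "x + 2 * s" "x + 3 * s"] s by auto
  define \<rho> where "\<rho> = s / 2"
  have \<rho>: "\<rho> > 0" using s by (simp add: \<rho>_def)
  \<comment> \<open>Bound for the number of zeros per n within radius x + s. The summand 2 is the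
    error in \<open>circ_diff_gap\<close> for a test function bounded by 1 and \<delta> \<le>
    1.\<close>
  define T where "T = (\<bar>circ_diff \<rho> \<beta> ?p\<bar> + 2) / jmass \<rho>"
  have T: "T \<ge> 0" using jmass_pos[OF \<rho>] by (simp add: T_def)
  have y1: "x + s \<in> radii \<alpha>" using s x by (auto simp: radii_def split: if_splits)
  \<comment> \<open>Half of \<epsilon> covers the mollification errors: T weighs the one for the
    zeros, \<open>crit\<close> the one for the limit measure, and the 1 keeps the denominator
    positive.\<close>
  define \<eta> where "\<eta> = \<epsilon> / (2 * (T + crit \<alpha> (x + s) + 1))"
  have den: "T + crit \<alpha> (x + s) + 1 > 0" using T crit_nonneg[of \<alpha> "x + s"] by linarith
  have \<eta>: "\<eta> > 0" using \<epsilon> den by (simp add: \<eta>_def)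
  have \<eta>2: "\<eta> * T + \<eta> * crit \<alpha> (x + s) \<le> \<epsilon> / 2"
  proof -
    have "\<eta> * (T + crit \<alpha> (x + s)) \<le> \<eta> * (T + crit \<alpha> (x + s) + 1)" using \<eta> by (intro mult_left_mono) auto
    also have "\<dots> = \<epsilon> / 2" using den by (simp add: \<eta>_def field_simps)
    finally show ?thesis by (simp add: distrib_left)
  qed
  obtain d where d: "d > 0" "\<And>a z. cmod (a - z) < d \<Longrightarrow> \<bar>\<phi> a - \<phi> z\<bar> \<le> \<eta>" using supported_in_modulus[OF \<phi> \<eta>] by blast
  define r where "r = min d s"
  have r: "0 < r" "r \<le> s" "r \<le> d" using d s by (auto simp: r_def)
  have J: "jmass r > 0" by (rule jmass_pos[OF r(1)])
  obtain B where B: "B > 0" "\<And>z. \<bar>\<phi> z\<bar> \<le> B" using supported_in_bounded[OF \<phi>] by blast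
  \<comment> \<open>The other half of \<epsilon> pays for the difference of the circle differences,
    2 B \<delta>, after division by \<open>jmass r\<close>.\<close>
  define \<delta> where "\<delta> = min 1 (\<epsilon> * jmass r / (4 * B))"
  have \<delta>: "\<delta> > 0" "\<delta> \<le> 1" "2 * B * \<delta> / jmass r \<le> \<epsilon> / 2"
  proof -
    show "\<delta> > 0" "\<delta> \<le> 1" using \<epsilon> J B by (auto simp: \<delta>_def)
    have "\<delta> \<le> \<epsilon> * jmass r / (4 * B)" by (simp add: \<delta>_def)
    thus "2 * B * \<delta> / jmass r \<le> \<epsilon> / 2" using J B by (simp add: field_simps)
  qed
  let ?s = "\<lambda>z. smear r \<phi> z / jmass r"
  let ?\<chi> = "\<lambda>z::complex. if cmod z \<le> x + s then 1 else 0 :: real"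
  have near: "\<bar>?s z - \<phi> z\<bar> \<le> \<eta> * ?\<chi> z" for z
  proof (cases "cmod z \<le> x + s")
    case True
    have "\<bar>smear r \<phi> z - \<phi> z * jmass r\<bar> \<le> \<eta> * jmass r"
      by (rule smear_approx[OF r(1) \<phi>]) (use d r in auto)
    moreover have "?s z - \<phi> z = (smear r \<phi> z - \<phi> z * jmass r) / jmass r" using J by (simp add: field_simps)
    ultimately have "\<bar>?s z - \<phi> z\<bar> \<le> \<eta>" using J by (simp add: abs_divide divide_le_eq)
    thus ?thesis using True by simp
  next
    case False
    moreover have "smear r \<phi> z = 0" by (rule smear_eq_0[OF r(1) \<phi>]) (use False r in auto)
    moreover have "\<phi> z = 0" using \<phi> False s by (auto simp: supported_in_def)
    ultimately show ?thesis by simp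
  qed
  have sm: "smear r \<phi> \<in> borel_measurable borel" and pm: "\<phi> \<in> borel_measurable borel"
    using measurable_smear[OF \<phi>] supported_in_measurable[OF \<phi>] by auto
  have third: "\<bar>(\<integral>z. radial_density \<alpha> (cmod z) * ?s z \<partial>lborel) - (\<integral>z. radial_density \<alpha> (cmod z) * \<phi> z \<partial>lborel)\<bar> \<le> \<eta> * crit \<alpha> (x + s)"
  proof -
    have i\<phi>: "integrable lborel (\<lambda>z. radial_density \<alpha> (cmod z) * \<phi> z)"
      by (rule lim_density_integrable(1)[OF a y1 pm B(2)]) (use \<phi> s in \<open>auto simp: supported_in_def\<close>)
    have dm: "(\<lambda>z. ?s z - \<phi> z) \<in> borel_measurable borel" using sm pm by measurable
    have db: "\<bar>?s z - \<phi> z\<bar> \<le> \<eta>" and d0: "cmod z > x + s \<Longrightarrow> ?s z - \<phi> z = 0" for z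
      using near[of z] \<eta> by (auto split: if_splits)
    note D = lim_density_integrable[OF a y1 dm db d0]
    have "(\<integral>z. radial_density \<alpha> (cmod z) * ?s z \<partial>lborel) = 
       (\<integral>z. radial_density \<alpha> (cmod z) * (?s z - \<phi> z) + radial_density \<alpha> (cmod z) * \<phi> z \<partial>lborel)"
      by (simp add: algebra_simps)
    also have "\<dots> = (\<integral>z. radial_density \<alpha> (cmod z) * (?s z - \<phi> z) \<partial>lborel) + (\<integral>z. radial_density \<alpha> (cmod z) * \<phi> z \<partial>lborel)"
      by (rule Bochner_Integration.integral_add[OF D(1) i\<phi>])
    finally show ?thesis using D(2) by simp
  qed
  have "\<bar>zero_sum (H \<alpha> c n) ?Y \<phi> / n - (\<integral>z. radial_density \<alpha> (cmod z) * \<phi> z \<partial>lborel)\<bar> \<le> \<epsilon>"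
    if n: "n > 0" and c: "subexponential c" "c k \<noteq> 0"
      and gap: "(\<integral>\<^sup>+w. log_gap \<alpha> c n w * indicator (cball 0 ?Y) w \<partial>lborel) \<le> ennreal \<delta>" for n c k
  proof -
    let ?G = "H \<alpha> c n" and ?u = "\<lambda>z. ln (cmod (H \<alpha> c n z))"
    interpret analytic_fn ?G ?Y by (rule analytic_fn_H[OF a n c s(2) Y0])
    have rn: "real n > 0" using n by simp
    have zs_scale: "zero_sum ?G ?Y (\<lambda>z. k * f z) = k * zero_sum ?G ?Y f" for k f
      unfolding zero_sum_eq sum_distrib_left by (intro sum.cong refl mult.left_commute)
    have zs_div: "zero_sum ?G ?Y (\<lambda>z. f z / k) = zero_sum ?G ?Y f / k" for k f
      using zs_scale[of "1 / k" f] by simp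
    have "zero_sum ?G ?Y ?\<chi> \<le> zero_sum ?G ?Y (\<lambda>z. 1 / jmass \<rho> * smear \<rho> \<beta> z)"
    proof (rule zero_sum_mono)
      fix z
      show "?\<chi> z \<le> 1 / jmass \<rho> * smear \<rho> \<beta> z"
      proof (cases "cmod z \<le> x + s")
        case True
        \<comment> \<open>\<beta> is constant on the disc of radius \<rho> about z, so here the
          mollification has error 0.\<close>
        have "\<bar>smear \<rho> \<beta> z - \<beta> z * jmass \<rho>\<bar> \<le> 0 * jmass \<rho>"
        proof (rule smear_approx[OF \<rho> b(1)])
          fix w assume "cmod (w - z) < \<rho>"
          hence "cmod w \<le> x + 2 * s" using True norm_triangle_sub[of w z] s by (simp add: \<rho>_def)
          thus "\<bar>\<beta> w - \<beta> z\<bar> \<le> 0" using b(4) True s by simp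
        qed
        hence "smear \<rho> \<beta> z = jmass \<rho>" using b(4)[of z] True s by simp
        thus ?thesis using True jmass_pos[OF \<rho>] by simp
      next
        case False
        have "0 \<le> smear \<rho> \<beta> z" unfolding smear_def
          using b(2) jkernel_nonneg[OF \<rho>] by (intro integral_nonneg_AE) auto
        thus ?thesis using False jmass_pos[OF \<rho>] by simp
      qed
    qed
    also have "\<dots> = circ_diff \<rho> \<beta> ?u / jmass \<rho>"
      using circ_diff_ln(1)[OF b(1) \<rho>] s by (simp add: zs_div \<rho>_def)
    also have "\<dots> \<le> n * T"
    proof -
      have "\<bar>circ_diff \<rho> \<beta> ?u / n - circ_diff \<rho> \<beta> ?p\<bar> \<le> 2 * 1 * \<delta>"
        by (rule circ_diff_gap[OF a n s(2) Y0 c b(1,3) \<rho> _ gap]) (use s \<delta> in \<open>auto simp: \<rho>_def\<close>)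
      hence "circ_diff \<rho> \<beta> ?u / n \<le> \<bar>circ_diff \<rho> \<beta> ?p\<bar> + 2" using \<delta> by linarith
      hence "circ_diff \<rho> \<beta> ?u \<le> n * (\<bar>circ_diff \<rho> \<beta> ?p\<bar> + 2)" using rn by (simp add: field_simps)
      thus ?thesis using jmass_pos[OF \<rho>] by (simp add: T_def divide_right_mono)
    qed
    finally have count: "zero_sum ?G ?Y ?\<chi> \<le> n * T" .
    have "\<bar>zero_sum ?G ?Y ?s - zero_sum ?G ?Y \<phi>\<bar> \<le> zero_sum ?G ?Y (\<lambda>z. \<eta> * ?\<chi> z)" by (rule zero_sum_approx[OF near])
    also have "\<dots> = \<eta> * zero_sum ?G ?Y ?\<chi>" by (rule zs_scale)
    also have "\<dots> \<le> \<eta> * (n * T)" using count \<eta> by (intro mult_left_mono) auto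
    finally have "\<bar>zero_sum ?G ?Y ?s - zero_sum ?G ?Y \<phi>\<bar> / n \<le> \<eta> * (n * T) / n" by (rule divide_right_mono) simp
    hence first: "\<bar>zero_sum ?G ?Y ?s / n - zero_sum ?G ?Y \<phi> / n\<bar> \<le> \<eta> * T"
      using rn by (simp flip: diff_divide_distrib add: abs_divide)
    have zs: "zero_sum ?G ?Y ?s = circ_diff r \<phi> ?u / jmass r"
      using circ_diff_ln(1)[OF \<phi> r(1)] r s by (simp add: zs_div)
    have lim: "(\<integral>z. radial_density \<alpha> (cmod z) * ?s z \<partial>lborel) = circ_diff r \<phi> ?p / jmass r"
      using circ_diff_potential[OF a s(2) \<phi> r(1)] r s by simp
    have "\<bar>circ_diff r \<phi> ?u / n - circ_diff r \<phi> ?p\<bar> \<le> 2 * B * \<delta>"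
      by (rule circ_diff_gap[OF a n s(2) Y0 c \<phi> B(2) r(1) _ gap]) (use r s \<delta> in auto)
    hence "\<bar>circ_diff r \<phi> ?u / n - circ_diff r \<phi> ?p\<bar> / jmass r \<le> 2 * B * \<delta> / jmass r" using J by (intro divide_right_mono) auto
    moreover have "\<bar>circ_diff r \<phi> ?u / n - circ_diff r \<phi> ?p\<bar> / jmass r = \<bar>circ_diff r \<phi> ?u / jmass r / n - circ_diff r \<phi> ?p / jmass r\<bar>"
      using J by (simp add: diff_divide_distrib[symmetric] abs_divide) (simp add: field_simps)
    ultimately have second: "\<bar>zero_sum ?G ?Y ?s / n - (\<integral>z. radial_density \<alpha> (cmod z) * ?s z \<partial>lborel)\<bar> \<le> \<epsilon> / 2"
      unfolding zs lim using \<delta>(3) by linarith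
    show ?thesis using first second third \<eta>2 by linarith
  qed
  thus ?thesis using \<delta>(1) by blast
qed

text \<open>Its purpose is measurability: the locations of the zeros are not explicit in the
  coefficients, but the circle differences of ln |G| are integrals that depend measurably on
  them.\<close>

lemma zero_sum_smear_tendsto:
  assumes G: "analytic_fn G Y" and s: "0 < s" "x + s < Y" and \<phi>: "supported_in \<phi> x"
  shows "(\<lambda>i. circ_diff (s / real (Suc i)) \<phi> (\<lambda>z. ln (cmod (G z))) / jmass (s / real (Suc i))) \<longlonglongrightarrow> zero_sum G Y \<phi>"
proof -
  interpret analytic_fn G Y by fact
  let ?r = "\<lambda>i. s / real (Suc i)"
  have r: "0 < ?r i" "?r i \<le> s" for i using s by (auto simp: divide_le_eq)
  have eq: "circ_diff (?r i) \<phi> (\<lambda>z. ln (cmod (G z))) / jmass (?r i) = (\<Sum>z\<in>Z. zorder G z * (smear (?r i) \<phi> z / jmass (?r i)))" for i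
  proof -
    have "x + ?r i < Y" using r(2)[of i] s by linarith
    from circ_diff_ln(1)[OF \<phi> r(1) this] show ?thesis by (simp add: zero_sum_eq sum_divide_distrib)
  qed
  have lim: "(\<lambda>i. smear (?r i) \<phi> z / jmass (?r i)) \<longlonglongrightarrow> \<phi> z" for z
  proof (rule LIMSEQ_I)
    fix \<eta> :: real assume "\<eta> > 0"
    hence \<eta>: "\<eta> / 2 > 0" by simp
    obtain d where d: "d > 0" "\<And>a z. cmod (a - z) < d \<Longrightarrow> \<bar>\<phi> a - \<phi> z\<bar> \<le> \<eta> / 2" using supported_in_modulus[OF \<phi> \<eta>] by blast
    have "(\<lambda>i. s * (1 / real (Suc i))) \<longlonglongrightarrow> s * 0" by (intro tendsto_mult tendsto_const LIMSEQ_Suc[OF lim_1_over_n])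
    hence "eventually (\<lambda>i. s * (1 / real (Suc i)) < d) sequentially" using d by (intro order_tendstoD) auto
    then obtain N where N: "\<And>i. i \<ge> N \<Longrightarrow> ?r i < d" by (auto simp: eventually_sequentially)
    show "\<exists>N. \<forall>i\<ge>N. norm (smear (?r i) \<phi> z / jmass (?r i) - \<phi> z) < \<eta>"
    proof (intro exI allI impI)
      fix i assume i: "i \<ge> N"
      have J: "jmass (?r i) > 0" by (rule jmass_pos[OF r(1)])
      have "\<bar>smear (?r i) \<phi> z - \<phi> z * jmass (?r i)\<bar> \<le> \<eta> / 2 * jmass (?r i)"
        by (rule smear_approx[OF r(1) \<phi>]) (use d N[OF i] in auto)
      moreover have "smear (?r i) \<phi> z / jmass (?r i) - \<phi> z = (smear (?r i) \<phi> z - \<phi> z * jmass (?r i)) / jmass (?r i)"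
        using J by (simp add: diff_divide_distrib)
      ultimately have "\<bar>smear (?r i) \<phi> z / jmass (?r i) - \<phi> z\<bar> \<le> \<eta> / 2" using J by (simp add: abs_divide pos_divide_le_eq)
      thus "norm (smear (?r i) \<phi> z / jmass (?r i) - \<phi> z) < \<eta>" using \<open>\<eta> > 0\<close> by simp
    qed
  qed
  show ?thesis unfolding eq zero_sum_eq by (intro tendsto_sum tendsto_mult tendsto_const lim)
qed

section \<open>Convergence of the zero measures\<close>

lemma scale_measure_eq_density: "scale_measure r M = density M (\<lambda>_. r)"
  by (rule measure_eqI) (auto simp: emeasure_density_const)

lemma integral_scale_measure:
  fixes f :: "'b \<Rightarrow> real"
  assumes "f \<in> borel_measurable M" "r \<ge> 0"
  shows "integral\<^sup>L (scale_measure (ennreal r) M) f = r * integral\<^sup>L M f"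
  unfolding scale_measure_eq_density using assms by (subst integral_density) auto

lemma sets_zeros_measure [simp]: "sets (zeros_measure U G) = sets (restrict_space borel U)"
  and space_zeros_measure [simp]: "space (zeros_measure U G) = U"
  by (simp_all add: zeros_measure_def space_restrict_space)

lemma zeros_measure_embedding:
  "(\<lambda>z. z) \<in> measurable (point_measure {z \<in> U. G z = 0} (\<lambda>z. ennreal (of_int (zorder G z)))) (restrict_space borel U)"
  by (simp add: measurable_point_measure_eq1 space_restrict_space Pi_def)

text \<open>The support of \<phi> lies in a compact disc with finitely many zeros, so the integral
  over a possibly infinite zero set collapses to a finite sum.\<close>

lemma integral_zeros_measure:
  assumes G: "G holomorphic_on U" "open U" "connected U" "\<exists>z\<in>U. G z \<noteq> 0" and Y: "cball 0 Y \<subseteq> U"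
    and \<phi>: "supported_in \<phi> x" "x \<le> Y"
  shows "integral\<^sup>L (zeros_measure U G) \<phi> = zero_sum G Y \<phi>"
proof -
  let ?A = "{z \<in> U. G z = 0}"
  let ?Z = "{z. z \<in> cball 0 Y \<and> G z = 0}"
  note [measurable] = supported_in_measurable[OF \<phi>(1)]
  have m: "\<phi> \<in> borel_measurable (restrict_space borel U)" by (intro measurable_restrict_space1) measurable
  have ord: "zorder G z \<ge> 0" if "z \<in> ?A" for z
    using zorder_holomorphic_zero[OF G(1-3) _ G(4), of z] that by auto
  have fin: "finite ?Z" using holomorphic_finite_zeros[OF G(1-3) _ Y G(4)] by simp
  have sub: "{z \<in> ?A. of_int (zorder G z) * \<phi> z \<noteq> 0} \<subseteq> ?Z"
    using \<phi> by (auto simp: supported_in_def) (meson order_trans not_le)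
  have "integral\<^sup>L (zeros_measure U G) \<phi> = integral\<^sup>L (point_measure ?A (\<lambda>z. ennreal (of_int (zorder G z)))) \<phi>"
    unfolding zeros_measure_def by (rule integral_distr[OF zeros_measure_embedding m])
  also have "\<dots> = (\<integral>z. of_int (zorder G z) * \<phi> z \<partial>count_space ?A)"
    unfolding point_measure_def using ord by (subst integral_density) (auto intro!: AE_I2)
  also have "\<dots> = (\<Sum>z | z \<in> ?A \<and> of_int (zorder G z) * \<phi> z \<noteq> 0. of_int (zorder G z) * \<phi> z)"
    by (rule lebesgue_integral_count_space_finite_support) (rule finite_subset[OF sub fin])
  also have "\<dots> = (\<Sum>z\<in>?Z. of_int (zorder G z) * \<phi> z)"
    by (rule sum.mono_neutral_left[OF fin sub]) (use Y in auto)
  finally show ?thesis by (simp add: zero_sum_def)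
qed

lemma locally_finite_zeros_measure:
  assumes G: "G holomorphic_on U" "open U" "connected U" "\<exists>z\<in>U. G z \<noteq> 0"
  shows "locally_finite_on U (scale_measure (ennreal c) (zeros_measure U G))"
  unfolding locally_finite_on_def
proof (intro conjI allI impI)
  fix K assume K: "compact K \<and> K \<subseteq> U"
  let ?A = "{z \<in> U. G z = 0}"
  have "K \<in> sets borel" using K by (simp add: compact_imp_closed)
  hence Ks: "K \<in> sets (restrict_space borel U)" using K G(2) by (subst sets_restrict_space_iff) auto
  have eq: "K \<inter> ?A = {z \<in> K. G z = 0}" using K by auto
  have fin: "finite {z \<in> K. G z = 0}" using holomorphic_finite_zeros[OF G(1-3) _ _ G(4)] K by blast
  have "emeasure (zeros_measure U G) K = emeasure (point_measure ?A (\<lambda>z. ennreal (of_int (zorder G z)))) {z \<in> K. G z = 0}"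
    unfolding zeros_measure_def
    by (subst emeasure_distr[OF zeros_measure_embedding Ks]) (simp add: space_point_measure eq)
  also have "\<dots> = (\<Sum>z\<in>{z \<in> K. G z = 0}. ennreal (of_int (zorder G z)))"
    using K fin by (intro emeasure_point_measure_finite2) auto
  also have "\<dots> < \<infinity>" using fin by (simp add: less_top[symmetric])
  finally show "emeasure (scale_measure (ennreal c) (zeros_measure U G)) K < \<infinity>"
    by (simp add: ennreal_mult_less_top)
qed simp

lemma compact_in_H_domain:
  assumes K: "compact K" "K \<subseteq> H_domain \<alpha>"
  obtains x where "0 \<le> x" "x \<in> radii \<alpha>" "K \<subseteq> cball 0 x"
proof (cases "K = {}")
  case True
  thus ?thesis using that[of 0] by (auto simp: radii_def)
next
  case False
  have "continuous_on K cmod" by (intro continuous_intros)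
  from continuous_attains_sup[OF K(1) False this] obtain w where w: "w \<in> K" "\<And>z. z \<in> K \<Longrightarrow> cmod z \<le> cmod w" by blast
  show ?thesis using w K(2) by (intro that[of "cmod w"]) (auto simp: mem_H_domain)
qed

lemma locally_finite_limit_measure:
  assumes a: "0 < \<alpha>" "\<alpha> \<noteq> 1"
  shows "locally_finite_on (H_domain \<alpha>) (limit_measure \<alpha>)"
  unfolding locally_finite_on_def
proof (intro conjI allI impI)
  show s: "sets (limit_measure \<alpha>) = sets (restrict_space borel (H_domain \<alpha>))"
    by (simp add: limit_measure_def cong: sets_restrict_space_cong)
  fix K assume K: "compact K \<and> K \<subseteq> H_domain \<alpha>"
  then obtain x where x: "x \<in> radii \<alpha>" "K \<subseteq> cball 0 x" using compact_in_H_domain by blast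
  have Kb [measurable]: "K \<in> sets borel" using K by (simp add: compact_imp_closed)
  have "K \<in> sets (limit_measure \<alpha>)" unfolding s using K by (subst sets_restrict_space_iff) auto
  hence "emeasure (limit_measure \<alpha>) K = (\<integral>\<^sup>+z. indicator K z \<partial>limit_measure \<alpha>)" by simp
  also have "\<dots> = (\<integral>\<^sup>+z. lim_density \<alpha> z * indicator K z \<partial>lborel)" by (rule nn_integral_limit_measure[OF a]) measurable
  also have "\<dots> \<le> (\<integral>\<^sup>+z. lim_density \<alpha> z * indicator (cball 0 x) z \<partial>lborel)"
    using x by (intro nn_integral_mono mult_left_mono) (auto simp: indicator_def)
  also have "\<dots> = ennreal (crit \<alpha> x)" by (rule emeasure_lim_cball[OF a x(1)])
  finally show "emeasure (limit_measure \<alpha>) K < \<infinity>" by (simp add: le_less_trans)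
qed

lemma integral_limit_measure:
  assumes a: "0 < \<alpha>" "\<alpha> \<noteq> 1" and [measurable]: "f \<in> borel_measurable borel"
  shows "integral\<^sup>L (limit_measure \<alpha>) f = (\<integral>z. radial_density \<alpha> (cmod z) * f z \<partial>lborel)"
proof -
  let ?g = "\<lambda>z. if \<alpha> > 1 \<and> z \<in> ball 0 1 then 0 else limit_density \<alpha> z"
  have [measurable]: "ball (0::complex) 1 \<in> sets borel" by simp
  have [measurable]: "limit_density \<alpha> \<in> borel_measurable borel"
    unfolding limit_density_def by measurable
  have g [measurable]: "?g \<in> borel_measurable borel" by measurable
  have U: "H_domain \<alpha> \<inter> space lborel \<in> sets lborel" by (simp add: H_domain_def)
  have "integral\<^sup>L (limit_measure \<alpha>) f = (\<integral>z. ?g z * f z \<partial>restrict_space lborel (H_domain \<alpha>))"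
    unfolding limit_measure_def using a
    by (subst integral_density) (auto intro!: measurable_restrict_space1 AE_I2 simp: limit_density_def)
  also have "\<dots> = (\<integral>z. indicator (H_domain \<alpha>) z *\<^sub>R (?g z * f z) \<partial>lborel)"
    by (subst integral_restrict_space[OF U]) simp
  also have "\<dots> = (\<integral>z. radial_density \<alpha> (cmod z) * f z \<partial>lborel)"
    by (intro Bochner_Integration.integral_cong) (use a in \<open>auto simp: H_domain_def radial_density_def limit_density_def indicator_def\<close>)
  finally show ?thesis .
qed

text \<open>Continuity on the plane is glued from two open sets that cover it: the domain, and the
  complement of the compact support, on which the extension is 0.\<close>

lemma test_function_extension:
  assumes "test_function (H_domain \<alpha>) \<phi>"
  obtains \<psi> x s where "0 \<le> x" "0 < s" "x + 4 * s \<in> radii \<alpha>" "supported_in \<psi> x" "\<And>z. z \<in> H_domain \<alpha> \<Longrightarrow> \<psi> z = \<phi> z"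
proof -
  let ?U = "H_domain \<alpha>"
  define \<psi> where "\<psi> z = (if z \<in> ?U then \<phi> z else 0)" for z
  obtain K where cont: "continuous_on ?U \<phi>" and K: "compact K" "K \<subseteq> ?U" "\<And>z. z \<in> ?U - K \<Longrightarrow> \<phi> z = 0"
    using assms unfolding test_function_def by blast
  obtain x where x: "0 \<le> x" "x \<in> radii \<alpha>" "K \<subseteq> cball 0 x" using compact_in_H_domain[OF K(1,2)] by blast
  obtain y where y: "x < y" "y \<in> radii \<alpha>" using radii_room[OF x(2)] by blast
  have "continuous_on (?U \<union> - K) \<psi>"
  proof (rule continuous_on_open_Un)
    show "continuous_on ?U \<psi>" by (rule continuous_on_eq[OF cont]) (simp add: \<psi>_def)
    show "continuous_on (- K) \<psi>"
      by (rule continuous_on_eq[of _ "\<lambda>_. 0"]) (use K in \<open>auto simp: \<psi>_def\<close>)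
    show "open (- K)" using K(1) by (simp add: compact_imp_closed open_Compl)
  qed simp
  moreover have "?U \<union> - K = UNIV" using K by auto
  moreover have "\<psi> z = 0" if "cmod z > x" for z
  proof -
    have "z \<notin> K" using that x(3) by (auto dest!: subsetD)
    thus ?thesis using K(3) by (simp add: \<psi>_def)
  qed
  ultimately have "supported_in \<psi> x" by (simp add: supported_in_def)
  moreover have "x + 4 * ((y - x) / 4) = y" by (simp add: field_simps)
  hence "x + 4 * ((y - x) / 4) \<in> radii \<alpha>" using y(2) by (simp only:)
  ultimately show thesis using x y by (intro that[of x "(y - x) / 4" \<psi>]) (auto simp: \<psi>_def)
qed

text \<open>The set where f and g differ is contained in a null set, so it and all its subsets are
  measurable for the completion; a preimage under f is one under g corrected by such sets.\<close>

lemma borel_measurable_completion_AE: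
  assumes g: "g \<in> measurable M N" and ae: "AE x in M. f x = g x" and sp: "\<And>x. x \<in> space M \<Longrightarrow> f x \<in> space N"
  shows "f \<in> measurable (completion M) N"
proof (rule measurableI)
  fix A assume A: "A \<in> sets N"
  define E F where "E x \<longleftrightarrow> f x \<noteq> g x" and "F x \<longleftrightarrow> f x \<noteq> g x \<and> f x \<in> A" for x
  have [measurable]: "Measurable.pred (completion M) E" "Measurable.pred (completion M) F"
    unfolding E_def[abs_def] F_def[abs_def] by (rule sets_completion_AE, use ae in auto)+
  have [measurable]: "Measurable.pred (completion M) (\<lambda>x. g x \<in> A)"
    by (rule pred_sets2[OF A measurable_completion[OF g]])
  have "Measurable.pred (completion M) (\<lambda>x. (g x \<in> A \<and> \<not> E x) \<or> F x)" by measurable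
  moreover have "(\<lambda>x. (g x \<in> A \<and> \<not> E x) \<or> F x) = (\<lambda>x. f x \<in> A)" by (auto simp: E_def F_def)
  ultimately have "Measurable.pred (completion M) (\<lambda>x. f x \<in> A)" by simp
  hence "{x \<in> space (completion M). f x \<in> A} \<in> sets (completion M)" by (simp add: pred_def)
  moreover have "{x \<in> space (completion M). f x \<in> A} = f -` A \<inter> space (completion M)" by auto
  ultimately show "f -` A \<inter> space (completion M) \<in> sets (completion M)" by simp
qed (use sp in simp)

context random_series
begin

text \<open>H is jointly measurable in the outcome and the point, and the circle average and the
  integral over centres are parameter integrals of jointly measurable functions.\<close>

lemma measurable_circ_diff_HH [measurable]:
  assumes "supported_in \<phi> x"
  shows "(\<lambda>\<omega>. circ_diff r \<phi> (\<lambda>z. ln (cmod (HH n \<omega> z)))) \<in> borel_measurable M"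
proof -
  note [measurable] = supported_in_measurable[OF assms]
  have avg [measurable]: "(\<lambda>(\<omega>, a). circ_avg (\<lambda>z. ln (cmod (HH n \<omega> z))) a w) \<in> borel_measurable (M \<Otimes>\<^sub>M lborel)" for w
  proof -
    have "(\<lambda>(p, t). ln (cmod (HH n (fst p) (snd p + w * circ t)))) \<in> borel_measurable ((M \<Otimes>\<^sub>M lborel) \<Otimes>\<^sub>M unif01)"
    proof -
      have 1: "(\<lambda>q. (fst (fst q), snd (fst q) + w * circ (snd q))) \<in> (M \<Otimes>\<^sub>M lborel) \<Otimes>\<^sub>M unif01 \<rightarrow>\<^sub>M M \<Otimes>\<^sub>M borel"
        by measurable
      from measurable_compose[OF 1 measurable_HH_pair[of n]] show ?thesis by (simp add: split_beta)
    qed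
    thus ?thesis unfolding circ_avg_def split_beta by (intro unif01.borel_measurable_lebesgue_integral) (simp add: split_beta)
  qed
  have "(\<lambda>(\<omega>, a). \<phi> a * (circ_avg (\<lambda>z. ln (cmod (HH n \<omega> z))) a (of_real r) - circ_avg (\<lambda>z. ln (cmod (HH n \<omega> z))) a (of_real (r / 2))))
     \<in> borel_measurable (M \<Otimes>\<^sub>M lborel)"
    using avg[of "of_real r"] avg[of "of_real (r / 2)"] unfolding split_beta by measurable
  thus ?thesis unfolding circ_diff_def by (rule lborel.borel_measurable_lebesgue_integral)
qed

lemma AE_good: "AE \<omega> in M. subexponential (\<lambda>k. \<xi> k \<omega>) \<and> (\<exists>k. \<xi> k \<omega> \<noteq> 0)"
  using AE_subexponential AE_ex_nonzero by eventually_elim auto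

abbreviation zeros :: "nat \<Rightarrow> 'a \<Rightarrow> complex measure" where
  "zeros n \<omega> \<equiv> scale_measure (ennreal (1 / real n)) (zeros_measure (H_domain \<alpha>) (HH n \<omega>))"

lemma integral_zeros:
  assumes \<phi>: "\<And>z. z \<in> H_domain \<alpha> \<Longrightarrow> \<psi> z = \<phi> z" and \<psi>: "supported_in \<psi> x" "x \<le> Y" "Y \<in> radii \<alpha>" and n: "n > 0"
    and good: "subexponential (\<lambda>k. \<xi> k \<omega>)" "\<xi> k \<omega> \<noteq> 0"
  shows "integral\<^sup>L (zeros n \<omega>) \<phi> = zero_sum (HH n \<omega>) Y \<psi> / n"
proof -
  note [measurable] = supported_in_measurable[OF \<psi>(1)]
  have m: "\<psi> \<in> borel_measurable (zeros_measure (H_domain \<alpha>) (HH n \<omega>))"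
    by (subst measurable_cong_sets[OF sets_zeros_measure refl], intro measurable_restrict_space1) measurable
  have Y: "cball 0 Y \<subseteq> H_domain \<alpha>" using \<psi>(3) by (auto simp: mem_H_domain radii_def split: if_splits)
  have "integral\<^sup>L (zeros n \<omega>) \<phi> = integral\<^sup>L (zeros n \<omega>) \<psi>"
    by (intro Bochner_Integration.integral_cong) (auto simp: \<phi> space_scale_measure)
  also have "\<dots> = 1 / n * integral\<^sup>L (zeros_measure (H_domain \<alpha>) (HH n \<omega>)) \<psi>"
    by (rule integral_scale_measure[OF m]) simp
  also have "integral\<^sup>L (zeros_measure (H_domain \<alpha>) (HH n \<omega>)) \<psi> = zero_sum (HH n \<omega>) Y \<psi>"
    by (rule integral_zeros_measure[OF holomorphic_H[OF \<alpha> n good(1)] open_H_domain connected_H_domain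
          H_not_identically_0[OF \<alpha> n good] Y \<psi>(1,2)])
  finally show ?thesis by simp
qed

text \<open>Almost surely the integral is a limit of circle differences with radii tending to 0,
  each of them measurable. The identity holds only almost surely, hence the completion.\<close>

lemma measurable_integral_zeros:
  assumes "test_function (H_domain \<alpha>) \<phi>"
  shows "(\<lambda>\<omega>. integral\<^sup>L (zeros n \<omega>) \<phi>) \<in> borel_measurable (completion M)"
proof -
  obtain \<psi> x s where xs: "0 \<le> x" "0 < s" "x + 4 * s \<in> radii \<alpha>" and \<psi>: "supported_in \<psi> x" "\<And>z. z \<in> H_domain \<alpha> \<Longrightarrow> \<psi> z = \<phi> z"
    using test_function_extension[OF assms] by metis
  show ?thesis
  proof (cases "n > 0")
    case False
    \<comment> \<open>For n = 0 the factor 1 / real 0 is 0 and the measure is null.\<close>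
    hence "integral\<^sup>L (zeros n \<omega>) \<phi> = 0" for \<omega> by simp
    thus ?thesis by simp
  next
    case n: True
    let ?f = "\<lambda>i \<omega>. circ_diff (s / real (Suc i)) \<psi> (\<lambda>z. ln (cmod (HH n \<omega> z))) / jmass (s / real (Suc i))"
    have "(\<lambda>\<omega>. lim (\<lambda>i. ?f i \<omega>) / n) \<in> borel_measurable M"
      using measurable_circ_diff_HH[OF \<psi>(1)] by measurable
    moreover have "AE \<omega> in M. integral\<^sup>L (zeros n \<omega>) \<phi> = lim (\<lambda>i. ?f i \<omega>) / n"
      using AE_good
    proof eventually_elim
      case (elim \<omega>)
      then obtain k where good: "subexponential (\<lambda>k. \<xi> k \<omega>)" "\<xi> k \<omega> \<noteq> 0" by blast
      have Y: "x + 4 * s > 0" "x + s < x + 4 * s" using xs by auto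
      have "(\<lambda>i. ?f i \<omega>) \<longlonglongrightarrow> zero_sum (HH n \<omega>) (x + 4 * s) \<psi>"
        by (rule zero_sum_smear_tendsto[OF analytic_fn_H[OF \<alpha> n good xs(3) Y(1)] xs(2) Y(2) \<psi>(1)])
      thus ?case
        using integral_zeros[OF \<psi>(2) \<psi>(1) _ xs(3) n good] xs by (simp add: limI)
    qed
    ultimately show ?thesis by (rule borel_measurable_completion_AE) simp
  qed
qed

text \<open>With \<delta> from \<open>zero_sum_limit\<close>, a deviation above \<epsilon> is
  impossible off the exceptional event of \<open>log_gap_small\<close>, up to the null set where the
  coefficients fail to be subexponential or all vanish.\<close>

lemma zeros_converge_in_prob:
  assumes "test_function (H_domain \<alpha>) \<phi>"
  shows "converges_in_prob M (\<lambda>n \<omega>. integral\<^sup>L (zeros n \<omega>) \<phi>) (\<lambda>_. integral\<^sup>L (limit_measure \<alpha>) \<phi>)"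
  unfolding converges_in_prob_def
proof (intro conjI allI impI)
  show "(\<lambda>\<omega>. integral\<^sup>L (zeros n \<omega>) \<phi>) \<in> borel_measurable (completion M)" for n
    by (rule measurable_integral_zeros[OF assms])
  fix \<epsilon> :: real assume \<epsilon>: "\<epsilon> > 0"
  interpret C: prob_space "completion M" by (rule prob_space_completion)
  obtain \<psi> x s where xs: "0 \<le> x" "0 < s" "x + 4 * s \<in> radii \<alpha>" and \<psi>: "supported_in \<psi> x" "\<And>z. z \<in> H_domain \<alpha> \<Longrightarrow> \<psi> z = \<phi> z"
    using test_function_extension[OF assms] by metis
  have lim: "integral\<^sup>L (limit_measure \<alpha>) \<phi> = (\<integral>z. radial_density \<alpha> (cmod z) * \<psi> z \<partial>lborel)"
  proof -
    have "integral\<^sup>L (limit_measure \<alpha>) \<phi> = integral\<^sup>L (limit_measure \<alpha>) \<psi>"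
      by (intro Bochner_Integration.integral_cong) (auto simp: \<psi>(2) limit_measure_def space_restrict_space)
    thus ?thesis using integral_limit_measure[OF \<alpha> supported_in_measurable[OF \<psi>(1)]] by simp
  qed
  obtain \<delta> where \<delta>: "\<delta> > 0" "\<And>n c. n > 0 \<Longrightarrow> subexponential c \<Longrightarrow> (\<exists>k. c k \<noteq> 0) \<Longrightarrow>
    (\<integral>\<^sup>+w. log_gap \<alpha> c n w * indicator (cball 0 (x + 4 * s)) w \<partial>lborel) \<le> ennreal \<delta> \<Longrightarrow>
    \<bar>zero_sum (H \<alpha> c n) (x + 4 * s) \<psi> / n - (\<integral>z. radial_density \<alpha> (cmod z) * \<psi> z \<partial>lborel)\<bar> \<le> \<epsilon>"
    using zero_sum_limit[OF \<alpha> xs \<psi>(1) \<epsilon>] by blast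
  let ?E = "\<lambda>n. {\<omega> \<in> space M. \<bar>integral\<^sup>L (zeros n \<omega>) \<phi> - integral\<^sup>L (limit_measure \<alpha>) \<phi>\<bar> > \<epsilon>}"
  show "(\<lambda>n. measure (completion M) (?E n)) \<longlonglongrightarrow> 0"
  proof (rule LIMSEQ_I)
    fix \<eta> :: real assume "\<eta> > 0"
    hence "\<eta> / 2 > 0" by simp
    from log_gap_small[OF xs(3) \<delta>(1) this] eventually_gt_at_top[of 0]
    have "eventually (\<lambda>n. measure (completion M) (?E n) < \<eta>) sequentially"
    proof eventually_elim
      case (elim n)
      then obtain B where B: "B \<in> events" "prob B \<le> \<eta> / 2" "\<And>\<omega>. \<omega> \<in> space M - B \<Longrightarrow> subexponential (\<lambda>k. \<xi> k \<omega>) \<Longrightarrow>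
        (\<integral>\<^sup>+w. log_gap \<alpha> (\<lambda>k. \<xi> k \<omega>) n w * indicator (cball 0 (x + 4 * s)) w \<partial>lborel) \<le> ennreal \<delta>" by blast
      have "AE \<omega> in M. \<omega> \<in> ?E n \<longrightarrow> \<omega> \<in> B"
        using AE_good
      proof eventually_elim
        case e: (elim \<omega>)
        then obtain k where good: "subexponential (\<lambda>k. \<xi> k \<omega>)" "\<xi> k \<omega> \<noteq> 0" by blast
        show ?case
        proof (intro impI, rule ccontr)
          assume \<omega>: "\<omega> \<in> ?E n" "\<omega> \<notin> B"
          hence "\<omega> \<in> space M - B" by auto
          from \<delta>(2)[OF _ _ _ B(3)[OF this good(1)]] e elim
          have "\<bar>zero_sum (HH n \<omega>) (x + 4 * s) \<psi> / n - (\<integral>z. radial_density \<alpha> (cmod z) * \<psi> z \<partial>lborel)\<bar> \<le> \<epsilon>" by blast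
          hence "\<bar>integral\<^sup>L (zeros n \<omega>) \<phi> - integral\<^sup>L (limit_measure \<alpha>) \<phi>\<bar> \<le> \<epsilon>"
            using integral_zeros[OF \<psi>(2) \<psi>(1) _ xs(3) _ good] xs elim by (simp add: lim)
          thus False using \<omega> by auto
        qed
      qed
      \<comment> \<open>The deviation event is measured by the completion, so the inclusion up to a
        null set is carried over to it before the probabilities are compared.\<close>
      hence "AE \<omega> in completion M. \<omega> \<in> ?E n \<longrightarrow> \<omega> \<in> B" by (rule AE_completion)
      hence "measure (completion M) (?E n) \<le> measure (completion M) B"
        by (rule C.finite_measure_mono_AE) (use B(1) in simp)
      thus ?case using B \<open>\<eta> > 0\<close> by simp
    qed
    thus "\<exists>N. \<forall>n\<ge>N. norm (measure (completion M) (?E n) - 0) < \<eta>"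
      by (auto simp: eventually_sequentially)
  qed
qed simp

lemma zeros_locally_finite: "AE \<omega> in M. locally_finite_on (H_domain \<alpha>) (zeros n \<omega>)"
proof (cases "n > 0")
  case False
  hence "locally_finite_on (H_domain \<alpha>) (zeros n \<omega>)" for \<omega> by (simp add: locally_finite_on_def)
  thus ?thesis by simp
next
  case n: True
  show ?thesis
    using AE_good
  proof eventually_elim
    case (elim \<omega>)
    then obtain k where good: "subexponential (\<lambda>k. \<xi> k \<omega>)" "\<xi> k \<omega> \<noteq> 0" by blast
    show ?case
      by (rule locally_finite_zeros_measure[OF holomorphic_H[OF \<alpha> n good(1)] open_H_domain connected_H_domain
            H_not_identically_0[OF \<alpha> n good]])
  qed
qed

end

theorem theorem2p8:
  fixes M :: "'a measure" and \<xi> :: "nat \<Rightarrow> 'a \<Rightarrow> complex" and \<alpha> :: real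
  assumes "prob_space M"
    and "\<alpha> \<in> {0<..<1} \<union> {1<..}"
    and "iid M \<xi>"
    and "nondegenerate M (\<xi> 0)"
    and "integrable M (\<lambda>\<omega>. ln (1 + cmod (\<xi> 0 \<omega>)))"
  shows "measures_converge_in_prob M (H_domain \<alpha>)
    (\<lambda>n \<omega>. scale_measure (ennreal (1 / real n))
       (zeros_measure (H_domain \<alpha>) (H \<alpha> (\<lambda>k. \<xi> k \<omega>) n)))
    (\<lambda>_. limit_measure \<alpha>)"
proof -
  interpret prob_space M by fact
  interpret random_series M \<xi> \<alpha>
    by unfold_locales (use assms in auto)
  show ?thesis
    unfolding measures_converge_in_prob_def
    using zeros_locally_finite zeros_converge_in_prob locally_finite_limit_measure[OF \<alpha>] by simp
qed

end
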